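(* Let $X$ be a compact length space. Then $X$ is a polyhedral space if and only if for every point $x\in X$ there exist a neighborhood $U$ of $x$, a Euclidean cone $K_x$, and an open distance-preserving embedding $\iota\colon U\to K_x$ (where $U$ carries the metric restricted from $X$) which sends $x$ to the tip of $K_x$.
   Context: A metric space is a length space if the distance between any two points equals the infimum of the lengths of curves connecting them. No assumption is made on the dimension of $X$. A length space is called a polyhedral space if it admits a finite triangulation such that each simplex, with the metric restricted from the space, is (globally) isometric to a simplex in a Euclidean space. Euclidean cone: let $\Sigma$ be a metric space of diameter at most $\pi$. Let $K=([0,\infty)\times\Sigma)/\sim$, where $(0,x)\sim(0,y)$ for all $x,y\in\Sigma$, equipped with the metric $$|(a,x)-(b,y)|_K^2=a^2+b^2-2ab\cos|x-y|_\Sigma,\qquad a,b\in[0,\infty),\ x,y\in\Sigma.$$ Then $K$ is called the Euclidean cone over $\Sigma$; the point represented by all pairs $(0,x)$ is called its tip. A one-point space is also regarded as a Euclidean cone (the cone over $\Sigma=\emptyset$), whose tip is its only point. *)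

theory Defs
  imports "HOL-Analysis.Analysis" "HOL-Homology.Simplices"
begin

section \<open>Length spaces\<close>

text \<open>Curves are parametrised by the unit interval. The value is \<open>\<infinity>\<close> for curves
  that are not rectifiable.\<close>

definition curve_length :: "('a \<Rightarrow> 'a \<Rightarrow> real) \<Rightarrow> (real \<Rightarrow> 'a) \<Rightarrow> ereal" where
  "curve_length d \<gamma> =
     (SUP (n, t) \<in> {(n :: nat, t :: nat \<Rightarrow> real). mono_on {..n} t \<and> t ` {..n} \<subseteq> {0..1}}.
        ereal (\<Sum>i<n. d (\<gamma> (t i)) (\<gamma> (t (Suc i)))))"

text \<open>The infimum over the empty set of curves is \<open>\<infinity>\<close>, so a length space is
  path connected.\<close>

definition length_space :: "'a set \<Rightarrow> ('a \<Rightarrow> 'a \<Rightarrow> real) \<Rightarrow> bool" where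
  "length_space X d \<longleftrightarrow> Metric_space X d \<and>
     (\<forall>x\<in>X. \<forall>y\<in>X. ereal (d x y) =
        Inf {curve_length d \<gamma> | \<gamma>. pathin (Metric_space.mtopology X d) \<gamma> \<and> \<gamma> 0 = x \<and> \<gamma> 1 = y})"

section \<open>Polyhedral spaces\<close>

definition finite_simplicial_complex :: "nat set set \<Rightarrow> bool" where
  "finite_simplicial_complex K \<longleftrightarrow> finite K \<and>
     (\<forall>\<sigma>\<in>K. finite \<sigma> \<and> \<sigma> \<noteq> {}) \<and>
     (\<forall>\<sigma>\<in>K. \<forall>\<tau>. \<tau> \<subseteq> \<sigma> \<and> \<tau> \<noteq> {} \<longrightarrow> \<tau> \<in> K)"

text \<open>Points of the geometric realization are given by their barycentric coordinates,
  one for each vertex. For a finite complex the usual topology of the realization is the one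
  induced by the product topology.\<close>

definition closed_simplex :: "nat set \<Rightarrow> (nat \<Rightarrow> real) set" where
  "closed_simplex \<sigma> = {t. (\<forall>i. 0 \<le> t i) \<and> (\<forall>i. i \<notin> \<sigma> \<longrightarrow> t i = 0) \<and> sum t \<sigma> = 1}"

definition realization :: "nat set set \<Rightarrow> (nat \<Rightarrow> real) topology" where
  "realization K = subtopology (powertop_real UNIV) (\<Union>\<sigma>\<in>K. closed_simplex \<sigma>)"

definition affinely_independent :: "nat \<Rightarrow> (nat \<Rightarrow> nat \<Rightarrow> real) \<Rightarrow> bool" where
  "affinely_independent k v \<longleftrightarrow>
     (\<forall>c. (\<Sum>j\<le>k. c j) = 0 \<and> (\<forall>i. (\<Sum>j\<le>k. c j * v j i) = 0) \<longrightarrow> (\<forall>j\<le>k. c j = 0))"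

text \<open>The dimension \<open>n\<close> of the ambient Euclidean space is existentially quantified, so
  \<open>\<real>\<close>\<open>\<^sup>n\<close> is modelled by \<^const>\<open>Euclidean_space\<close> with the usual distance. The image
  of \<open>oriented_simplex k v\<close> is the convex hull of \<open>v 0, \<dots>, v k\<close>.\<close>

definition isometric_to_Euclidean_simplex :: "'a set \<Rightarrow> ('a \<Rightarrow> 'a \<Rightarrow> real) \<Rightarrow> bool" where
  "isometric_to_Euclidean_simplex S d \<longleftrightarrow>
     (\<exists>n k v f. (\<forall>j\<le>k. v j \<in> topspace (Euclidean_space n)) \<and>
        affinely_independent k v \<and>
        f ` S = oriented_simplex k v ` standard_simplex k \<and>
        (\<forall>x\<in>S. \<forall>y\<in>S. L2_set (\<lambda>i. f x i - f y i) {..<n} = d x y))"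

definition polyhedral_space :: "'a set \<Rightarrow> ('a \<Rightarrow> 'a \<Rightarrow> real) \<Rightarrow> bool" where
  "polyhedral_space X d \<longleftrightarrow> length_space X d \<and>
     (\<exists>K h. finite_simplicial_complex K \<and>
        homeomorphic_map (realization K) (Metric_space.mtopology X d) h \<and>
        (\<forall>\<sigma>\<in>K. isometric_to_Euclidean_simplex (h ` closed_simplex \<sigma>) d))"

section \<open>Euclidean cones\<close>

definition cone_base :: "'a set \<Rightarrow> ('a \<Rightarrow> 'a \<Rightarrow> real) \<Rightarrow> bool" where
  "cone_base \<Sigma> d \<longleftrightarrow> Metric_space \<Sigma> d \<and> (\<forall>x\<in>\<Sigma>. \<forall>y\<in>\<Sigma>. d x y \<le> pi)"

definition cone_rel :: "'a set \<Rightarrow> ((real \<times> 'a) \<times> (real \<times> 'a)) set" where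
  "cone_rel \<Sigma> = {(p, q). p \<in> {0..} \<times> \<Sigma> \<and> q \<in> {0..} \<times> \<Sigma> \<and> (p = q \<or> fst p = 0 \<and> fst q = 0)}"

text \<open>The tip is the class of all pairs \<open>(0, x)\<close>. If \<open>\<Sigma>\<close> is nonempty, it already
  belongs to the quotient; inserting it makes the cone over the empty set the one-point space
  \<open>{{}}\<close>.\<close>

definition cone_tip :: "'a set \<Rightarrow> (real \<times> 'a) set" where
  "cone_tip \<Sigma> = {0} \<times> \<Sigma>"

definition cone_space :: "'a set \<Rightarrow> (real \<times> 'a) set set" where
  "cone_space \<Sigma> = insert (cone_tip \<Sigma>) (({0..} \<times> \<Sigma>) // cone_rel \<Sigma>)"

definition cone_pair_dist :: "('a \<Rightarrow> 'a \<Rightarrow> real) \<Rightarrow> real \<times> 'a \<Rightarrow> real \<times> 'a \<Rightarrow> real" where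
  "cone_pair_dist d = (\<lambda>(a, x) (b, y). sqrt (a\<^sup>2 + b\<^sup>2 - 2 * a * b * cos (d x y)))"

text \<open>The choice of representatives is irrelevant, see \<open>cone_dist_class\<close> below. The first
  case only concerns the one-point cone.\<close>

definition cone_dist :: "('a \<Rightarrow> 'a \<Rightarrow> real) \<Rightarrow> (real \<times> 'a) set \<Rightarrow> (real \<times> 'a) set \<Rightarrow> real" where
  "cone_dist d P Q =
     (if P = {} \<or> Q = {} then 0
      else cone_pair_dist d (SOME p. p \<in> P) (SOME q. q \<in> Q))"

lemma cone_dist_eqI:
  assumes b: "cone_base \<Sigma> d" and P: "P \<in> cone_space \<Sigma>" and Q: "Q \<in> cone_space \<Sigma>"
    and p: "p \<in> P" and q: "q \<in> Q"
  shows "cone_dist d P Q = cone_pair_dist d p q"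
proof -
  have *: "r \<in> {0..} \<times> \<Sigma> \<and> (r = s \<or> fst r = 0 \<and> fst s = 0)"
    if "R \<in> cone_space \<Sigma>" "r \<in> R" "s \<in> R" for R r s
    using that by (auto simp: cone_space_def cone_tip_def cone_rel_def quotient_def)
  define p' q' where "p' = (SOME p. p \<in> P)" and "q' = (SOME q. q \<in> Q)"
  have "p' \<in> P" "q' \<in> Q"
    using p q by (auto simp: p'_def q'_def intro: someI)
  with *[OF P p, of p'] *[OF Q q, of q']
  have "cone_pair_dist d p' q' = cone_pair_dist d p q"
    by (auto simp: cone_pair_dist_def split: prod.splits)
  then show ?thesis
    using p q by (auto simp: cone_dist_def p'_def q'_def)
qed

lemma cone_class_in:
  assumes "a \<ge> 0" "x \<in> \<Sigma>"
  shows "cone_rel \<Sigma> `` {(a, x)} \<in> cone_space \<Sigma>" "(a, x) \<in> cone_rel \<Sigma> `` {(a, x)}"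
  using assms by (auto simp: cone_space_def cone_rel_def quotient_def)

lemma cone_class_eq:
  assumes "a \<ge> 0" "b \<ge> 0" "x \<in> \<Sigma>" "y \<in> \<Sigma>"
  shows "cone_rel \<Sigma> `` {(a, x)} = cone_rel \<Sigma> `` {(b, y)} \<longleftrightarrow> a = b \<and> (a = 0 \<or> x = y)"
proof
  assume "cone_rel \<Sigma> `` {(a, x)} = cone_rel \<Sigma> `` {(b, y)}"
  with cone_class_in(2)[OF assms(1,3)] have "(a, x) \<in> cone_rel \<Sigma> `` {(b, y)}" by simp
  then show "a = b \<and> (a = 0 \<or> x = y)" by (auto simp: cone_rel_def)
qed (use assms in \<open>auto simp: cone_rel_def\<close>)

lemma cone_dist_class:
  assumes "cone_base \<Sigma> d" "a \<ge> 0" "b \<ge> 0" "x \<in> \<Sigma>" "y \<in> \<Sigma>"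
  shows "cone_dist d (cone_rel \<Sigma> `` {(a, x)}) (cone_rel \<Sigma> `` {(b, y)}) =
    sqrt (a\<^sup>2 + b\<^sup>2 - 2 * a * b * cos (d x y))"
  using cone_dist_eqI[OF assms(1) cone_class_in(1)[OF assms(2,4)] cone_class_in(1)[OF assms(3,5)]
      cone_class_in(2)[OF assms(2,4)] cone_class_in(2)[OF assms(3,5)]]
  by (simp add: cone_pair_dist_def)

lemma norm_cis_diff:
  "norm (of_real a * cis s - of_real b * cis t) = sqrt (a\<^sup>2 + b\<^sup>2 - 2 * a * b * cos (s - t))"
proof -
  have "(a * cos s - b * cos t)\<^sup>2 + (a * sin s - b * sin t)\<^sup>2
      = a\<^sup>2 * ((sin s)\<^sup>2 + (cos s)\<^sup>2) + b\<^sup>2 * ((sin t)\<^sup>2 + (cos t)\<^sup>2) - 2 * a * b * cos (s - t)"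
    unfolding cos_diff by algebra
  then show ?thesis
    by (simp add: cmod_def)
qed

lemma cone_triangle:
  fixes a b c \<alpha> \<beta> \<gamma> :: real
  assumes nn: "0 \<le> a" "0 \<le> b" "0 \<le> c" "0 \<le> \<alpha>" "\<alpha> \<le> pi" "0 \<le> \<beta>" "\<beta> \<le> pi"
    and g: "0 \<le> \<gamma>" "\<gamma> \<le> pi" "\<gamma> \<le> \<alpha> + \<beta>"
  shows "sqrt (a\<^sup>2 + c\<^sup>2 - 2 * a * c * cos \<gamma>)
    \<le> sqrt (a\<^sup>2 + b\<^sup>2 - 2 * a * b * cos \<alpha>) + sqrt (b\<^sup>2 + c\<^sup>2 - 2 * b * c * cos \<beta>)"
proof -
  define \<beta>' where "\<beta>' = min \<beta> (pi - \<alpha>)"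
  have "cos \<beta> \<le> cos \<beta>'"
    using nn by (intro cos_monotone_0_pi_le) (auto simp: \<beta>'_def)
  then have 1: "sqrt (b\<^sup>2 + c\<^sup>2 - 2 * b * c * cos \<beta>') \<le> sqrt (b\<^sup>2 + c\<^sup>2 - 2 * b * c * cos \<beta>)"
    using nn by (simp add: mult_left_mono)
  have "cos (\<alpha> + \<beta>') \<le> cos \<gamma>"
    using nn g by (intro cos_monotone_0_pi_le) (auto simp: \<beta>'_def)
  then have 2: "sqrt (a\<^sup>2 + c\<^sup>2 - 2 * a * c * cos \<gamma>) \<le> sqrt (a\<^sup>2 + c\<^sup>2 - 2 * a * c * cos (\<alpha> + \<beta>'))"
    using nn by (simp add: mult_left_mono)
  have "norm (of_real a * cis 0 - of_real c * cis (\<alpha> + \<beta>'))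
      \<le> norm (of_real a * cis 0 - of_real b * cis \<alpha>) + norm (of_real b * cis \<alpha> - of_real c * cis (\<alpha> + \<beta>'))"
    by (metis norm_triangle_ineq diff_add_cancel add_diff_eq)
  then have "sqrt (a\<^sup>2 + c\<^sup>2 - 2 * a * c * cos (\<alpha> + \<beta>'))
    \<le> sqrt (a\<^sup>2 + b\<^sup>2 - 2 * a * b * cos \<alpha>) + sqrt (b\<^sup>2 + c\<^sup>2 - 2 * b * c * cos \<beta>')"
    unfolding norm_cis_diff by (simp only: diff_0 cos_minus) simp
  with 1 2 show ?thesis by linarith
qed

lemma cone_pair_dist_eq_0:
  assumes "0 \<le> a" "0 \<le> b" "0 \<le> t" "t \<le> pi"
  shows "0 \<le> a\<^sup>2 + b\<^sup>2 - 2 * a * b * cos t"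
    and "a\<^sup>2 + b\<^sup>2 - 2 * a * b * cos t = 0 \<longleftrightarrow> a = b \<and> (a = 0 \<or> t = 0)"
proof -
  have e: "a\<^sup>2 + b\<^sup>2 - 2 * a * b * cos t = (a - b)\<^sup>2 + 2 * a * b * (1 - cos t)"
    by (simp add: power2_eq_square algebra_simps)
  have n: "0 \<le> 2 * a * b * (1 - cos t)" using assms by simp
  have c: "cos t = 1 \<longleftrightarrow> t = 0"
    using assms cos_inj_pi[of t 0] by auto
  show "0 \<le> a\<^sup>2 + b\<^sup>2 - 2 * a * b * cos t" unfolding e using n by simp
  show "a\<^sup>2 + b\<^sup>2 - 2 * a * b * cos t = 0 \<longleftrightarrow> a = b \<and> (a = 0 \<or> t = 0)"
    unfolding e add_nonneg_eq_0_iff[OF zero_le_power2 n] using c by auto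
qed

lemma cone_space_cases:
  assumes "P \<in> cone_space \<Sigma>" "\<Sigma> \<noteq> {}"
  obtains a x where "a \<ge> 0" "x \<in> \<Sigma>" "P = cone_rel \<Sigma> `` {(a, x)}"
proof -
  have "P \<in> ({0..} \<times> \<Sigma>) // cone_rel \<Sigma>"
  proof (cases "P = cone_tip \<Sigma>")
    case True
    from assms(2) obtain x where x: "x \<in> \<Sigma>" by auto
    then have "P = cone_rel \<Sigma> `` {(0, x)}"
      using True by (auto simp: cone_tip_def cone_rel_def)
    with x show ?thesis by (auto simp: quotient_def)
  qed (use assms in \<open>auto simp: cone_space_def\<close>)
  then show thesis using that by (auto simp: quotient_def)
qed

lemma Metric_space_cone:
  assumes base: "cone_base \<Sigma> d"
  shows "Metric_space (cone_space \<Sigma>) (cone_dist d)"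
proof -
  interpret Metric_space \<Sigma> d using base by (simp add: cone_base_def)
  have le: "d x y \<le> pi" if "x \<in> \<Sigma>" "y \<in> \<Sigma>" for x y
    using base that by (simp add: cone_base_def)
  have nn: "0 \<le> cone_pair_dist d p q" for p q
  proof -
    obtain a x b y where pq: "p = (a, x)" "q = (b, y)" by (cases p, cases q) auto
    have "a\<^sup>2 + b\<^sup>2 - 2 * a * b * cos (d x y) = (a - b * cos (d x y))\<^sup>2 + (b * sin (d x y))\<^sup>2"
      unfolding power_mult_distrib sin_squared_eq by (simp add: power2_eq_square algebra_simps)
    then show ?thesis
      by (simp add: pq cone_pair_dist_def)
  qed
  have comm: "cone_pair_dist d p q = cone_pair_dist d q p" for p q
    by (cases p; cases q) (simp add: cone_pair_dist_def commute algebra_simps)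
  show ?thesis
  proof
    show "0 \<le> cone_dist d P Q" for P Q
      by (simp add: cone_dist_def nn)
    show "cone_dist d P Q = cone_dist d Q P" for P Q
      by (simp add: cone_dist_def comm)
  next
    fix P Q assume P: "P \<in> cone_space \<Sigma>" and Q: "Q \<in> cone_space \<Sigma>"
    show "cone_dist d P Q = 0 \<longleftrightarrow> P = Q"
    proof (cases "\<Sigma> = {}")
      case True
      with P Q show ?thesis by (auto simp: cone_space_def cone_tip_def cone_dist_def)
    next
      case False
      obtain a x where p: "a \<ge> 0" "x \<in> \<Sigma>" "P = cone_rel \<Sigma> `` {(a, x)}"
        using cone_space_cases[OF P False] .
      obtain b y where q: "b \<ge> 0" "y \<in> \<Sigma>" "Q = cone_rel \<Sigma> `` {(b, y)}"
        using cone_space_cases[OF Q False] .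
      have "cone_dist d P Q = 0 \<longleftrightarrow> a = b \<and> (a = 0 \<or> x = y)"
        using cone_pair_dist_eq_0(2)[OF p(1) q(1) nonneg le[OF p(2) q(2)]] p q
        by (simp add: cone_dist_class[OF base])
      also have "\<dots> \<longleftrightarrow> P = Q"
        unfolding p(3) q(3) using cone_class_eq[OF p(1) q(1) p(2) q(2)] by simp
      finally show ?thesis .
    qed
  next
    fix P Q R assume P: "P \<in> cone_space \<Sigma>" and Q: "Q \<in> cone_space \<Sigma>" and R: "R \<in> cone_space \<Sigma>"
    show "cone_dist d P R \<le> cone_dist d P Q + cone_dist d Q R"
    proof (cases "\<Sigma> = {}")
      case True
      with P Q R show ?thesis by (auto simp: cone_space_def cone_tip_def cone_dist_def)
    next
      case False
      obtain a x where p: "a \<ge> 0" "x \<in> \<Sigma>" "P = cone_rel \<Sigma> `` {(a, x)}"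
        using cone_space_cases[OF P False] .
      obtain b y where q: "b \<ge> 0" "y \<in> \<Sigma>" "Q = cone_rel \<Sigma> `` {(b, y)}"
        using cone_space_cases[OF Q False] .
      obtain c z where r: "c \<ge> 0" "z \<in> \<Sigma>" "R = cone_rel \<Sigma> `` {(c, z)}"
        using cone_space_cases[OF R False] .
      show ?thesis
        using p q r by (simp add: cone_dist_class[OF base] cone_triangle le triangle)
    qed
  qed
qed

section \<open>Neighbourhoods and open embeddings\<close>

definition neighborhood_of :: "'a set \<Rightarrow> ('a \<Rightarrow> 'a \<Rightarrow> real) \<Rightarrow> 'a \<Rightarrow> 'a set \<Rightarrow> bool" where
  "neighborhood_of X d x U \<longleftrightarrow> U \<subseteq> X \<and>
     (\<exists>V. openin (Metric_space.mtopology X d) V \<and> x \<in> V \<and> V \<subseteq> U)"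

definition open_isometric_embedding ::
    "'a set \<Rightarrow> ('a \<Rightarrow> 'a \<Rightarrow> real) \<Rightarrow> 'b set \<Rightarrow> ('b \<Rightarrow> 'b \<Rightarrow> real) \<Rightarrow> ('a \<Rightarrow> 'b) \<Rightarrow> bool" where
  "open_isometric_embedding U d K e \<iota> \<longleftrightarrow> \<iota> ` U \<subseteq> K \<and>
     (\<forall>u\<in>U. \<forall>v\<in>U. e (\<iota> u) (\<iota> v) = d u v) \<and>
     open_map (Metric_space.mtopology U d) (Metric_space.mtopology K e) \<iota>"

text \<open>An existential quantifier cannot range over types, so an existentially quantified base
  \<open>\<Sigma>\<close> has to live in a fixed type, for which the type of the points of \<open>X\<close> suffices
  by the following lemma: the image of \<open>\<iota>\<close> is open and contains the tip,
  hence contains all points \<open>(r, s)\<close>, \<open>s \<in> \<Sigma>\<close>, for some \<open>r > 0\<close>, and so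
  \<open>\<Sigma>\<close> injects into \<open>U\<close>.\<close>

lemma cone_base_type_irrelevant:
  fixes \<Sigma> :: "'b set" and X :: "'a set"
  assumes base: "cone_base \<Sigma> e"
    and X: "Metric_space X d" and UX: "U \<subseteq> X" and xU: "x \<in> U"
    and emb: "open_isometric_embedding U d (cone_space \<Sigma>) (cone_dist e) \<iota>"
    and tip: "\<iota> x = cone_tip \<Sigma>"
  shows "\<exists>(\<Sigma>' :: 'a set) e' \<iota>'. cone_base \<Sigma>' e' \<and>
    open_isometric_embedding U d (cone_space \<Sigma>') (cone_dist e') \<iota>' \<and> \<iota>' x = cone_tip \<Sigma>'"
proof -
  interpret S: Metric_space \<Sigma> e using base by (simp add: cone_base_def)
  interpret U: Metric_space U d using Metric_space.subspace[OF X UX] .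
  interpret C: Metric_space "cone_space \<Sigma>" "cone_dist e" by (rule Metric_space_cone[OF base])
  define Q where "Q r s = cone_rel \<Sigma> `` {(r, s)}" for r :: real and s
  have "openin C.mtopology (\<iota> ` U)"
    using emb openin_topspace[of U.mtopology] by (auto simp: open_isometric_embedding_def open_map_def)
  moreover have "cone_tip \<Sigma> \<in> \<iota> ` U" using tip xU by force
  ultimately obtain r where r: "r > 0" "C.mball (cone_tip \<Sigma>) r \<subseteq> \<iota> ` U"
    unfolding C.openin_mtopology by blast
  have "\<exists>y. y \<in> U \<and> \<iota> y = Q (r / 2) s" if s: "s \<in> \<Sigma>" for s
  proof -
    have "cone_tip \<Sigma> = Q 0 s" using s by (auto simp: Q_def cone_tip_def cone_rel_def)
    moreover have "Q (r / 2) s \<in> cone_space \<Sigma>" "Q 0 s \<in> cone_space \<Sigma>"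
      using cone_class_in(1)[OF _ s] r by (auto simp: Q_def)
    moreover have "cone_dist e (Q 0 s) (Q (r / 2) s) = r / 2"
      unfolding Q_def using cone_dist_class[OF base _ _ s s] r by simp
    ultimately have "Q (r / 2) s \<in> C.mball (cone_tip \<Sigma>) r" using r by simp
    with r(2) show ?thesis by force
  qed
  then obtain u where u: "\<And>s. s \<in> \<Sigma> \<Longrightarrow> u s \<in> U" "\<And>s. s \<in> \<Sigma> \<Longrightarrow> \<iota> (u s) = Q (r / 2) s"
    by metis
  have inj: "inj_on u \<Sigma>"
  proof (rule inj_onI)
    fix s t assume st: "s \<in> \<Sigma>" "t \<in> \<Sigma>" "u s = u t"
    then have "Q (r / 2) s = Q (r / 2) t" using u(2) by metis
    then show "s = t" using st r(1) using cone_class_eq[of "r / 2" "r / 2" s \<Sigma> t] by (simp add: Q_def)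
  qed
  define g where "g = inv_into \<Sigma> u"
  have g: "g (u s) = s" if "s \<in> \<Sigma>" for s using inj that by (simp add: g_def)
  define e' where "e' y z = e (g y) (g z)" for y z
  have base': "cone_base (u ` \<Sigma>) e'"
    unfolding cone_base_def
  proof
    show "Metric_space (u ` \<Sigma>) e'"
      by unfold_locales (auto simp: e'_def g S.commute S.triangle)
    show "\<forall>x\<in>u ` \<Sigma>. \<forall>y\<in>u ` \<Sigma>. e' x y \<le> pi"
      using base by (auto simp: e'_def g cone_base_def)
  qed
  define F where "F P = map_prod id u ` P" for P :: "(real \<times> 'b) set"
  have Ftip: "F (cone_tip \<Sigma>) = cone_tip (u ` \<Sigma>)"
    by (simp add: F_def cone_tip_def map_prod_surj_on)
  have FQ: "F (Q a s) = cone_rel (u ` \<Sigma>) `` {(a, u s)}" if "a \<ge> 0" "s \<in> \<Sigma>" for a s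
  proof -
    have "cone_rel \<Sigma> `` {(a, s)} = (if a = 0 then {0} \<times> \<Sigma> else {(a, s)})"
      "cone_rel (u ` \<Sigma>) `` {(a, u s)} = (if a = 0 then {0} \<times> u ` \<Sigma> else {(a, u s)})"
      using that by (auto simp: cone_rel_def)
    then show ?thesis
      using Ftip by (auto simp: F_def Q_def cone_tip_def)
  qed
  have quot: "({0..} \<times> A) // cone_rel A = (\<lambda>(a, s). cone_rel A `` {(a, s)}) ` ({0..} \<times> A)" for A :: "'c set"
    by (auto simp: quotient_def)
  have Fim: "F ` cone_space \<Sigma> = cone_space (u ` \<Sigma>)"
  proof -
    have "F ` (({0..} \<times> \<Sigma>) // cone_rel \<Sigma>) = ({0..} \<times> u ` \<Sigma>) // cone_rel (u ` \<Sigma>)"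
    proof -
      have "F ` (({0..} \<times> \<Sigma>) // cone_rel \<Sigma>)
          = (\<lambda>(a, s). cone_rel (u ` \<Sigma>) `` {(a, u s)}) ` ({0..} \<times> \<Sigma>)"
        unfolding quot image_image by (rule image_cong) (auto simp: FQ[unfolded Q_def])
      also have "\<dots> = (\<lambda>(a, s). cone_rel (u ` \<Sigma>) `` {(a, s)}) ` map_prod id u ` ({0..} \<times> \<Sigma>)"
        unfolding image_image by (rule image_cong) auto
      also have "map_prod id u ` ({0 :: real..} \<times> \<Sigma>) = {0..} \<times> u ` \<Sigma>"
        by (simp add: map_prod_surj_on)
      finally show ?thesis unfolding quot .
    qed
    then show ?thesis by (simp add: cone_space_def Ftip)
  qed
  have Fdist: "cone_dist e' (F P) (F R) = cone_dist e P R"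
    if P: "P \<in> cone_space \<Sigma>" and R: "R \<in> cone_space \<Sigma>" for P R
  proof (cases "P = {} \<or> R = {}")
    case True
    then show ?thesis by (auto simp: F_def cone_dist_def)
  next
    case False
    then obtain a s b t where m: "(a, s) \<in> P" "(b, t) \<in> R" by auto
    then have st: "s \<in> \<Sigma>" "t \<in> \<Sigma>"
      using P R by (auto simp: cone_space_def cone_tip_def cone_rel_def quotient_def)
    have "(a, u s) \<in> F P" "(b, u t) \<in> F R" using m by (force simp: F_def)+
    moreover have "F P \<in> cone_space (u ` \<Sigma>)" "F R \<in> cone_space (u ` \<Sigma>)" using Fim P R by auto
    ultimately have "cone_dist e' (F P) (F R) = cone_pair_dist e' (a, u s) (b, u t)"
      by (intro cone_dist_eqI[OF base'])
    also have "\<dots> = cone_pair_dist e (a, s) (b, t)"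
      by (simp add: cone_pair_dist_def e'_def g st)
    also have "\<dots> = cone_dist e P R" using cone_dist_eqI[OF base P R m] ..
    finally show ?thesis .
  qed
  interpret C': Metric_space "cone_space (u ` \<Sigma>)" "cone_dist e'" by (rule Metric_space_cone[OF base'])
  interpret CC: Metric_space12 "cone_space \<Sigma>" "cone_dist e" "cone_space (u ` \<Sigma>)" "cone_dist e'" ..
  have "homeomorphic_map C.mtopology C'.mtopology F"
    using CC.isometry_imp_homeomorphic_map Fim Fdist by blast
  then have "open_map C.mtopology C'.mtopology F"
    by (rule homeomorphic_imp_open_map)
  then have "open_map U.mtopology C'.mtopology (F \<circ> \<iota>)"
    using emb open_map_compose by (auto simp: open_isometric_embedding_def)
  moreover have "(F \<circ> \<iota>) ` U \<subseteq> cone_space (u ` \<Sigma>)"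
    using emb Fim by (auto simp: open_isometric_embedding_def)
  moreover have "\<forall>y\<in>U. \<forall>z\<in>U. cone_dist e' ((F \<circ> \<iota>) y) ((F \<circ> \<iota>) z) = d y z"
    using emb Fdist by (auto simp: open_isometric_embedding_def image_subset_iff)
  ultimately have "open_isometric_embedding U d (cone_space (u ` \<Sigma>)) (cone_dist e') (F \<circ> \<iota>)"
    by (simp add: open_isometric_embedding_def)
  moreover have "(F \<circ> \<iota>) x = cone_tip (u ` \<Sigma>)" by (simp add: tip Ftip)
  ultimately show ?thesis using base' by blast
qed

end

theory Submission
  imports Defs
begin

text \<open>
  Both directions use a description of conic balls that does not mention a cone: around \<open>z\<close>
  there are dilations \<open>dil z t\<close>, and distances between dilated points obey the law of cosines
  (\<open>conic\<close>). Differentiating the triangle inequality along a dilation yields Stewart's identity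
  (\<open>stewart\<close>): along any geodesic of a conic ball the squared distance to its centre is the same
  quadratic function as in a Euclidean space. Hence the \<^emph>\<open>difference\<close> of the squared distances to
  two centres is affine along geodesics.

  \<^bold>\<open>Locally conic implies polyhedral.\<close> Cover a compact set \<open>L\<close> by finitely many balls \<open>B(z, R z)\<close>
  whose doubles are conic, and let the cell of \<open>z\<close> consist of the points of \<open>L\<close> at which
  \<open>pow z p = (d z p)\<^sup>2 - (R z)\<^sup>2\<close> is minimal among all centres. As differences of these functions
  are affine, a cell is star-shaped about its centre, and every ray from the centre leaves it once and
  for all through the wall, the set of points that lie in at least two cells (\<open>transversal\<close>,
  \<open>exit_point\<close>). For the same reason cells and walls are again locally conic sets, so the
  construction can be applied to the wall of the first covering, to the wall of the second one, and
  so on; this gives a decreasing sequence \<open>L 0 = X, L 1, L 2, \<dots>\<close> of compact sets. The sequence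
  reaches the empty set: at a point \<open>p\<close> of \<open>L (m + 1)\<close> two different centres of stage \<open>m\<close> compete,
  which produces a direction at \<open>p\<close> orthogonal to the directions that arise in the later stages
  (\<open>perpendicular_point\<close>), and in a compact space there is no infinite family of pairwise
  orthogonal directions at a point with a conic ball (\<open>tower_terminates\<close>).

  Starting from any point, project it from the centre of its cell to the wall, project the result
  from its centre to the next wall, and so on. The centres met on the way span a simplex containing
  the point, and the ratios of the projections are its barycentric coordinates
  (\<open>join_point_surj\<close>, \<open>join_point_inj\<close>). Which sets of centres span a simplex is decided by pairs, so
  the triangulation is a clique complex. By Stewart's identity the squared distance of two points of
  a simplex is a quadratic form in the difference of their barycentric coordinates
  (\<open>dist_formula\<close>); it is definite because coordinates are unique, and a Gram matrix construction
  places the simplex in a Euclidean space (\<open>euclidean_realization\<close>).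

  \<^bold>\<open>Polyhedral implies locally conic.\<close> Near \<open>x\<close> only simplices containing \<open>x\<close> matter, and
  each of them is invariant there under dilations about \<open>x\<close>. Let \<open>\<theta> u v\<close> be the infimum, capped at
  \<open>\<pi>\<close>, of the total angle at \<open>x\<close> of a fan of simplices leading from direction \<open>u\<close> to direction \<open>v\<close>.
  Unfolding a fan into the plane shows that distances are at most those of the cone over \<open>\<theta>\<close>
  (\<open>dist_polar_le_fan\<close>). Conversely, an almost shortest curve can be cut into finitely many
  pieces with both ends in a common simplex (\<open>closed_cover_chain\<close>), and adding up the pieces with the
  triangle inequality of the cone shows that distances are not smaller (\<open>chord_le_dist\<close>).
\<close>

section \<open>Dilations and conic balls\<close>

context Metric_space
begin

text \<open>In a conic ball the two distances single out the point at parameter \<open>t\<close> on the ray from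
  \<open>z\<close> through \<open>p\<close>; describing it by distances makes it independent of the radius of the ball.\<close>
definition dil :: "'a \<Rightarrow> real \<Rightarrow> 'a \<Rightarrow> 'a" where
  "dil z t p = (THE y. y \<in> M \<and> d z y = t * d z p \<and> d y p = \<bar>1 - t\<bar> * d z p)"

text \<open>For \<open>s = t = 1\<close> the formula is a tautology; with \<open>cos \<alpha> = (a\<^sup>2 + b\<^sup>2 - c\<^sup>2) / 2ab\<close> it
  says that the angle at \<open>z\<close> does not change under dilations, which is the cone metric without a base.\<close>
definition conic :: "'a \<Rightarrow> real \<Rightarrow> bool" where
  "conic z \<rho> \<longleftrightarrow> z \<in> M \<and> 0 < \<rho> \<and>
    (\<forall>p\<in>mball z \<rho>. \<forall>t\<ge>0. t * d z p < \<rho> \<longrightarrow> dil z t p \<in> M) \<and>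
    (\<forall>p\<in>mball z \<rho>. \<forall>q\<in>mball z \<rho>. \<forall>s\<ge>0. \<forall>t\<ge>0. s * d z p < \<rho> \<longrightarrow> t * d z q < \<rho> \<longrightarrow>
      (d (dil z s p) (dil z t q))\<^sup>2 =
        s\<^sup>2 * (d z p)\<^sup>2 + t\<^sup>2 * (d z q)\<^sup>2 - s * t * ((d z p)\<^sup>2 + (d z q)\<^sup>2 - (d p q)\<^sup>2))"

text \<open>Parameters \<open>t > 1\<close> are included, so inside the ball such a set is a union of open rays
  from \<open>z\<close>, with or without \<open>z\<close> itself.\<close>
definition conic_set :: "'a \<Rightarrow> real \<Rightarrow> 'a set \<Rightarrow> bool" where
  "conic_set z \<rho> A \<longleftrightarrow> (\<forall>p\<in>mball z \<rho> \<inter> A. \<forall>t>0. t * d z p < \<rho> \<longrightarrow> dil z t p \<in> A)"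

lemma dil_1: "p \<in> M \<Longrightarrow> dil z 1 p = p"
  unfolding dil_def by (rule the_equality) auto

lemma dil_0: "z \<in> M \<Longrightarrow> dil z 0 p = z"
  unfolding dil_def by (rule the_equality) auto

text \<open>Any family of maps obeying the law of cosines consists of the dilations defined above: the law
  forces the two distances, and it makes points with these distances coincide.\<close>
lemma conicI:
  assumes z: "z \<in> M" and \<rho>: "0 < \<rho>"
    and hM: "\<And>p t. p \<in> mball z \<rho> \<Longrightarrow> 0 \<le> t \<Longrightarrow> t * d z p < \<rho> \<Longrightarrow> h t p \<in> M"
    and h1: "\<And>p. p \<in> mball z \<rho> \<Longrightarrow> h 1 p = p"
    and law: "\<And>p q s t. p \<in> mball z \<rho> \<Longrightarrow> q \<in> mball z \<rho> \<Longrightarrow> 0 \<le> s \<Longrightarrow> 0 \<le> t \<Longrightarrow>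
      s * d z p < \<rho> \<Longrightarrow> t * d z q < \<rho> \<Longrightarrow>
      (d (h s p) (h t q))\<^sup>2 =
        s\<^sup>2 * (d z p)\<^sup>2 + t\<^sup>2 * (d z q)\<^sup>2 - s * t * ((d z p)\<^sup>2 + (d z q)\<^sup>2 - (d p q)\<^sup>2)"
  shows "conic z \<rho>"
proof -
  have zb: "z \<in> mball z \<rho>" using z \<rho> by simp
  have dz: "d z (h t p) = t * d z p" if "p \<in> mball z \<rho>" "0 \<le> t" "t * d z p < \<rho>" for t p
  proof -
    have "(d (h 1 z) (h t p))\<^sup>2 = (t * d z p)\<^sup>2"
      using law[OF zb that(1), of 1 t] that z \<rho> by (simp add: power_mult_distrib)
    then show ?thesis using h1[OF zb] that by simp
  qed
  have dp: "d (h t p) p = \<bar>1 - t\<bar> * d z p" if "p \<in> mball z \<rho>" "0 \<le> t" "t * d z p < \<rho>" for t p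
  proof -
    have "(d (h t p) (h 1 p))\<^sup>2 = ((1 - t) * d z p)\<^sup>2"
      using law[OF that(1) that(1), of t 1] that by (simp add: power2_eq_square algebra_simps)
    then show ?thesis using h1[OF that(1)]
      by (metis abs_mult abs_of_nonneg nonneg power2_eq_iff_nonneg abs_ge_zero power2_abs)
  qed
  have eq: "dil z t p = h t p" if p: "p \<in> mball z \<rho>" and t: "0 \<le> t" "t * d z p < \<rho>" for t p
    unfolding dil_def
  proof (rule the_equality)
    show "h t p \<in> M \<and> d z (h t p) = t * d z p \<and> d (h t p) p = \<bar>1 - t\<bar> * d z p"
      using dz dp hM that by blast
  next
    fix y assume y: "y \<in> M \<and> d z y = t * d z p \<and> d y p = \<bar>1 - t\<bar> * d z p"
    then have yb: "y \<in> mball z \<rho>" using t z by simp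
    have "(d (h 1 y) (h t p))\<^sup>2 = 0"
      using law[OF yb p, of 1 t] y t yb
      by (simp add: power_mult_distrib) (simp add: power2_eq_square algebra_simps)
    then show "y = h t p" using h1[OF yb] y hM[OF p t] by simp
  qed
  show ?thesis unfolding conic_def using eq z \<rho> hM law by simp
qed

context
  fixes z :: 'a and \<rho> :: real
  assumes c: "conic z \<rho>"
begin

lemma conic_pos: "0 < \<rho>" and conic_center: "z \<in> M" and conic_center_ball: "z \<in> mball z \<rho>"
  using c by (auto simp: conic_def)

lemma dil_law:
  assumes "p \<in> mball z \<rho>" "q \<in> mball z \<rho>" "0 \<le> s" "0 \<le> t" "s * d z p < \<rho>" "t * d z q < \<rho>"
  shows "(d (dil z s p) (dil z t q))\<^sup>2 =
        s\<^sup>2 * (d z p)\<^sup>2 + t\<^sup>2 * (d z q)\<^sup>2 - s * t * ((d z p)\<^sup>2 + (d z q)\<^sup>2 - (d p q)\<^sup>2)"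
  using c assms unfolding conic_def by blast

text \<open>The law for one dilated point: Stewart's identity with apex \<open>p\<close> for the segment from the
  centre \<open>z\<close> to \<open>q\<close>.\<close>
lemma dil_law_1:
  assumes "p \<in> mball z \<rho>" "q \<in> mball z \<rho>" "0 \<le> t" "t * d z q < \<rho>"
  shows "(d p (dil z t q))\<^sup>2 = (1 - t) * (d z p)\<^sup>2 + t * (d p q)\<^sup>2 - t * (1 - t) * (d z q)\<^sup>2"
proof -
  have "p \<in> M" "d z p < \<rho>" using assms by auto
  then show ?thesis
    using dil_law[OF assms(1,2), of 1 t] assms(3,4) dil_1[of p z]
    by (simp add: power2_eq_square algebra_simps)
qed

lemma dil_in_M:
  assumes "p \<in> mball z \<rho>" "0 \<le> t" "t * d z p < \<rho>"
  shows "dil z t p \<in> M"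
  using c assms unfolding conic_def by blast

lemma dil_dist_center:
  assumes "p \<in> mball z \<rho>" "0 \<le> t" "t * d z p < \<rho>"
  shows "d z (dil z t p) = t * d z p"
proof -
  have "(d z (dil z t p))\<^sup>2 = (t * d z p)\<^sup>2"
    using dil_law_1[OF conic_center_ball assms] conic_center
    by (simp add: power2_eq_square algebra_simps)
  then show ?thesis using assms by simp
qed

lemma dil_in_ball:
  assumes "p \<in> mball z \<rho>" "0 \<le> t" "t * d z p < \<rho>"
  shows "dil z t p \<in> mball z \<rho>"
  using dil_in_M[OF assms] dil_dist_center[OF assms] conic_center assms by simp

lemma dil_shrink_bound:
  assumes "p \<in> mball z \<rho>" "0 \<le> t" "t \<le> 1"
  shows "t * d z p < \<rho>"
  using assms mult_right_mono[of t 1 "d z p"] by simp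

lemma dil_dist_same:
  assumes "p \<in> mball z \<rho>" "0 \<le> s" "s * d z p < \<rho>" "0 \<le> t" "t * d z p < \<rho>"
  shows "d (dil z s p) (dil z t p) = \<bar>s - t\<bar> * d z p"
proof -
  have "p \<in> M" using assms by auto
  then have "(d (dil z s p) (dil z t p))\<^sup>2 = (\<bar>s - t\<bar> * d z p)\<^sup>2"
    using dil_law[OF assms(1,1,2,4,3,5)] by (simp add: power2_eq_square algebra_simps)
  then show ?thesis by simp
qed

lemma dil_dist_self:
  assumes "p \<in> mball z \<rho>" "0 \<le> t" "t * d z p < \<rho>"
  shows "d p (dil z t p) = \<bar>1 - t\<bar> * d z p"
  using dil_dist_same[of p 1 t] assms dil_1[of p z] by auto

lemma dil_unique:
  assumes "p \<in> mball z \<rho>" "0 \<le> t" "t * d z p < \<rho>"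
    and "y \<in> M" "d z y = t * d z p" "d y p = \<bar>1 - t\<bar> * d z p"
  shows "y = dil z t p"
proof -
  have yb: "y \<in> mball z \<rho>" using assms conic_center by simp
  have "(d y (dil z t p))\<^sup>2 = 0"
    using dil_law_1[OF yb assms(1-3)] assms(5,6) by (simp add: power_mult_distrib)
      (simp add: power2_eq_square algebra_simps)
  then show ?thesis using assms(4) dil_in_M[OF assms(1-3)] by simp
qed

lemma dil_dil:
  assumes p: "p \<in> mball z \<rho>" and t: "0 \<le> t" "t * d z p < \<rho>" and s: "0 \<le> s" "s * t * d z p < \<rho>"
  shows "dil z s (dil z t p) = dil z (s * t) p"
proof -
  note D = dil_dist_center[OF p t] and B = dil_in_ball[OF p t]
  have s': "s * d z (dil z t p) < \<rho>" using s D by (simp add: mult.assoc)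
  have ds: "0 \<le> s * t" using s t by simp
  have "(d (dil z s (dil z t p)) (dil z (s * t) p))\<^sup>2 = 0"
    using dil_law[OF B p s(1) ds s' s(2)] dil_dist_self[OF p t] commute[of p "dil z t p"]
    by (simp add: D power_mult_distrib) (simp add: power2_eq_square algebra_simps)
  then show ?thesis using dil_in_M[OF B s(1) s'] dil_in_M[OF p ds s(2)] by simp
qed

lemma dil_inverse:
  assumes p: "p \<in> mball z \<rho>" and t: "0 < t" "t * d z p < \<rho>"
  shows "dil z (1 / t) (dil z t p) = p"
  using dil_dil[OF p _ t(2), of "1 / t"] t p dil_1[of p z] by simp

text \<open>Here the apex is the centre and \<open>m\<close> lies on an arbitrary geodesic from \<open>p\<close> to \<open>q\<close>.
  Moving \<open>m\<close> radially cannot shorten the path from \<open>p\<close> through \<open>m\<close> to \<open>q\<close>, so the derivative of its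
  length vanishes at \<open>m\<close>, and this equation is the claim.\<close>
lemma stewart:
  assumes p: "p \<in> mball z \<rho>" and m: "m \<in> mball z \<rho>" and q: "q \<in> mball z \<rho>"
    and \<tau>: "0 \<le> \<tau>" "\<tau> \<le> 1"
    and pm: "d p m = \<tau> * d p q" and mq: "d m q = (1 - \<tau>) * d p q"
  shows "(d z m)\<^sup>2 = (1 - \<tau>) * (d z p)\<^sup>2 + \<tau> * (d z q)\<^sup>2 - \<tau> * (1 - \<tau>) * (d p q)\<^sup>2"
proof -
  have M: "p \<in> M" "m \<in> M" "q \<in> M" using p m q by auto
  consider "d p m = 0" | "d m q = 0" | "d p m > 0" "d m q > 0"
    using nonneg[of p m] nonneg[of m q] by linarith
  then show ?thesis
  proof cases
    case 1
    then have "p = m" "\<tau> = 0 \<or> d p q = 0" using M pm by auto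
    then show ?thesis using M by (auto simp: algebra_simps)
  next
    case 2
    then have "m = q" "\<tau> = 1 \<or> d p q = 0" using M mq by auto
    then show ?thesis using M by (auto simp: algebra_simps)
  next
    case 3
    define l where "l = d p q"
    have l: "l > 0" and \<tau>': "0 < \<tau>" "\<tau> < 1"
      using 3 \<tau> nonneg[of p q] by (auto simp: pm mq l_def zero_less_mult_iff)
    define a b c where "a = d z p" and "b = d z q" and "c = d z m"
    define A where "A r = (1 - r) * a\<^sup>2 + r * (\<tau> * l)\<^sup>2 - r * (1 - r) * c\<^sup>2" for r
    define B where "B r = (1 - r) * b\<^sup>2 + r * ((1 - \<tau>) * l)\<^sup>2 - r * (1 - r) * c\<^sup>2" for r
    \<comment> \<open>The length of the path through the dilated point \<open>dil z r m\<close>; it is minimal at \<open>r = 1\<close>.\<close>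
    define \<phi> where "\<phi> r = sqrt (A r) + sqrt (B r)" for r
    have A1: "A 1 = (\<tau> * l)\<^sup>2" and B1: "B 1 = ((1 - \<tau>) * l)\<^sup>2" by (auto simp: A_def B_def)
    have sA: "sqrt (A 1) = \<tau> * l" and sB: "sqrt (B 1) = (1 - \<tau>) * l"
      unfolding A1 B1 using \<tau>' l by auto
    have \<phi>1: "\<phi> 1 = l" unfolding \<phi>_def sA sB by (simp add: algebra_simps)
    have ge: "\<phi> 1 \<le> \<phi> r" if r: "0 \<le> r" "r * c < \<rho>" for r
    proof -
      have "(d p (dil z r m))\<^sup>2 = A r" "(d q (dil z r m))\<^sup>2 = B r"
        using dil_law_1[OF p m r(1)] dil_law_1[OF q m r(1)] r(2) pm mq commute[of q m]
        by (auto simp: A_def B_def a_def b_def c_def l_def)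
      then have "\<phi> r = d p (dil z r m) + d q (dil z r m)"
        unfolding \<phi>_def by (metis nonneg real_sqrt_unique)
      moreover have "dil z r m \<in> M" using dil_in_M[OF m r(1)] r(2) c_def by simp
      ultimately show ?thesis using triangle[of p "dil z r m" q] M \<phi>1 commute[of q] l_def by simp
    qed
    have dA: "(A has_real_derivative (c\<^sup>2 - a\<^sup>2 + (\<tau> * l)\<^sup>2)) (at 1)"
      unfolding A_def by (auto intro!: derivative_eq_intros simp: algebra_simps)
    have dB: "(B has_real_derivative (c\<^sup>2 - b\<^sup>2 + ((1 - \<tau>) * l)\<^sup>2)) (at 1)"
      unfolding B_def by (auto intro!: derivative_eq_intros simp: algebra_simps)
    have pA: "0 < A 1" and pB: "0 < B 1" unfolding A1 B1 using \<tau>' l by auto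
    have d\<phi>: "(\<phi> has_real_derivative
        ((c\<^sup>2 - a\<^sup>2 + (\<tau> * l)\<^sup>2) / (2 * (\<tau> * l)) + (c\<^sup>2 - b\<^sup>2 + ((1 - \<tau>) * l)\<^sup>2) / (2 * ((1 - \<tau>) * l)))) (at 1)"
      unfolding \<phi>_def using pA pB
      by (auto intro!: derivative_eq_intros dA dB simp: sA sB divide_simps)
    have c\<rho>: "c < \<rho>" "0 \<le> c" using m by (auto simp: c_def)
    define \<epsilon> where "\<epsilon> = (if c = 0 then 1 else min 1 (\<rho> / c - 1))"
    have \<epsilon>: "0 < \<epsilon>" using c\<rho> by (auto simp: \<epsilon>_def)
    have "\<phi> 1 \<le> \<phi> r" if "\<bar>1 - r\<bar> < \<epsilon>" for r
    proof (rule ge)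
      show "0 \<le> r" using that by (auto simp: \<epsilon>_def split: if_splits)
      show "r * c < \<rho>"
      proof (cases "c = 0")
        case False
        then have "r < \<rho> / c" using that by (auto simp: \<epsilon>_def split: if_splits)
        then show ?thesis using False c\<rho> by (simp add: field_simps)
      qed (use conic_pos in auto)
    qed
    then have "(c\<^sup>2 - a\<^sup>2 + (\<tau> * l)\<^sup>2) / (2 * (\<tau> * l)) + (c\<^sup>2 - b\<^sup>2 + ((1 - \<tau>) * l)\<^sup>2) / (2 * ((1 - \<tau>) * l)) = 0"
      by (intro DERIV_local_min[OF d\<phi> \<epsilon>]) auto
    then have "(1 - \<tau>) * (c\<^sup>2 - a\<^sup>2 + (\<tau> * l)\<^sup>2) + \<tau> * (c\<^sup>2 - b\<^sup>2 + ((1 - \<tau>) * l)\<^sup>2) = 0"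
      using \<tau>' l by (simp add: divide_simps split: if_splits) (simp add: algebra_simps)
    then have "c\<^sup>2 = (1 - \<tau>) * a\<^sup>2 + \<tau> * b\<^sup>2 - \<tau> * (1 - \<tau>) * l\<^sup>2"
      by (simp add: power2_eq_square algebra_simps)
    then show ?thesis by (simp add: a_def b_def c_def l_def)
  qed
qed

end

lemma conic_mono:
  assumes "conic z \<rho>" "0 < r" "r \<le> \<rho>"
  shows "conic z r"
proof -
  have *: "p \<in> mball z \<rho>" if "p \<in> mball z r" for p using that assms(3) by auto
  show ?thesis
    unfolding conic_def using assms(2) conic_center[OF assms(1)] dil_in_M[OF assms(1) *] 
      dil_law[OF assms(1) * *] assms(3) by auto
qed

lemma conic_set_mono: "conic_set z \<rho> A \<Longrightarrow> r \<le> \<rho> \<Longrightarrow> conic_set z r A"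
  unfolding conic_set_def by auto

end

section \<open>Finite nets with power cells\<close>

lemma compact_closed_subset_Icc:
  fixes A :: "real set"
  assumes "closed A" "A \<subseteq> {a..b}"
  shows "compact A"
  using compact_Int_closed[OF compact_Icc[of a b] assms(1)] assms(2) by (simp add: Int_absorb1)

context Metric_space
begin

lemma abs_dist_diff_le: "x \<in> M \<Longrightarrow> y \<in> M \<Longrightarrow> z \<in> M \<Longrightarrow> \<bar>d z x - d z y\<bar> \<le> d x y"
  using mdist_reverse_triangle[of x z y] commute by simp

lemma continuous_map_dist: "w \<in> M \<Longrightarrow> continuous_map mtopology euclideanreal (d w)"
  unfolding continuous_map_from_metric
proof (intro conjI ballI allI impI)
  fix a U assume w: "w \<in> M" and a: "a \<in> M" and U: "openin euclideanreal U \<and> d w a \<in> U"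
  then obtain r where r: "r > 0" "ball (d w a) r \<subseteq> U" by (auto simp: open_contains_ball)
  have "d w x \<in> U" if "x \<in> M" "d a x < r" for x
    using abs_dist_diff_le[OF a that(1) w] that r by (auto simp: subset_iff dist_real_def)
  then show "\<exists>r>0. \<forall>x. x \<in> M \<and> d a x < r \<longrightarrow> d w x \<in> U" using r(1) by blast
qed simp

text \<open>Centres are chosen greedily among the points not yet covered, with almost maximal radius: each
  new radius exceeds \<open>1/sqrt 2\<close> times all radii still available. The choice stops because the balls
  leave no room for infinitely many centres of radius bounded below. The last inequality says that
  each centre is strictly inside its own power cell; a cover by balls alone would not give it.\<close>
lemma greedy_net:
  assumes L: "compactin mtopology L" and r: "\<And>x. x \<in> L \<Longrightarrow> 0 < r x \<and> r x \<le> (1 :: real)"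
  shows "\<exists>N. finite N \<and> N \<subseteq> L \<and> L \<subseteq> (\<Union>z\<in>N. mball z (r z)) \<and>
    (\<forall>z\<in>N. \<forall>w\<in>N. z \<noteq> w \<longrightarrow> (r w)\<^sup>2 < (r z)\<^sup>2 + (d z w)\<^sup>2)"
proof (rule ccontr)
  assume no: "\<not> ?thesis"
  have LM: "L \<subseteq> M" using L compactin_subset_topspace by fastforce
  define U where "U f n = {y\<in>L. \<forall>i<n. y \<notin> mball (f i) (r (f i))}" for f and n :: nat
  \<comment> \<open>The requirement on the \<open>n\<close>-th centre \<open>x\<close> when \<open>f\<close> lists the earlier ones.\<close>
  define P where "P f n x \<longleftrightarrow> x \<in> U f n \<and> (\<forall>y\<in>U f n. (r y)\<^sup>2 < 2 * (r x)\<^sup>2)" for f n x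
  have far: "r (f i) \<le> d (f i) (f j)" if "P f i (f i)" "P f j (f j)" "i < j" for f i j
    using that LM by (auto simp: P_def U_def)
  have big: "(r (f j))\<^sup>2 < 2 * (r (f i))\<^sup>2" if "P f i (f i)" "P f j (f j)" "i < j" for f i j
    using that by (auto simp: P_def U_def)
  have sep: "(r (f j))\<^sup>2 < (r (f i))\<^sup>2 + (d (f i) (f j))\<^sup>2"
    if "P f i (f i)" "P f j (f j)" "i \<noteq> j" for f i j
  proof -
    have pos: "0 < r (f i)" "0 < r (f j)" using that r by (auto simp: P_def U_def)
    show ?thesis
    proof (cases "i < j")
      case True
      have "(r (f i))\<^sup>2 \<le> (d (f i) (f j))\<^sup>2" using far[OF that(1,2) True] pos by simp
      then show ?thesis using big[OF that(1,2) True] by simp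
    next
      case False
      then have "j < i" using that by simp
      then have "(r (f j))\<^sup>2 \<le> (d (f i) (f j))\<^sup>2"
        using far[OF that(2,1)] pos commute by simp
      then show ?thesis using pos by (smt (verit) zero_less_power)
    qed
  qed
  have "\<exists>f. \<forall>n. P f n (f n)"
  proof (rule dependent_wf_choice[of less_than])
    fix f g :: "nat \<Rightarrow> 'a" and n x assume "\<And>z. (z, n) \<in> less_than \<Longrightarrow> f z = g z"
    then have "U f n = U g n" by (auto simp: U_def)
    then show "P f n x = P g n x" by (simp add: P_def)
  next
    fix n f assume "\<And>y. (y, n) \<in> less_than \<Longrightarrow> P f y (f y)"
    then have IH: "P f i (f i)" if "i < n" for i using that by simp
    have "U f n \<noteq> {}"
    proof
      assume "U f n = {}"
      then have cov: "L \<subseteq> (\<Union>z\<in>f ` {..<n}. mball z (r z))"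
        unfolding U_def by blast
      have sub: "f ` {..<n} \<subseteq> L" using IH by (auto simp: P_def U_def)
      have "\<forall>z\<in>f ` {..<n}. \<forall>w\<in>f ` {..<n}. z \<noteq> w \<longrightarrow> (r w)\<^sup>2 < (r z)\<^sup>2 + (d z w)\<^sup>2"
      proof (intro ballI impI)
        fix z w assume "z \<in> f ` {..<n}" "w \<in> f ` {..<n}" "z \<noteq> w"
        then obtain i j where "z = f i" "w = f j" "i < n" "j < n" "i \<noteq> j" by auto
        then show "(r w)\<^sup>2 < (r z)\<^sup>2 + (d z w)\<^sup>2" using sep[OF IH IH] by simp
      qed
      then show False using no cov sub by (meson finite_imageI finite_lessThan)
    qed
    then obtain y0 where y0: "y0 \<in> U f n" by auto
    define S where "S = (\<lambda>y. (r y)\<^sup>2) ` U f n"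
    have bd: "bdd_above S" unfolding S_def
      using r by (intro bdd_aboveI[of _ 1]) (force simp: U_def power_le_one)
    have "0 < r y0" using y0 r[of y0] by (simp add: U_def)
    then have "0 < (r y0)\<^sup>2" by simp
    also have "(r y0)\<^sup>2 \<le> Sup S" using bd y0 by (intro cSup_upper) (auto simp: S_def)
    finally have "Sup S / 2 < Sup S" by simp
    moreover have "S \<noteq> {}" using y0 by (auto simp: S_def)
    ultimately obtain v where "v \<in> S" "Sup S / 2 < v" using less_cSup_iff[OF _ bd] by blast
    then obtain x where x: "x \<in> U f n" "Sup S / 2 < (r x)\<^sup>2" by (auto simp: S_def)
    have "(r y)\<^sup>2 < 2 * (r x)\<^sup>2" if "y \<in> U f n" for y
      using cSup_upper[OF _ bd, of "(r y)\<^sup>2"] that x(2) by (auto simp: S_def)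
    then show "\<exists>x. P f n x" using x(1) by (auto simp: P_def)
  qed simp
  then obtain f where f: "\<And>n. P f n (f n)" by blast
  have fL: "f n \<in> L" for n using f[of n] by (auto simp: P_def U_def)
  then obtain l \<sigma> where l: "l \<in> L" "strict_mono \<sigma>" "limitin mtopology (f \<circ> \<sigma>) l sequentially"
    using L unfolding compactin_sequentially by (metis image_subsetI)
  then have lM: "l \<in> M" using LM by auto
  have lim: "\<exists>K. \<forall>n\<ge>K. d (f (\<sigma> n)) l < \<epsilon>" if "\<epsilon> > 0" for \<epsilon>
    using l(3) that unfolding limit_metric_sequentially by (metis comp_apply)
  have lU: "l \<notin> mball (f i) (r (f i))" for i
  proof
    assume a: "l \<in> mball (f i) (r (f i))"
    then have "0 < r (f i) - d (f i) l" by simp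
    from lim[OF this] obtain K where K: "\<forall>n\<ge>K. d (f (\<sigma> n)) l < r (f i) - d (f i) l" by blast
    define n where "n = max K (Suc i)"
    have "i < \<sigma> n" using seq_suble[OF l(2), of n] by (auto simp: n_def)
    then have "r (f i) \<le> d (f i) (f (\<sigma> n))" using far f by blast
    also have "\<dots> \<le> d (f i) l + d (f (\<sigma> n)) l"
      using triangle'[of "f i" l "f (\<sigma> n)"] fL LM lM by (auto simp: subset_iff)
    also have "\<dots> < r (f i)" using K by (auto simp: n_def add.commute less_diff_eq)
    finally show False by simp
  qed
  then have "l \<in> U f n" for n using l(1) by (auto simp: U_def)
  then have rl: "(r l)\<^sup>2 < 2 * (r (f n))\<^sup>2" for n using f[of n] by (auto simp: P_def)
  have pl: "0 < r l" using r l(1) by blast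
  then have "0 < r l / 4" by simp
  from lim[OF this] obtain K where K: "\<forall>n\<ge>K. d (f (\<sigma> n)) l < r l / 4" by blast
  have "\<sigma> K < \<sigma> (Suc K)" using l(2) by (simp add: strict_mono_def)
  then have "r (f (\<sigma> K)) \<le> d (f (\<sigma> K)) (f (\<sigma> (Suc K)))" using far f by blast
  also have "\<dots> \<le> d (f (\<sigma> K)) l + d (f (\<sigma> (Suc K))) l"
    using triangle'[of "f (\<sigma> K)" l "f (\<sigma> (Suc K))"] fL LM lM by (auto simp: subset_iff)
  also have "\<dots> \<le> r l / 2" using K[rule_format, of K] K[rule_format, of "Suc K"] by simp
  finally have "(r (f (\<sigma> K)))\<^sup>2 \<le> (r l / 2)\<^sup>2"
    using r[OF fL, of "\<sigma> K"] by (intro power_mono) auto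
  then show False using rl[of "\<sigma> K"] pl by (simp add: power_divide) (smt (verit) zero_less_power)
qed

end

text \<open>The factor 2 leaves room: a point at distance less than \<open>R z\<close> from \<open>z\<close> has a neighbourhood
  of fixed size inside the conic ball.\<close>
locale power_cells = Metric_space +
  fixes L N :: "'a set" and R :: "'a \<Rightarrow> real"
  assumes finN: "finite N" and N_sub: "N \<subseteq> L" and L_closed: "closedin mtopology L"
    and R_pos: "z \<in> N \<Longrightarrow> 0 < R z"
    and N_conic: "z \<in> N \<Longrightarrow> conic z (2 * R z)"
    and L_conic: "z \<in> N \<Longrightarrow> conic_set z (2 * R z) L"
    and cover: "L \<subseteq> (\<Union>z\<in>N. mball z (R z))"
    and sep: "z \<in> N \<Longrightarrow> w \<in> N \<Longrightarrow> z \<noteq> w \<Longrightarrow> (R w)\<^sup>2 < (R z)\<^sup>2 + (d z w)\<^sup>2"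
begin

definition pow :: "'a \<Rightarrow> 'a \<Rightarrow> real" where "pow z p = (d z p)\<^sup>2 - (R z)\<^sup>2"

definition cell :: "'a \<Rightarrow> 'a set" where
  "cell z = {p\<in>L. \<forall>w\<in>N. pow z p \<le> pow w p}"

definition wall :: "'a set" where
  "wall = (\<Union>z\<in>N. \<Union>w\<in>N - {z}. cell z \<inter> cell w)"

lemma L_sub: "L \<subseteq> M" using L_closed closedin_subset by fastforce

lemma N_in_M: "z \<in> N \<Longrightarrow> z \<in> M" using N_sub L_sub by blast

lemma cell_sub: "cell z \<subseteq> L" by (auto simp: cell_def)

lemma pow_neg_iff: "z \<in> N \<Longrightarrow> pow z p < 0 \<longleftrightarrow> d z p < R z"
  using R_pos[of z] power_mono_iff[of "R z" "d z p" 2] by (simp add: pow_def not_le[symmetric] del: power_mono_iff)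

lemma pow_min_neg: "p \<in> L \<Longrightarrow> \<exists>z\<in>N. pow z p < 0"
  using cover pow_neg_iff by fastforce

lemma cell_dist: assumes "z \<in> N" "p \<in> cell z" shows "d z p < R z"
proof -
  have "p \<in> L" using assms(2) by (simp add: cell_def)
  then obtain w where "w \<in> N" "pow w p < 0" using pow_min_neg by blast
  then have "pow z p < 0" using assms(2) by (force simp: cell_def)
  then show ?thesis using pow_neg_iff assms(1) by simp
qed

lemma cell_in_M: "p \<in> cell z \<Longrightarrow> p \<in> M"
  using cell_sub L_sub by blast

lemma cell_in_ball: "z \<in> N \<Longrightarrow> p \<in> cell z \<Longrightarrow> p \<in> mball z (2 * R z)"
  using cell_dist[of z p] cell_in_M[of p z] N_in_M[of z] R_pos[of z] by simp

lemma cell_ex: assumes "p \<in> L" shows "\<exists>z\<in>N. p \<in> cell z"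
proof -
  have ne: "N \<noteq> {}" using pow_min_neg[OF assms] by auto
  show ?thesis
    using assms arg_min_if_finite(1)[OF finN ne, of "\<lambda>w. pow w p"]
      arg_min_least[OF finN ne, of _ "\<lambda>w. pow w p"]
    by (intro bexI[of _ "arg_min_on (\<lambda>w. pow w p) N"]) (auto simp: cell_def)
qed

lemma continuous_map_pow: "z \<in> N \<Longrightarrow> continuous_map mtopology euclideanreal (pow z)"
  unfolding pow_def using continuous_map_dist[OF N_in_M] by (intro continuous_intros) auto

lemma cell_closed: assumes "z \<in> N" shows "closedin mtopology (cell z)"
proof -
  have "cell z = L \<inter> (\<Inter>w\<in>N. {p \<in> topspace mtopology. pow w p - pow z p \<in> {0..}})"
    using L_sub by (auto simp: cell_def)
  moreover have "closedin mtopology (\<Inter>w\<in>N. {p \<in> topspace mtopology. pow w p - pow z p \<in> {0..}})"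
    using assms by (intro closedin_INT closedin_continuous_map_preimage[where Y = euclideanreal]
      continuous_map_diff continuous_map_pow) auto
  ultimately show ?thesis using L_closed by (simp add: closedin_Int)
qed

lemma wall_closed: "closedin mtopology wall"
  unfolding wall_def using finN cell_closed by (auto intro!: closedin_Union closedin_Int)

lemma wall_sub: "wall \<subseteq> L"
  using cell_sub by (auto simp: wall_def)

lemma pow_center_less: "z \<in> N \<Longrightarrow> w \<in> N \<Longrightarrow> w \<noteq> z \<Longrightarrow> pow z z < pow w z"
  using sep[of z w] N_in_M[of z] commute[of z w] by (simp add: pow_def)

lemma center_in_cell: "z \<in> N \<Longrightarrow> z \<in> cell z"
  using pow_center_less[of z] N_sub by (force simp: cell_def)

lemma not_wallI:
  assumes "z \<in> N" "\<And>w. w \<in> N \<Longrightarrow> w \<noteq> z \<Longrightarrow> pow z p < pow w p"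
  shows "p \<notin> wall"
proof
  assume "p \<in> wall"
  then obtain u v where "u \<in> N" "v \<in> N" "u \<noteq> v" "p \<in> cell u" "p \<in> cell v" by (auto simp: wall_def)
  then show False using assms by (cases "u = z") (fastforce simp: cell_def)+
qed

lemma center_not_wall: "z \<in> N \<Longrightarrow> z \<notin> wall"
  by (rule not_wallI) (auto intro: pow_center_less)

lemma pow_along_ray:
  assumes z: "z \<in> N" and p: "p \<in> mball z (2 * R z)" and t: "0 \<le> t" "t * d z p < 2 * R z"
  shows "pow z (dil z t p) = t\<^sup>2 * (d z p)\<^sup>2 - (R z)\<^sup>2"
  using dil_dist_center[OF N_conic[OF z] p t] by (simp add: pow_def power_mult_distrib)

lemma continuous_on_pow_ray:
  assumes z: "z \<in> N" and w: "w \<in> N" and p: "p \<in> mball z (2 * R z)"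
    and T: "T \<subseteq> {t. 0 \<le> t \<and> t * d z p < 2 * R z}"
  shows "continuous_on T (\<lambda>t. pow w (dil z t p))"
proof -
  have "(d z p)-lipschitz_on T (\<lambda>t. d w (dil z t p))"
  proof (rule lipschitz_onI)
    fix s t assume st: "s \<in> T" "t \<in> T"
    then have "0 \<le> s" "s * d z p < 2 * R z" "0 \<le> t" "t * d z p < 2 * R z" using T by auto
    note * = dil_dist_same[OF N_conic[OF z] p this] dil_in_M[OF N_conic[OF z] p this(1,2)]
      dil_in_M[OF N_conic[OF z] p this(3,4)]
    show "dist (d w (dil z s p)) (d w (dil z t p)) \<le> d z p * dist s t"
      using abs_dist_diff_le[OF *(2,3) N_in_M[OF w]] *(1) by (simp add: dist_real_def mult.commute)
  qed simp
  then have "continuous_on T (\<lambda>t. d w (dil z t p))" by (rule lipschitz_on_continuous_on)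
  then show ?thesis unfolding pow_def by (intro continuous_intros)
qed

text \<open>The difference \<open>\<phi>\<close> of the two power functions along the ray is positive at the centre and
  nonnegative at \<open>p\<close>. Where it is nonpositive the ray runs inside \<open>B(w, R w)\<close>, so \<open>\<phi>\<close> is affine
  near such a parameter, and a minimum there would extend to the left. Taking the first
  minimum avoids the question whether the whole ray lies in the conic ball of \<open>w\<close>.\<close>
lemma transversal:
  assumes z: "z \<in> N" and w: "w \<in> N" "w \<noteq> z" and p: "p \<in> cell z" and t: "0 \<le> t" "t < 1"
  shows "pow z (dil z t p) < pow w (dil z t p)"
proof (rule ccontr)
  assume neg: "\<not> ?thesis"
  note pb = cell_in_ball[OF z p] and c = N_conic[OF z] and cw = N_conic[OF w(1)]
  define l where "l = d z p"
  have l: "0 \<le> l" "l < R z" using cell_dist[OF z p] by (auto simp: l_def)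
  have bnd: "u * d z p < 2 * R z" if "u \<le> 1" "0 \<le> u" for u
    using dil_shrink_bound[OF c pb] that by simp
  define \<phi> where "\<phi> u = pow w (dil z u p) - pow z (dil z u p)" for u
  have cont: "continuous_on {0..1} \<phi>" unfolding \<phi>_def
    using bnd by (intro continuous_intros continuous_on_pow_ray z w pb) auto
  obtain m where m: "m \<in> {0..1}" "\<And>u. u \<in> {0..1} \<Longrightarrow> \<phi> m \<le> \<phi> u"
    using continuous_attains_inf[OF _ _ cont] by auto
  have pM: "p \<in> M" and zM: "z \<in> M" using pb by auto
  have "0 \<le> \<phi> 1" using p w dil_1[OF pM] by (simp add: \<phi>_def cell_def)
  moreover have \<phi>t: "\<phi> t \<le> 0" using neg by (simp add: \<phi>_def)
  ultimately obtain m' where m': "m' \<in> {0..<1}" "\<phi> m' = \<phi> m"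
    using m t by (metis atLeastAtMost_iff atLeastLessThan_iff less_eq_real_def order_antisym_conv order_trans)
  \<comment> \<open>Minimum points; the least of them is neither 0 nor 1.\<close>
  define Z where "Z = {u\<in>{0..1}. \<phi> u = \<phi> m}"
  have "compact Z" unfolding Z_def
    by (rule compact_closed_subset_Icc[OF continuous_closed_preimage_constant[OF cont]]) auto
  moreover have "m' \<in> Z" using m' by (auto simp: Z_def)
  ultimately obtain u where u: "u \<in> Z" "\<And>v. v \<in> Z \<Longrightarrow> u \<le> v"
    using compact_attains_inf[of Z] by blast
  have "u \<le> m'" using u(2) \<open>m' \<in> Z\<close> by blast
  have "\<phi> u \<le> 0" using u(1) m(2)[of t] t \<phi>t by (auto simp: Z_def)
  moreover have "0 < \<phi> 0" using pow_center_less[OF z w] dil_0[OF zM] by (simp add: \<phi>_def)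
  ultimately have u01: "0 < u" "u < 1" using u(1) m' \<open>u \<le> m'\<close> by (auto simp: Z_def less_le)
  have "pow z (dil z u p) < 0"
  proof -
    have "u * l < R z" using u01 l mult_left_le_one_le[of l u] by linarith
    then show ?thesis using pow_neg_iff[OF z] dil_dist_center[OF c pb] bnd u01 by (simp add: l_def)
  qed
  then have "pow w (dil z u p) < 0" using \<open>\<phi> u \<le> 0\<close> unfolding \<phi>_def by linarith
  then have wu: "d w (dil z u p) < R w" using pow_neg_iff[OF w(1)] by blast
  define \<delta> where "\<delta> = min (min u (1 - u)) (R w / (l + 1))"
  have \<delta>: "0 < \<delta>" "\<delta> \<le> u" "\<delta> \<le> 1 - u" using u01 R_pos[OF w(1)] l by (auto simp: \<delta>_def)
  have "\<delta> \<le> R w / (l + 1)" by (simp add: \<delta>_def)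
  then have "\<delta> * (l + 1) \<le> R w" using l by (simp add: pos_le_divide_eq)
  then have \<delta>l: "\<delta> * l \<le> R w" using \<delta>(1) by (simp add: algebra_simps)
  have wm: "w \<in> M" using N_in_M w by blast
  have inb: "dil z v p \<in> mball w (2 * R w)" if v: "0 \<le> v" "v \<le> 1" "\<bar>u - v\<bar> \<le> \<delta>" for v
  proof -
    have "d w (dil z v p) \<le> d w (dil z u p) + d (dil z u p) (dil z v p)"
      using triangle[OF wm] dil_in_M[OF c pb] bnd v u01 by simp
    also have "d (dil z u p) (dil z v p) = \<bar>u - v\<bar> * l"
      using dil_dist_same[OF c pb] bnd u01 v by (simp add: l_def)
    also have "\<dots> \<le> \<delta> * l" using v l by (simp add: mult_right_mono)
    finally show ?thesis using wu \<delta>l dil_in_M[OF c pb v(1) bnd] v wm by simp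
  qed
  \<comment> \<open>Stewart for \<open>w\<close> with the midpoint of a short piece of the ray: the quadratic terms cancel.\<close>
  have "\<phi> (u - \<delta>) + \<phi> (u + \<delta>) = 2 * \<phi> u"
  proof -
    have e: "d (dil z (u - \<delta>) p) (dil z (u + \<delta>) p) = 2 * \<delta> * l"
      "d (dil z (u - \<delta>) p) (dil z u p) = \<delta> * l" "d (dil z u p) (dil z (u + \<delta>) p) = \<delta> * l"
      using dil_dist_same[OF c pb] bnd u01 \<delta> by (simp_all add: l_def)
    have "(d w (dil z u p))\<^sup>2 = (1 - 1 / 2) * (d w (dil z (u - \<delta>) p))\<^sup>2 + 1 / 2 * (d w (dil z (u + \<delta>) p))\<^sup>2
        - 1 / 2 * (1 - 1 / 2) * (2 * \<delta> * l)\<^sup>2"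
      unfolding e(1)[symmetric] using \<delta> u01
      by (intro stewart[OF cw] inb) (simp_all add: e)
    then have W: "pow w (dil z (u - \<delta>) p) + pow w (dil z (u + \<delta>) p) - 2 * pow w (dil z u p) = 2 * (\<delta> * l)\<^sup>2"
      by (simp add: pow_def power2_eq_square algebra_simps)
    have ray: "pow z (dil z v p) = v\<^sup>2 * l\<^sup>2 - (R z)\<^sup>2" if "0 \<le> v" "v \<le> 1" for v
      using pow_along_ray[OF z pb that(1) bnd[OF that(2,1)]] by (simp add: l_def)
    have "pow z (dil z (u - \<delta>) p) + pow z (dil z (u + \<delta>) p) - 2 * pow z (dil z u p) = 2 * (\<delta> * l)\<^sup>2"
      using ray[of "u - \<delta>"] ray[of "u + \<delta>"] ray[of u] u01 \<delta>
      by (simp add: power2_eq_square algebra_simps)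
    with W show ?thesis by (simp add: \<phi>_def)
  qed
  moreover have "\<phi> u = \<phi> m" "\<phi> m \<le> \<phi> (u - \<delta>)" "\<phi> m \<le> \<phi> (u + \<delta>)"
    using u(1) m(2) u01 \<delta> by (auto simp: Z_def)
  ultimately have "u - \<delta> \<in> Z" using u01 \<delta> by (auto simp: Z_def)
  then show False using u(2) \<delta> by force
qed

lemma star:
  assumes z: "z \<in> N" and p: "p \<in> cell z" and t: "0 \<le> t" "t \<le> 1"
  shows "dil z t p \<in> cell z"
proof -
  note pb = cell_in_ball[OF z p] and c = N_conic[OF z]
  consider "t = 1" | "t = 0" | "0 < t" "t < 1" using t by linarith
  then show ?thesis
  proof cases
    case 3
    have "dil z t p \<in> L"
      using L_conic[OF z] pb p dil_shrink_bound[OF c pb t] 3 cell_sub unfolding conic_set_def by blast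
    moreover have "pow z (dil z t p) \<le> pow w (dil z t p)" if "w \<in> N" for w
      using transversal[OF z that _ p t(1) 3(2)] by (cases "w = z") auto
    ultimately show ?thesis by (simp add: cell_def)
  qed (use dil_1[of p z] dil_0 N_in_M[OF z] pb p center_in_cell[OF z] in auto)
qed

lemma ray_not_wall:
  assumes z: "z \<in> N" and p: "p \<in> cell z" and t: "0 \<le> t" "t < 1"
  shows "dil z t p \<notin> wall"
  by (rule not_wallI[OF z]) (use transversal[OF z _ _ p t] in auto)

text \<open>At the last parameter for which the ray is in the cell some other centre must win right
  afterwards; there are only finitely many centres, so one of them ties at that parameter.\<close>
lemma exit_point:
  assumes z: "z \<in> N" and p: "p \<in> cell z" and ne: "p \<noteq> z"
  shows "\<exists>q\<in>cell z \<inter> wall. \<exists>s. 0 < s \<and> s \<le> 1 \<and> p = dil z s q"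
proof -
  note pb = cell_in_ball[OF z p] and c = N_conic[OF z]
  define a where "a = d z p"
  have a: "0 < a" "a < R z" using cell_dist[OF z p] ne pb by (auto simp: a_def mdist_pos_eq)
  define B where "B = R z / a"
  have B: "1 < B" using a by (simp add: B_def)
  have bnd: "t * d z p < 2 * R z" if "t \<le> B" for t
  proof -
    have "t * a \<le> B * a" using that a by simp
    also have "B * a = R z" using a by (simp add: B_def)
    finally show ?thesis using R_pos[OF z] by (simp add: a_def)
  qed
  have inL: "dil z t p \<in> L" if "0 < t" "t \<le> B" for t
    using L_conic[OF z] pb p bnd that cell_sub unfolding conic_set_def by blast
  define f where "f w t = pow w (dil z t p) - pow z (dil z t p)" for w t
  have contf: "continuous_on {1..B} (f w)" if "w \<in> N" for w unfolding f_def
    using bnd by (intro continuous_intros continuous_on_pow_ray z that pb) auto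
  define T where "T = (\<Inter>w\<in>N. {t\<in>{1..B}. f w t \<in> {0..}})"
  have "closed {t\<in>{1..B}. f w t \<in> {0..}}" if "w \<in> N" for w
    using continuous_closed_preimage[OF contf[OF that], of "{0..}"]
    by (simp add: vimage_def Int_def)
  then have "closed T" unfolding T_def by (intro closed_INT) blast
  moreover have "T \<subseteq> {1..B}" using z by (auto simp: T_def)
  ultimately have cT: "compact T" by (rule compact_closed_subset_Icc)
  have Tcell: "t \<in> T \<longleftrightarrow> t \<in> {1..B} \<and> dil z t p \<in> cell z" for t
    using z inL[of t] by (auto simp: T_def f_def cell_def)
  have "1 \<in> T" unfolding Tcell using B p dil_1[of p z] pb by simp
  then obtain t where t: "t \<in> T" "\<And>u. u \<in> T \<Longrightarrow> u \<le> t"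
    using compact_attains_sup[OF cT] by blast
  define q where "q = dil z t p"
  have tB: "1 \<le> t" "t \<le> B" and q: "q \<in> cell z" using t(1) Tcell by (auto simp: q_def)
  have "t * a < R z"
    using cell_dist[OF z q] dil_dist_center[OF c pb, of t] bnd[OF tB(2)] tB by (simp add: q_def a_def)
  then have "t < B" using a by (simp add: B_def field_simps)
  have "\<exists>w\<in>N - {z}. f w t \<le> 0"
  proof (rule ccontr)
    assume "\<not> ?thesis"
    then have "\<forall>w\<in>N - {z}. 0 < f w t" by force
    moreover have "(f w \<longlongrightarrow> f w t) (at t within {1..B})" if "w \<in> N" for w
      using contf[OF that] tB by (simp add: continuous_on_def)
    ultimately have "\<forall>w\<in>N - {z}. eventually (\<lambda>u. 0 < f w u) (at t within {1..B})"
      using order_tendstoD(1) by blast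
    then have "eventually (\<lambda>u. \<forall>w\<in>N - {z}. 0 < f w u) (at t within {1..B})"
      using finN by (simp add: eventually_ball_finite)
    then obtain \<delta> where \<delta>: "\<delta> > 0" "\<And>u w. u \<in> {1..B} \<Longrightarrow> u \<noteq> t \<Longrightarrow> dist u t < \<delta> \<Longrightarrow> w \<in> N - {z} \<Longrightarrow> 0 < f w u"
      unfolding eventually_at by blast
    define u where "u = min B (t + \<delta> / 2)"
    have u: "t < u" "u \<in> {1..B}" "dist u t < \<delta>"
      using \<delta>(1) \<open>t < B\<close> tB by (auto simp: u_def dist_real_def)
    have "0 \<le> f w u" if "w \<in> N" for w
      using \<delta>(2)[OF u(2) _ u(3), of w] u(1) that by (cases "w = z") (auto simp: f_def)
    then have "u \<in> T" using u(2) by (auto simp: T_def)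
    then show False using t(2) u(1) by force
  qed
  then obtain w where w: "w \<in> N - {z}" "pow w q \<le> pow z q" by (auto simp: f_def q_def)
  then have "q \<in> cell w" using q by (force simp: cell_def)
  then have "q \<in> wall" using w(1) q z by (auto simp: wall_def)
  moreover have "p = dil z (1 / t) q"
    using dil_inverse[OF c pb, of t] bnd tB by (simp add: q_def)
  ultimately show ?thesis using q tB by (intro bexI[of _ q] exI[of _ "1 / t"]) auto
qed

text \<open>Near a point where the two power functions agree, their difference vanishes at \<open>p\<close> and is
  affine along rays from \<open>p\<close>, hence homogeneous under dilations about \<open>p\<close>.\<close>
lemma pow_diff_homogeneous:
  assumes z: "z \<in> N" and w: "w \<in> N" and p: "conic p \<rho>"
    and zp: "d z p < R z" "\<rho> \<le> R z" and wp: "d w p < R w" "\<rho> \<le> R w"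
    and eq: "pow z p = pow w p" and y: "y \<in> mball p \<rho>" and t: "0 < t" "t * d p y < \<rho>"
  shows "pow z (dil p t y) - pow w (dil p t y) = t * (pow z y - pow w y)"
proof -
  have pM: "p \<in> M" using conic_center[OF p] .
  have inb: "x \<in> mball v (2 * R v)" if "v \<in> N" "d v p < R v" "\<rho> \<le> R v" "x \<in> mball p \<rho>" for v x
    using that triangle[OF N_in_M[OF that(1)] pM, of x] N_in_M[OF that(1)] by auto
  have pb: "p \<in> mball p \<rho>" using conic_center_ball[OF p] .
  have *: "pow z (dil p t y) - pow w (dil p t y) = t * (pow z y - pow w y)"
    if y: "y \<in> mball p \<rho>" and t: "0 < t" "t \<le> 1" for t y
  proof -
    have tb: "t * d p y < \<rho>" using dil_shrink_bound[OF p y] t by simp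
    have yM: "y \<in> M" using y by simp
    have t0: "0 \<le> t" using t by simp
    note D = dil_dist_center[OF p y t0 tb] dil_dist_self[OF p y t0 tb] dil_in_ball[OF p y t0 tb]
    have "(d v (dil p t y))\<^sup>2 = (1 - t) * (d v p)\<^sup>2 + t * (d v y)\<^sup>2 - t * (1 - t) * (d p y)\<^sup>2"
      if v: "v \<in> N" "d v p < R v" "\<rho> \<le> R v" for v
      using D t by (intro stewart[OF N_conic[OF v(1)]] inb[OF v] y pb)
        (simp_all add: commute)
    from this[OF z zp] this[OF w wp]
    have "(d z (dil p t y))\<^sup>2 - (d w (dil p t y))\<^sup>2
      = (1 - t) * ((d z p)\<^sup>2 - (d w p)\<^sup>2) + t * ((d z y)\<^sup>2 - (d w y)\<^sup>2)"
      by (simp add: algebra_simps)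
    moreover have "(d z p)\<^sup>2 - (d w p)\<^sup>2 = (R z)\<^sup>2 - (R w)\<^sup>2" using eq by (simp add: pow_def)
    ultimately show ?thesis by (simp add: pow_def algebra_simps)
  qed
  show ?thesis
  proof (cases "t \<le> 1")
    case False
    have "pow z (dil p (1 / t) (dil p t y)) - pow w (dil p (1 / t) (dil p t y))
        = 1 / t * (pow z (dil p t y) - pow w (dil p t y))"
      using False t by (intro * dil_in_ball[OF p y]) auto
    then show ?thesis unfolding dil_inverse[OF p y t] using False by (simp add: field_simps)
  qed (use * y t in simp)
qed

text \<open>By homogeneity the sign of \<open>pow z - pow w\<close> is constant along rays from \<open>p\<close> when it vanishes at
  \<open>p\<close>; otherwise the sign is constant near \<open>p\<close>. This makes the defining inequalities of the cell
  invariant under dilations about \<open>p\<close>.\<close>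
lemma cell_locally_conic:
  assumes p: "conic p \<rho>" and pL: "conic_set p \<rho> L" and z: "z \<in> N"
  shows "\<exists>r>0. r \<le> \<rho> \<and> conic_set p r (cell z)"
proof (cases "p \<in> cell z")
  case False
  then obtain r where r: "r > 0" "disjnt (cell z) (mball p r)"
    using cell_closed[OF z] conic_center[OF p] unfolding closedin_metric by blast
  then have "conic_set p (min r \<rho>) (cell z)"
    unfolding conic_set_def disjnt_def by (auto simp: disjoint_iff)
  then show ?thesis using r(1) conic_pos[OF p] by (intro exI[of _ "min r \<rho>"]) auto
next
  case True
  have pM: "p \<in> M" using conic_center[OF p] .
  define Q where "Q w r \<longleftrightarrow> (\<forall>y\<in>mball p r. \<forall>t>0. t * d p y < r \<longrightarrow> pow z y \<le> pow w y
    \<longrightarrow> pow z (dil p t y) \<le> pow w (dil p t y))" for w r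
  have Qmono: "Q w r" if "Q w s" "r \<le> s" for w r s using that unfolding Q_def by force
  have "\<exists>r. 0 < r \<and> r \<le> \<rho> \<and> Q w r" if w: "w \<in> N" for w
  proof (cases "pow z p < pow w p")
    case less: True
    have "openin mtopology {y \<in> topspace mtopology. pow w y - pow z y \<in> {0<..}}"
      using w z by (intro openin_continuous_map_preimage[where Y = euclideanreal]
        continuous_map_diff continuous_map_pow) auto
    then obtain r where r: "r > 0" "mball p r \<subseteq> {y \<in> topspace mtopology. pow w y - pow z y \<in> {0<..}}"
      using less pM unfolding openin_mtopology by force
    have "pow z (dil p t y) \<le> pow w (dil p t y)"
      if y: "y \<in> mball p (min r \<rho>)" and t: "0 < t" "t * d p y < min r \<rho>" for y t
    proof -
      have y': "y \<in> mball p \<rho>" using y by simp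
      have "dil p t y \<in> mball p r"
        using dil_in_M[OF p y'] dil_dist_center[OF p y'] t pM by simp
      then show ?thesis using r(2) by auto
    qed
    then show ?thesis using r(1) conic_pos[OF p]
      by (intro exI[of _ "min r \<rho>"]) (auto simp: Q_def)
  next
    case False
    then have eq: "pow z p = pow w p" using True w by (force simp: cell_def)
    have dz: "d z p < R z" using cell_dist[OF z True] .
    then have dw: "d w p < R w" using eq pow_neg_iff z w by metis
    define r where "r = min \<rho> (min (R z) (R w))"
    have r: "0 < r" "r \<le> \<rho>" "r \<le> R z" "r \<le> R w" using conic_pos[OF p] R_pos z w by (auto simp: r_def)
    have "Q w r" unfolding Q_def
      using pow_diff_homogeneous[OF z w conic_mono[OF p r(1,2)] dz r(3) dw r(4) eq]
      by (smt (verit) mult_le_0_iff)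
    then show ?thesis using r by blast
  qed
  then obtain r where r: "\<And>w. w \<in> N \<Longrightarrow> 0 < r w \<and> r w \<le> \<rho> \<and> Q w (r w)" by metis
  define r0 where "r0 = Min (r ` N)"
  have ne: "N \<noteq> {}" using z by auto
  have r0_le: "r0 \<le> r w" if "w \<in> N" for w using finN that by (simp add: r0_def)
  have r0: "0 < r0" "r0 \<le> \<rho>" "\<And>w. w \<in> N \<Longrightarrow> Q w r0"
    using finN ne r r0_le[OF z] r[OF z] Qmono[OF _ r0_le] by (auto simp: r0_def)
  have "conic_set p r0 (cell z)"
    unfolding conic_set_def
  proof (intro ballI allI impI)
    fix y t assume y: "y \<in> mball p r0 \<inter> cell z" and t: "0 < (t::real)" "t * d p y < r0"
    have "dil p t y \<in> L" using pL y t r0(2) cell_sub unfolding conic_set_def by fastforce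
    moreover have "pow z (dil p t y) \<le> pow w (dil p t y)" if "w \<in> N" for w
      using r0(3)[OF that] y t that unfolding Q_def cell_def by blast
    ultimately show "dil p t y \<in> cell z" by (simp add: cell_def)
  qed
  then show ?thesis using r0 by blast
qed

lemma wall_conic_set: "(\<And>z. z \<in> N \<Longrightarrow> conic_set p \<rho> (cell z)) \<Longrightarrow> conic_set p \<rho> wall"
  unfolding conic_set_def wall_def by (simp only: Int_iff UN_iff) blast

end

text \<open>In a Euclidean space \<open>x\<close> would be \<open>p\<close> moved in the direction from \<open>z\<close> to \<open>w\<close>, which is
  orthogonal to the level set \<open>pow z = pow w\<close>. The translation is obtained by dilating about \<open>z\<close> with
  factor \<open>1 + s\<close> and then about \<open>w\<close> with the inverse factor. Subtracting the two instances of
  Stewart's identity shows that \<open>(d y x)\<^sup>2 - (d y p)\<^sup>2\<close> is the same for all \<open>y\<close> of the level set,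
  and \<open>y = p\<close> identifies the constant. Sets that are conic at \<open>z\<close> and \<open>w\<close> are preserved by both
  dilations; they will be the cells of earlier stages.\<close>
lemma (in power_cells) perpendicular_point:
  assumes z: "z \<in> N" and w: "w \<in> N" "w \<noteq> z" and p: "p \<in> cell z" "p \<in> cell w" and \<epsilon>: "0 < \<epsilon>"
  shows "\<exists>x\<in>M. x \<noteq> p \<and> d p x < \<epsilon> \<and>
    (\<forall>A. p \<in> A \<longrightarrow> conic_set z (2 * R z) A \<longrightarrow> conic_set w (2 * R w) A \<longrightarrow> x \<in> A) \<and>
    (\<forall>y\<in>M. d p y < R z \<longrightarrow> d p y < R w \<longrightarrow> pow z y = pow w y \<longrightarrow>
      (d y x)\<^sup>2 = (d y p)\<^sup>2 + (d p x)\<^sup>2)"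
proof -
  note pb = cell_in_ball[OF z p(1)] and c = N_conic[OF z] and cw = N_conic[OF w(1)]
  have pM: "p \<in> M" and zM: "z \<in> M" and wM: "w \<in> M" using pb N_in_M w by auto
  define a where "a = d z p"
  have a: "0 \<le> a" "a < R z" using cell_dist[OF z p(1)] by (auto simp: a_def)
  have dw: "d w p < R w" using cell_dist[OF w(1) p(2)] .
  have Rp: "0 < R z" "0 < R w" using R_pos z w by auto
  have peq: "pow z p = pow w p" using p z w by (force simp: cell_def)
  have "z \<noteq> p" using p w z pow_center_less[OF z w] by (force simp: cell_def)
  then have a0: "0 < a" using a zM pM by (simp add: a_def mdist_pos_eq)
  define s where "s = min 1 (min (R z / (2 * a)) (min (R w / (2 * a)) (\<epsilon> / (2 * (a + 2 * R w)))))"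
  have s: "0 < s" using a0 Rp \<epsilon> by (simp add: s_def)
  have "s \<le> R z / (2 * a)" "s \<le> R w / (2 * a)" "s \<le> \<epsilon> / (2 * (a + 2 * R w))"
    by (auto simp: s_def)
  then have s_le: "s * a < R z" "s * a < R w" "s * (a + 2 * R w) < \<epsilon>"
    using a0 Rp \<epsilon> by (auto simp: field_simps)
  \<comment> \<open>The ray from \<open>z\<close> prolonged slightly beyond \<open>p\<close>.\<close>
  define q where "q = dil z (1 + s) p"
  have q_bd: "0 \<le> 1 + s" "(1 + s) * d z p < 2 * R z"
    using s a s_le by (auto simp: a_def[symmetric] algebra_simps)
  have q_zball: "q \<in> mball z (2 * R z)" and qM: "q \<in> M"
    using dil_in_ball[OF c pb q_bd] by (auto simp: q_def)
  have zq: "d z q = (1 + s) * a" using dil_dist_center[OF c pb q_bd] by (simp add: q_def a_def)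
  have pq: "d p q = s * a" using dil_dist_self[OF c pb q_bd] s by (simp add: q_def a_def)
  have wq: "d w q < 2 * R w" using triangle[OF wM pM qM] pq dw s_le by simp
  have q_wball: "q \<in> mball w (2 * R w)" using wq wM qM by simp
  define \<kappa> where "\<kappa> = 1 / (1 + s)"
  have \<kappa>: "0 < \<kappa>" "\<kappa> < 1" using s by (auto simp: \<kappa>_def)
  have \<kappa>s: "\<kappa> * (1 + s) = 1" using s by (simp add: \<kappa>_def)
  have p_q: "p = dil z \<kappa> q"
    using dil_inverse[OF c pb, of "1 + s"] q_bd s by (simp add: q_def \<kappa>_def)
  define x where "x = dil w \<kappa> q"
  have bq: "\<kappa> * d z q < 2 * R z" "\<kappa> * d w q < 2 * R w"
    using dil_shrink_bound[OF c q_zball, of \<kappa>] dil_shrink_bound[OF cw q_wball, of \<kappa>] \<kappa> by auto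
  have xM: "x \<in> M" using dil_in_M[OF cw q_wball _ bq(2)] \<kappa> by (simp add: x_def)
  have key: "(d y x)\<^sup>2 - (d y p)\<^sup>2
      = (1 - \<kappa>) * ((R w)\<^sup>2 - (R z)\<^sup>2) - \<kappa> * (1 - \<kappa>) * ((d w q)\<^sup>2 - (d z q)\<^sup>2)"
    if y: "y \<in> M" "d p y < R z" "d p y < R w" "pow z y = pow w y" for y
  proof -
    have "y \<in> mball z (2 * R z)" using triangle[OF zM pM y(1)] y a zM by (simp add: a_def)
    from dil_law_1[OF c this q_zball _ bq(1)]
    have 1: "(d y p)\<^sup>2 = (1 - \<kappa>) * (d z y)\<^sup>2 + \<kappa> * (d y q)\<^sup>2 - \<kappa> * (1 - \<kappa>) * (d z q)\<^sup>2"
      using \<kappa> p_q by simp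
    have "y \<in> mball w (2 * R w)" using triangle[OF wM pM y(1)] y dw wM by simp
    from dil_law_1[OF cw this q_wball _ bq(2)]
    have 2: "(d y x)\<^sup>2 = (1 - \<kappa>) * (d w y)\<^sup>2 + \<kappa> * (d y q)\<^sup>2 - \<kappa> * (1 - \<kappa>) * (d w q)\<^sup>2"
      using \<kappa> by (simp add: x_def)
    have 3: "(d w y)\<^sup>2 = (d z y)\<^sup>2 + ((R w)\<^sup>2 - (R z)\<^sup>2)" using y(4) by (simp add: pow_def)
    show ?thesis unfolding 1 2 3 by (simp add: algebra_simps)
  qed
  have kp: "(d p x)\<^sup>2 = (1 - \<kappa>) * ((R w)\<^sup>2 - (R z)\<^sup>2) - \<kappa> * (1 - \<kappa>) * ((d w q)\<^sup>2 - (d z q)\<^sup>2)"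
    using key[OF pM] pM Rp peq by simp
  have "(d y x)\<^sup>2 = (d y p)\<^sup>2 + (d p x)\<^sup>2"
    if y: "y \<in> M" "d p y < R z" "d p y < R w" "pow z y = pow w y" for y
    using key[OF y] kp by simp
  moreover have "x \<in> A" if A: "p \<in> A" "conic_set z (2 * R z) A" "conic_set w (2 * R w) A" for A
  proof -
    have "q \<in> A" using A(1,2) pb q_bd s unfolding conic_set_def q_def by auto
    then show ?thesis using A(3) q_wball bq(2) \<kappa> unfolding conic_set_def x_def by auto
  qed
  moreover have "d p x < \<epsilon>"
  proof -
    have "1 - \<kappa> = s * \<kappa>" using \<kappa>s by (simp add: algebra_simps)
    then have "1 - \<kappa> \<le> s" using \<kappa> s by simp
    have "d q x = (1 - \<kappa>) * d w q"
      using dil_dist_self[OF cw q_wball _ bq(2)] \<kappa> by (simp add: x_def)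
    also have "\<dots> \<le> s * (2 * R w)" using \<open>1 - \<kappa> \<le> s\<close> \<kappa> wq s by (intro mult_mono) auto
    finally have "d p x \<le> s * a + s * (2 * R w)" using triangle[OF pM qM xM] pq by simp
    then show ?thesis using s_le(3) by (simp add: algebra_simps)
  qed
  moreover have "x \<noteq> p"
  proof
    \<comment> \<open>If nothing moved, the rays from \<open>z\<close> and \<open>w\<close> would agree near \<open>p\<close>, with equal radii; then \<open>z\<close> and \<open>w\<close> would tie before \<open>p\<close>, against transversality.\<close>
    assume xp: "x = p"
    have wp: "d w p = \<kappa> * d w q"
      using dil_dist_center[OF cw q_wball _ bq(2)] \<kappa> xp by (simp add: x_def)
    have "d p q = (1 - \<kappa>) * d w q"
      using dil_dist_self[OF cw q_wball _ bq(2)] \<kappa> xp commute by (simp add: x_def)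
    then have "s * a = (1 - \<kappa>) * d w q" using pq by simp
    also have "1 - \<kappa> = s * \<kappa>" using \<kappa>s by (simp add: algebra_simps)
    finally have "a = \<kappa> * d w q" using s by simp
    then have wa: "d w p = a" and wq': "d w q = (1 + s) * a"
      using wp \<kappa>s by (auto simp: algebra_simps) (metis mult.commute mult.left_commute mult_1 distrib_left)
    have "R z = R w" using peq wa Rp by (simp add: pow_def a_def)
    define \<delta> where "\<delta> = min (1 / 2) (min (R w) (R z) / (2 * a))"
    have \<delta>: "0 < \<delta>" "\<delta> < 1" using a0 Rp by (auto simp: \<delta>_def)
    define y where "y = dil z (1 - \<delta>) p"
    have yb: "0 \<le> 1 - \<delta>" "(1 - \<delta>) * d z p < 2 * R z"
      using \<delta> dil_shrink_bound[OF c pb, of "1 - \<delta>"] by auto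
    have yM: "y \<in> M" using dil_in_M[OF c pb yb] by (simp add: y_def)
    have py: "d p y = \<delta> * a" using dil_dist_self[OF c pb yb] \<delta> by (simp add: y_def a_def)
    have yq: "d y q = (\<delta> + s) * a"
      using dil_dist_same[OF c pb yb q_bd] \<delta> s by (simp add: y_def q_def a_def)
    have zy: "d z y = (1 - \<delta>) * a" using dil_dist_center[OF c pb yb] by (simp add: y_def a_def)
    have "\<delta> \<le> min (R w) (R z) / (2 * a)" unfolding \<delta>_def by (rule min.cobounded2)
    then have "\<delta> * a < R w" using a0 Rp by (auto simp: field_simps)
    then have "y \<in> mball w (2 * R w)" using triangle[OF wM pM yM] py dw wM yM by simp
    from dil_law_1[OF cw this q_wball _ bq(2)]
    have "(\<delta> * a)\<^sup>2 = (1 - \<kappa>) * (d w y)\<^sup>2 + \<kappa> * ((\<delta> + s) * a)\<^sup>2 - \<kappa> * (1 - \<kappa>) * ((1 + s) * a)\<^sup>2"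
      using \<kappa> xp py yq wq' commute[of y p] by (simp add: x_def)
    then have "(1 - \<kappa>) * (d w y)\<^sup>2 = a\<^sup>2 * (\<delta>\<^sup>2 - \<kappa> * (\<delta> + s)\<^sup>2 + (1 - \<kappa>) * (1 + s) * (\<kappa> * (1 + s)))"
      by (simp add: power2_eq_square algebra_simps)
    also have "\<dots> = a\<^sup>2 * (\<delta>\<^sup>2 - \<kappa> * (\<delta> + s)\<^sup>2 + (1 - \<kappa>) * (1 + s))" unfolding \<kappa>s by simp
    also have "\<delta>\<^sup>2 - \<kappa> * (\<delta> + s)\<^sup>2 + (1 - \<kappa>) * (1 + s) = (1 - \<kappa>) * (1 - \<delta>)\<^sup>2"
      using s by (simp add: \<kappa>_def divide_simps) (simp add: power2_eq_square algebra_simps)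
    finally have "(d w y)\<^sup>2 = (d z y)\<^sup>2" using \<kappa> zy by (simp add: power_mult_distrib)
    then have "pow w y = pow z y" using \<open>R z = R w\<close> by (simp add: pow_def)
    moreover have "pow z y < pow w y"
      unfolding y_def using \<delta> by (intro transversal[OF z w p(1)]) auto
    ultimately show False by simp
  qed
  ultimately show ?thesis using xM by blast
qed

section \<open>Iterated walls\<close>

context Metric_space
begin

definition locally_conic_set :: "'a set \<Rightarrow> bool" where
  "locally_conic_set A \<longleftrightarrow> (\<forall>p \<rho>. conic p \<rho> \<longrightarrow> (\<exists>r>0. r \<le> \<rho> \<and> conic_set p r A))"

lemma locally_conic_family:
  assumes "finite F" "\<And>A. A \<in> F \<Longrightarrow> locally_conic_set A" "conic p \<rho>"
  shows "\<exists>r>0. r \<le> \<rho> \<and> (\<forall>A\<in>F. conic_set p r A)"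
  using assms(1,2)
proof (induction F rule: finite_induct)
  case empty
  then show ?case using conic_pos[OF assms(3)] by auto
next
  case (insert A F)
  then obtain r where r: "r > 0" "r \<le> \<rho>" "\<forall>A\<in>F. conic_set p r A" by auto
  obtain s where s: "s > 0" "s \<le> \<rho>" "conic_set p s A"
    using insert.prems[of A] assms(3) unfolding locally_conic_set_def by blast
  have "\<forall>B\<in>insert A F. conic_set p (min r s) B"
    using r(3) s(3) by (auto intro: conic_set_mono[where \<rho> = r] conic_set_mono[where \<rho> = s])
  then show ?case using r s by (intro exI[of _ "min r s"]) auto
qed

text \<open>The family \<open>F\<close> will collect all cells of earlier stages; the conic balls of the new centres are
  chosen so small that these cells are conic in them.\<close>
lemma power_cells_exist:
  assumes comp: "compact_space mtopology" and conic: "\<And>p. p \<in> M \<Longrightarrow> \<exists>\<rho>. conic p \<rho>"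
    and L: "closedin mtopology L" "locally_conic_set L"
    and F: "finite F" "\<And>A. A \<in> F \<Longrightarrow> locally_conic_set A"
  shows "\<exists>N R. power_cells M d L N R \<and> (\<forall>z\<in>N. \<forall>A\<in>F. conic_set z (2 * R z) A)"
proof -
  have LM: "L \<subseteq> M" using L(1) closedin_subset by fastforce
  have "\<exists>r. 0 < r \<and> r \<le> 1 \<and> conic p (2 * r) \<and> (\<forall>A\<in>insert L F. conic_set p (2 * r) A)"
    if pL: "p \<in> L" for p
  proof -
    obtain \<rho> where \<rho>: "conic p \<rho>" using conic[of p] LM pL by auto
    define \<rho>' where "\<rho>' = min 2 \<rho>"
    have \<rho>': "conic p \<rho>'" using conic_mono[OF \<rho>] conic_pos[OF \<rho>] by (simp add: \<rho>'_def)
    obtain r where r: "r > 0" "r \<le> \<rho>'" "\<forall>A\<in>insert L F. conic_set p r A"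
      using locally_conic_family[OF _ _ \<rho>', of "insert L F"] F L(2) by auto
    show ?thesis
      using r conic_mono[OF \<rho>' r(1,2)] by (intro exI[of _ "r / 2"]) (auto simp: \<rho>'_def)
  qed
  then obtain R where R: "\<And>p. p \<in> L \<Longrightarrow> 0 < R p \<and> R p \<le> 1 \<and> conic p (2 * R p) \<and>
      (\<forall>A\<in>insert L F. conic_set p (2 * R p) A)" by metis
  have "compactin mtopology L" using comp L(1) closedin_compact_space by blast
  then have "\<exists>N. finite N \<and> N \<subseteq> L \<and> L \<subseteq> (\<Union>z\<in>N. mball z (R z)) \<and>
      (\<forall>z\<in>N. \<forall>w\<in>N. z \<noteq> w \<longrightarrow> (R w)\<^sup>2 < (R z)\<^sup>2 + (d z w)\<^sup>2)"
    by (rule greedy_net) (simp add: R)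
  then obtain N where N: "finite N" "N \<subseteq> L" "L \<subseteq> (\<Union>z\<in>N. mball z (R z))"
      "\<forall>z\<in>N. \<forall>w\<in>N. z \<noteq> w \<longrightarrow> (R w)\<^sup>2 < (R z)\<^sup>2 + (d z w)\<^sup>2"
    by (elim exE conjE)
  have "power_cells M d L N R"
  proof (intro power_cells.intro power_cells_axioms.intro)
    show "Metric_space M d" by unfold_locales
    show "finite N" "N \<subseteq> L" "closedin mtopology L" "L \<subseteq> (\<Union>z\<in>N. mball z (R z))"
      using N L(1) by simp_all
    show "0 < R z" "conic z (2 * R z)" "conic_set z (2 * R z) L" if "z \<in> N" for z
      using R N(2) that by blast+
    show "(R w)\<^sup>2 < (R z)\<^sup>2 + (d z w)\<^sup>2" if "z \<in> N" "w \<in> N" "z \<noteq> w" for z w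
      using N(4) that by blast
  qed
  then show ?thesis using R N(2) by blast
qed

end

text \<open>Adaptedness to all earlier stages is what makes the stages fit together: a cell of an earlier
  stage meets a later cell in a union of rays from the later centre.\<close>
locale tower = Metric_space +
  fixes L N :: "nat \<Rightarrow> 'a set" and R :: "nat \<Rightarrow> 'a \<Rightarrow> real"
  assumes cells: "power_cells M d (L m) (N m) (R m)"
    and L_0: "L 0 = M"
    and L_Suc: "L (Suc m) = power_cells.wall d (L m) (N m) (R m)"
    and adapted: "j < m \<Longrightarrow> u \<in> N j \<Longrightarrow> z \<in> N m \<Longrightarrow>
      conic_set z (2 * R m z) (power_cells.cell d (L j) (N j) (R j) u)"

sublocale tower \<subseteq> P: power_cells M d "L m" "N m" "R m" for m by (rule cells)

theorem (in Metric_space) tower_exists: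
  assumes comp: "compact_space mtopology" and conic: "\<And>p. p \<in> M \<Longrightarrow> \<exists>\<rho>. conic p \<rho>"
  shows "\<exists>L N R. tower M d L N R"
proof -
  \<comment> \<open>The state of the recursion also carries the family of all cells constructed so far.\<close>
  define I where "I n S \<longleftrightarrow> (case S of (L, N, R, F) \<Rightarrow> power_cells M d L N R \<and> finite F \<and>
      (\<forall>A\<in>insert L F. locally_conic_set A) \<and> (\<forall>z\<in>N. \<forall>A\<in>F. conic_set z (2 * R z) A) \<and> (n = 0 \<longrightarrow> L = M))"
    for n :: nat and S :: "'a set \<times> 'a set \<times> ('a \<Rightarrow> real) \<times> 'a set set"
  define step where "step n S S' \<longleftrightarrow> (case S of (L, N, R, F) \<Rightarrow> case S' of (L', N', R', F') \<Rightarrow>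
      L' = power_cells.wall d L N R \<and> F' = F \<union> power_cells.cell d L N R ` N)" for n :: nat and S S' :: "'a set \<times> 'a set \<times> ('a \<Rightarrow> real) \<times> 'a set set"
  have "\<exists>f. \<forall>n. I n (f n) \<and> step n (f n) (f (Suc n))"
  proof (rule dependent_nat_choice)
    have "locally_conic_set M"
      unfolding locally_conic_set_def conic_set_def
      using dil_in_M by (meson Int_iff conic_pos less_eq_real_def order_refl)
    moreover have "closedin mtopology M" using closedin_topspace[of mtopology] by simp
    moreover from calculation obtain N R where "power_cells M d M N R"
      using power_cells_exist[OF comp conic, of M "{}"] by blast
    ultimately have "I 0 (M, N, R, {})" by (simp add: I_def)
    then show "\<exists>S. I 0 S" by blast
  next
    fix S n assume S: "I n S"
    obtain L N R F where LNRF: "S = (L, N, R, F)" by (cases S) auto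
    interpret Q: power_cells M d L N R using S by (simp add: I_def LNRF)
    have F: "finite F" "\<And>A. A \<in> insert L F \<Longrightarrow> locally_conic_set A"
      using S by (auto simp: I_def LNRF)
    have cell: "locally_conic_set (Q.cell z)" if z: "z \<in> N" for z
      unfolding locally_conic_set_def
    proof (intro allI impI)
      fix p \<rho> assume p: "conic p \<rho>"
      then obtain r where r: "r > 0" "r \<le> \<rho>" "conic_set p r L"
        using F(2)[of L] unfolding locally_conic_set_def by blast
      then obtain s where "s > 0" "s \<le> r" "conic_set p s (Q.cell z)"
        using Q.cell_locally_conic[OF conic_mono[OF p r(1,2)] r(3) z] by blast
      then show "\<exists>r>0. r \<le> \<rho> \<and> conic_set p r (Q.cell z)" using r(2) by (meson order_trans)
    qed
    have wall: "locally_conic_set Q.wall"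
      unfolding locally_conic_set_def
    proof (intro allI impI)
      fix p \<rho> assume p: "conic p \<rho>"
      obtain r where "r > 0" "r \<le> \<rho>" "\<forall>A\<in>Q.cell ` N. conic_set p r A"
        using locally_conic_family[OF _ _ p, of "Q.cell ` N"] cell Q.finN by auto
      then show "\<exists>r>0. r \<le> \<rho> \<and> conic_set p r Q.wall" using Q.wall_conic_set by blast
    qed
    define F' where "F' = F \<union> Q.cell ` N"
    have F': "finite F'" "\<And>A. A \<in> F' \<Longrightarrow> locally_conic_set A"
      using F cell Q.finN by (auto simp: F'_def)
    obtain N' R' where "power_cells M d Q.wall N' R'" "\<forall>z\<in>N'. \<forall>A\<in>F'. conic_set z (2 * R' z) A"
      using power_cells_exist[OF comp conic Q.wall_closed wall F'] by blast
    then show "\<exists>S'. I (Suc n) S' \<and> step n S S'"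
      using F' wall by (intro exI[of _ "(Q.wall, N', R', F')"]) (auto simp: I_def step_def LNRF F'_def)
  qed
  then obtain f where f: "\<And>n. I n (f n)" "\<And>n. step n (f n) (f (Suc n))" by blast
  define L where "L n = fst (f n)" for n
  define N where "N n = fst (snd (f n))" for n
  define R where "R n = fst (snd (snd (f n)))" for n
  define F where "F n = snd (snd (snd (f n)))" for n
  have fn: "f n = (L n, N n, R n, F n)" for n by (simp add: L_def N_def R_def F_def)
  have FSuc: "F (Suc n) = F n \<union> power_cells.cell d (L n) (N n) (R n) ` N n" for n
    using f(2)[of n] by (simp add: step_def fn)
  have Fmono: "power_cells.cell d (L j) (N j) (R j) ` N j \<subseteq> F m" if "j < m" for j m
    using that
  proof (induction m)
    case (Suc m)
    then show ?case using FSuc[of m] by (cases "j = m") auto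
  qed simp
  have "tower M d L N R"
  proof (intro tower.intro tower_axioms.intro)
    show "Metric_space M d" by unfold_locales
    show "power_cells M d (L m) (N m) (R m)" for m using f(1)[of m] by (simp add: I_def fn)
    show "L 0 = M" using f(1)[of 0] by (simp add: I_def fn)
    show "L (Suc m) = power_cells.wall d (L m) (N m) (R m)" for m
      using f(2)[of m] by (simp add: step_def fn)
    fix j m u z assume j: "j < m" "u \<in> N j" "z \<in> N m"
    have "\<forall>z\<in>N m. \<forall>A\<in>F m. conic_set z (2 * R m z) A" using f(1)[of m] by (simp add: I_def fn)
    then show "conic_set z (2 * R m z) (power_cells.cell d (L j) (N j) (R j) u)"
      using Fmono[OF j(1)] j by blast
  qed
  then show ?thesis by blast
qed

context tower
begin

lemma L_antimono: "m \<le> n \<Longrightarrow> L n \<subseteq> L m"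
  by (rule lift_Suc_antimono_le) (auto simp: L_Suc intro: subsetD[OF P.wall_sub])

text \<open>For a common point \<open>p\<close> of all stages pick two competing centres in each stage and the
  corresponding perpendicular point. A point of stage \<open>m\<close> is obtained by dilations that preserve the
  cells of every earlier stage \<open>j\<close>, so it lies on the level set of stage \<open>j\<close> and Pythagoras applies.
  Rescaled to a fixed distance from \<open>p\<close> the points are pairwise equidistant.\<close>
theorem tower_terminates:
  assumes comp: "compact_space mtopology" and conic: "\<And>p. p \<in> M \<Longrightarrow> \<exists>\<rho>. conic p \<rho>"
  shows "\<exists>m. L m = {}"
proof (rule ccontr)
  assume "\<nexists>m. L m = {}"
  moreover have "decseq L" using L_antimono by (simp add: decseq_def)
  ultimately have "(\<Inter>m. L m) \<noteq> {}"
    by (intro compact_space_imp_nest[OF comp]) (auto intro: P.L_closed)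
  then obtain p where p: "\<And>m. p \<in> L m" by auto
  then have pM: "p \<in> M" using L_0 by auto
  have "\<exists>z w. z \<in> N m \<and> w \<in> N m \<and> w \<noteq> z \<and> p \<in> P.cell m z \<and> p \<in> P.cell m w" for m
    using p[of "Suc m"] unfolding L_Suc P.wall_def by blast
  then obtain z w where zw: "\<And>m. z m \<in> N m" "\<And>m. w m \<in> N m" "\<And>m. w m \<noteq> z m"
    and cz: "\<And>m. p \<in> P.cell m (z m)" "\<And>m. p \<in> P.cell m (w m)" by metis
  obtain \<rho> where \<rho>: "conic p \<rho>" using conic pM by blast
  have \<rho>0: "0 < \<rho>" using conic_pos[OF \<rho>] .
  have "\<exists>x\<in>M. x \<noteq> p \<and> d p x < \<rho> \<and> (\<forall>j<m. d p x < R j (z j) \<and> d p x < R j (w j)) \<and>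
      (\<forall>j<m. P.pow j (z j) x = P.pow j (w j) x) \<and>
      (\<forall>y\<in>M. d p y < R m (z m) \<longrightarrow> d p y < R m (w m) \<longrightarrow> P.pow m (z m) y = P.pow m (w m) y \<longrightarrow>
        (d y x)\<^sup>2 = (d y p)\<^sup>2 + (d p x)\<^sup>2)" for m
  proof -
    define \<epsilon> where "\<epsilon> = Min (insert \<rho> ((\<lambda>j. min (R j (z j)) (R j (w j))) ` {..<m}))"
    have \<epsilon>: "0 < \<epsilon>" "\<epsilon> \<le> \<rho>" "\<And>j. j < m \<Longrightarrow> \<epsilon> \<le> min (R j (z j)) (R j (w j))"
      using \<rho>0 P.R_pos[OF zw(1)] P.R_pos[OF zw(2)] unfolding \<epsilon>_def
      by (auto simp del: min.bounded_iff)
    obtain x where x: "x \<in> M" "x \<noteq> p" "d p x < \<epsilon>"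
      "\<forall>A. p \<in> A \<longrightarrow> conic_set (z m) (2 * R m (z m)) A \<longrightarrow> conic_set (w m) (2 * R m (w m)) A \<longrightarrow> x \<in> A"
      "\<forall>y\<in>M. d p y < R m (z m) \<longrightarrow> d p y < R m (w m) \<longrightarrow> P.pow m (z m) y = P.pow m (w m) y \<longrightarrow>
        (d y x)\<^sup>2 = (d y p)\<^sup>2 + (d p x)\<^sup>2"
      using P.perpendicular_point[OF zw cz \<epsilon>(1), of m] by (elim bexE conjE)
    have "P.pow j (z j) x = P.pow j (w j) x" if "j < m" for j
    proof -
      have "x \<in> P.cell j (z j)" "x \<in> P.cell j (w j)"
        using x(4)[rule_format, OF cz(1)[of j] adapted[OF that zw(1) zw(1)] adapted[OF that zw(1) zw(2)]]
          x(4)[rule_format, OF cz(2)[of j] adapted[OF that zw(2) zw(1)] adapted[OF that zw(2) zw(2)]]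
        by simp_all
      then show ?thesis using zw(1,2)[of j] by (force simp: P.cell_def)
    qed
    moreover have "d p x < \<rho>" "\<forall>j<m. d p x < R j (z j) \<and> d p x < R j (w j)"
      using x(3) \<epsilon> by fastforce+
    ultimately show ?thesis using x(1,2,5) by (intro bexI[of _ x]) simp_all
  qed
  then obtain x where x: "\<And>m. x m \<in> M" "\<And>m. x m \<noteq> p" "\<And>m. d p (x m) < \<rho>"
    and xR: "\<And>m j. j < m \<Longrightarrow> d p (x m) < R j (z j) \<and> d p (x m) < R j (w j)"
    and xe: "\<And>m j. j < m \<Longrightarrow> P.pow j (z j) (x m) = P.pow j (w j) (x m)"
    and pyth: "\<And>m y. y \<in> M \<Longrightarrow> d p y < R m (z m) \<Longrightarrow> d p y < R m (w m) \<Longrightarrow>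
        P.pow m (z m) y = P.pow m (w m) y \<Longrightarrow> (d y (x m))\<^sup>2 = (d y p)\<^sup>2 + (d p (x m))\<^sup>2"
    by metis
  have xb: "x m \<in> mball p \<rho>" for m using x pM by simp
  define u where "u m = dil p (\<rho> / 2 / d p (x m)) (x m)" for m
  have dpos: "0 < d p (x m)" for m using x(1,2)[of m] pM by (metis mdist_pos_less)
  have ub: "0 \<le> \<rho> / 2 / d p (x m)" "\<rho> / 2 / d p (x m) * d p (x m) < \<rho>" for m
    using dpos[of m] \<rho>0 by auto
  have uM: "u m \<in> M" for m unfolding u_def by (rule dil_in_M[OF \<rho> xb ub])
  \<comment> \<open>Orthogonality at \<open>p\<close> survives the rescaling, by the law of cosines.\<close>
  have sep: "(d (u m) (u j))\<^sup>2 = \<rho>\<^sup>2 / 2" if "j < m" for j m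
  proof -
    have e: "(d p (x m))\<^sup>2 + (d p (x j))\<^sup>2 - (d (x m) (x j))\<^sup>2 = 0"
      using pyth[OF x(1), of m j] xR[OF that] xe[OF that] commute by simp
    show ?thesis
      unfolding u_def dil_law[OF \<rho> xb xb ub(1) ub(1) ub(2) ub(2)] e
      using dpos[of m] dpos[of j] by (simp add: power_divide)
  qed
  obtain l \<sigma> where l: "l \<in> M" "strict_mono \<sigma>" "limitin mtopology (u \<circ> \<sigma>) l sequentially"
    using comp uM unfolding compact_space_sequentially by (metis image_subsetI)
  have "0 < \<rho> / 4" using \<rho>0 by simp
  then obtain K where K: "\<forall>n\<ge>K. d (u (\<sigma> n)) l < \<rho> / 4"
    using l(3) unfolding limit_metric_sequentially by (metis comp_apply)
  have "\<sigma> K < \<sigma> (Suc K)" using l(2) by (simp add: strict_mono_def)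
  then have "(d (u (\<sigma> (Suc K))) (u (\<sigma> K)))\<^sup>2 = \<rho>\<^sup>2 / 2" by (rule sep)
  moreover have "d (u (\<sigma> (Suc K))) (u (\<sigma> K)) \<le> \<rho> / 2"
    using triangle'[OF uM l(1) uM, of "\<sigma> (Suc K)" "\<sigma> K"] K[rule_format, of K] K[rule_format, of "Suc K"]
    by simp
  then have "(d (u (\<sigma> (Suc K))) (u (\<sigma> K)))\<^sup>2 \<le> (\<rho> / 2)\<^sup>2" by (intro power_mono) auto
  moreover have "0 < \<rho>\<^sup>2" using \<rho>0 by simp
  ultimately show False by (simp add: power_divide)
qed

end

section \<open>Simplices spanned by chains of centres\<close>

context Metric_space
begin

text \<open>The point with barycentric weights \<open>t\<close> in the iterated join of the listed centres. The weights
  are not normalized; if the weights of the tail vanish, the quotient is 0 and the value is the head,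
  also when all weights vanish and the quotient is \<open>0 / 0 = 0\<close>. Simplices
  have nonempty vertex lists, so the value at the empty list is arbitrary.\<close>
fun join_point :: "'a list \<Rightarrow> ('a \<Rightarrow> real) \<Rightarrow> 'a" where
  "join_point [] t = undefined"
| "join_point [z] t = z"
| "join_point (z # w # zs) t =
     dil z (sum t (set (w # zs)) / sum t (set (z # w # zs))) (join_point (w # zs) t)"

lemma join_point_Cons:
  assumes "zs \<noteq> []"
  shows "join_point (z # zs) t = dil z (sum t (set zs) / sum t (set (z # zs))) (join_point zs t)"
proof -
  obtain w ws where w: "zs = w # ws" using assms by (cases zs) auto
  show ?thesis unfolding w by (rule join_point.simps)
qed

lemma join_point_cong: "(\<And>x. x \<in> set zs \<Longrightarrow> t x = t' x) \<Longrightarrow> join_point zs t = join_point zs t'"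
proof (induction zs t rule: join_point.induct)
  case (3 z w zs t)
  have "sum t (set (w # zs)) = sum t' (set (w # zs))" "sum t (set (z # w # zs)) = sum t' (set (z # w # zs))"
    using 3(2) by (intro sum.cong; simp)+
  moreover have "join_point (w # zs) t = join_point (w # zs) t'" using 3 by simp
  ultimately show ?case by (simp only: join_point.simps)
qed auto

lemma conic_set_center:
  assumes c: "conic z \<rho>" and A: "conic_set z \<rho> A" "closedin mtopology A" and p: "p \<in> A" "p \<in> mball z \<rho>"
  shows "z \<in> A"
proof (rule ccontr)
  assume "z \<notin> A"
  then obtain r where r: "r > 0" "disjnt A (mball z r)"
    using A(2) conic_center[OF c] unfolding closedin_metric by blast
  define t where "t = min 1 (r / (2 * (d z p + 1)))"
  have t: "0 < t" "t \<le> 1" using r by (auto simp: t_def add_nonneg_pos)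
  have "t \<le> r / (2 * (d z p + 1))" by (simp add: t_def)
  then have "t * (2 * (d z p + 1)) \<le> r" using nonneg[of z p] by (simp add: pos_le_divide_eq)
  moreover have "d z p < 2 * (d z p + 1)" by (simp add: add_nonneg_pos)
  then have "t * d z p < t * (2 * (d z p + 1))" using t by (intro mult_strict_left_mono)
  ultimately have "t * d z p < r" by linarith
  moreover have tb: "t * d z p < \<rho>" using dil_shrink_bound[OF c p(2)] t by simp
  ultimately have "dil z t p \<in> mball z r"
    using dil_dist_center[OF c p(2)] dil_in_M[OF c p(2)] t conic_center[OF c] by simp
  moreover have "dil z t p \<in> A" using A(1) p t tb unfolding conic_set_def by blast
  ultimately show False using r(2) by (auto simp: disjnt_def)
qed

text \<open>On weights with sum 0 the form \<open>- dist_form S c c / 2\<close> is the squared length of \<open>\<Sum>x. c x * x\<close>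
  when \<open>S\<close> is a set of points of a Euclidean space.\<close>
definition dist_form :: "'a set \<Rightarrow> ('a \<Rightarrow> real) \<Rightarrow> ('a \<Rightarrow> real) \<Rightarrow> real" where
  "dist_form S a b = (\<Sum>x\<in>S. \<Sum>y\<in>S. a x * b y * (d x y)\<^sup>2)"

lemma dist_form_insert:
  assumes "finite S" "z \<notin> S" "z \<in> M"
  shows "dist_form (insert z S) a b = dist_form S a b + a z * (\<Sum>x\<in>S. b x * (d z x)\<^sup>2) + b z * (\<Sum>x\<in>S. a x * (d z x)\<^sup>2)"
proof -
  have "(\<Sum>x\<in>S. a x * b z * (d x z)\<^sup>2) = b z * (\<Sum>x\<in>S. a x * (d z x)\<^sup>2)"
    unfolding sum_distrib_left by (intro sum.cong refl) (subst commute, simp)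
  moreover have "(\<Sum>x\<in>S. a z * b x * (d z x)\<^sup>2) = a z * (\<Sum>x\<in>S. b x * (d z x)\<^sup>2)"
    unfolding sum_distrib_left by (intro sum.cong refl) simp
  ultimately show ?thesis using assms by (simp add: dist_form_def sum.distrib)
qed

lemma dist_form_sym: "dist_form S a b = dist_form S b a"
proof -
  have "dist_form S a b = (\<Sum>y\<in>S. \<Sum>x\<in>S. a x * b y * (d x y)\<^sup>2)" unfolding dist_form_def by (rule sum.swap)
  also have "\<dots> = dist_form S b a" unfolding dist_form_def
    by (intro sum.cong refl) (subst commute, simp)
  finally show ?thesis .
qed

lemma dist_form_diff: "dist_form S (\<lambda>x. u * a x - v * b x) (\<lambda>x. u * a x - v * b x)
    = u\<^sup>2 * dist_form S a a + v\<^sup>2 * dist_form S b b - 2 * u * v * dist_form S a b"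
proof -
  have "dist_form S (\<lambda>x. u * a x - v * b x) (\<lambda>x. u * a x - v * b x)
    = (\<Sum>x\<in>S. \<Sum>y\<in>S. u\<^sup>2 * (a x * a y * (d x y)\<^sup>2) + v\<^sup>2 * (b x * b y * (d x y)\<^sup>2)
        - u * v * (a x * b y * (d x y)\<^sup>2) - u * v * (b x * a y * (d x y)\<^sup>2))"
    unfolding dist_form_def by (intro sum.cong refl) (simp add: power2_eq_square algebra_simps)
  also have "\<dots> = u\<^sup>2 * dist_form S a a + v\<^sup>2 * dist_form S b b - u * v * dist_form S a b - u * v * dist_form S b a"
    by (simp add: dist_form_def sum.distrib sum_subtractf sum_distrib_left)
  finally have "dist_form S (\<lambda>x. u * a x - v * b x) (\<lambda>x. u * a x - v * b x)
    = u\<^sup>2 * dist_form S a a + v\<^sup>2 * dist_form S b b - u * v * dist_form S a b - u * v * dist_form S b a" .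
  then show ?thesis using dist_form_sym[of S a b] by simp
qed

end

locale finite_tower = tower +
  fixes K :: nat
  assumes L_K: "L K = {}"
begin

definition vertices :: "'a set" where "vertices = (\<Union>m. N m)"
definition level :: "'a \<Rightarrow> nat" where "level z = (SOME m. z \<in> N m)"
definition radius :: "'a \<Rightarrow> real" where "radius z = R (level z) z"
definition vcell :: "'a \<Rightarrow> 'a set" where "vcell z = P.cell (level z) z"

text \<open>A later centre \<open>v\<close> in the cell of \<open>u\<close>. The relation is not transitive, therefore chains are
  required to be related pairwise.\<close>
definition adj :: "'a \<Rightarrow> 'a \<Rightarrow> bool" where
  "adj u v \<longleftrightarrow> u \<in> vertices \<and> v \<in> vertices \<and> level u < level v \<and> v \<in> vcell u"

definition chain :: "'a list \<Rightarrow> bool" where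
  "chain zs \<longleftrightarrow> zs \<noteq> [] \<and> set zs \<subseteq> vertices \<and> sorted_wrt adj zs"

lemma finite_vertices: "finite vertices"
proof -
  have "N m = {}" if "K \<le> m" for m using L_antimono[OF that] L_K P.N_sub[of m] by blast
  then have "vertices = (\<Union>m<K. N m)" unfolding vertices_def by (force simp: not_le[symmetric])
  then show ?thesis using P.finN by simp
qed

lemma N_level: "z \<in> vertices \<Longrightarrow> z \<in> N (level z)"
  unfolding vertices_def level_def by (auto intro: someI)

lemma N_disjoint: "z \<in> N m \<Longrightarrow> z \<in> N n \<Longrightarrow> \<not> m < n"
proof
  assume z: "z \<in> N m" "z \<in> N n" and mn: "m < n"
  then have "z \<in> L (Suc m)" using P.N_sub[of n] L_antimono[of "Suc m" n] by auto
  then show False using P.center_not_wall[OF z(1)] by (simp add: L_Suc)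
qed

lemma level_eq: "z \<in> N m \<Longrightarrow> level z = m"
  using N_disjoint N_level[of z] by (metis UN_I UNIV_I vertices_def linorder_neqE_nat)

lemma N_in_vertices: "z \<in> N m \<Longrightarrow> z \<in> vertices" by (auto simp: vertices_def)

context
  fixes z assumes z: "z \<in> vertices"
begin

lemmas center_in_N = N_level[OF z]

lemma vertex_in_M: "z \<in> M" using P.N_in_M[OF center_in_N] .
lemma vertex_conic: "conic z (2 * radius z)" using P.N_conic[OF center_in_N] by (simp add: radius_def)
lemma vcell_in_ball: "p \<in> vcell z \<Longrightarrow> p \<in> mball z (2 * radius z)"
  using P.cell_in_ball[OF center_in_N] by (simp add: vcell_def radius_def)
lemma vcell_closed: "closedin mtopology (vcell z)" using P.cell_closed[OF center_in_N] by (simp add: vcell_def)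
lemma vcell_center: "z \<in> vcell z" using P.center_in_cell[OF center_in_N] by (simp add: vcell_def)
lemma vcell_star: "p \<in> vcell z \<Longrightarrow> 0 \<le> t \<Longrightarrow> t \<le> 1 \<Longrightarrow> dil z t p \<in> vcell z"
  using P.star[OF center_in_N] by (simp add: vcell_def)
lemma vcell_sub_L: "vcell z \<subseteq> L (level z)" using P.cell_sub by (simp add: vcell_def)
lemma vcell_sub_M: "vcell z \<subseteq> M" using P.cell_in_M by (auto simp: vcell_def)
lemma vcell_ray: "p \<in> vcell z \<Longrightarrow> 0 \<le> t \<Longrightarrow> t < 1 \<Longrightarrow> dil z t p \<notin> L (Suc (level z))"
  using P.ray_not_wall[OF center_in_N] by (simp add: vcell_def L_Suc)
lemma center_notin_Suc: "z \<notin> L (Suc (level z))" using P.center_not_wall[OF center_in_N] by (simp add: L_Suc)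
lemma vcell_adapted: "u \<in> vertices \<Longrightarrow> level u < level z \<Longrightarrow> conic_set z (2 * radius z) (vcell u)"
  using adapted[OF _ N_level center_in_N] by (simp add: vcell_def radius_def)

end

lemma chain_Cons:
  "chain (z # w # zs) \<longleftrightarrow> z \<in> vertices \<and> (\<forall>x\<in>set (w # zs). adj z x) \<and> chain (w # zs)"
  by (auto simp: chain_def)

lemma chain_distinct: "chain zs \<Longrightarrow> distinct zs"
proof -
  have "sorted_wrt adj zs \<Longrightarrow> distinct zs" by (induction zs) (auto simp: adj_def)
  then show "chain zs \<Longrightarrow> distinct zs" by (simp add: chain_def)
qed

lemma chain_sub: "chain zs \<Longrightarrow> set zs \<subseteq> vertices" by (simp add: chain_def)

lemma ratio_bounds:
  assumes "\<And>x. x \<in> set (z # zs) \<Longrightarrow> 0 \<le> t x"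
  shows "0 \<le> sum t (set zs) / sum t (set (z # zs)) \<and> sum t (set zs) / sum t (set (z # zs)) \<le> (1::real)"
proof -
  have "0 \<le> sum t (set zs)" using assms by (intro sum_nonneg) auto
  moreover have "sum t (set zs) \<le> sum t (set (z # zs))" using assms by (intro sum_mono2) auto
  ultimately show ?thesis by (cases "sum t (set (z # zs)) = 0") (auto simp: divide_le_eq_1)
qed

text \<open>Cells of \<open>u\<close> are conic about all later centres, so a join with later centres stays in the cell
  once the centres are in it. In particular pairwise relations suffice to keep a simplex inside.\<close>
lemma join_point_in_cell:
  assumes "chain zs" "\<And>x. x \<in> set zs \<Longrightarrow> 0 \<le> t x" "\<And>x. x \<in> set zs \<Longrightarrow> adj u x"
  shows "join_point zs t \<in> vcell u"
  using assms
proof (induction zs t arbitrary: u rule: join_point.induct)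
  case (1 t)
  then show ?case by (simp add: chain_def)
next
  case (2 z t)
  then show ?case by (simp add: adj_def)
next
  case (3 z w zs t)
  define y where "y = join_point (w # zs) t"
  define s where "s = sum t (set (w # zs)) / sum t (set (z # w # zs))"
  have s: "0 \<le> s" "s \<le> 1" using ratio_bounds[of z "w # zs" t] 3(3) by (auto simp: s_def)
  have ch: "z \<in> vertices" "chain (w # zs)" "\<And>x. x \<in> set (w # zs) \<Longrightarrow> adj z x" using 3(2) chain_Cons by auto
  have yz: "y \<in> vcell z" unfolding y_def using 3(3) ch by (intro 3(1)) auto
  have yu: "y \<in> vcell u" unfolding y_def using 3(3,4) ch by (intro 3(1)) auto
  have uz: "u \<in> vertices" "level u < level z" "z \<in> vcell u" using 3(4)[of z] by (auto simp: adj_def)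
  have "dil z s y \<in> vcell u"
  proof (cases "s = 0")
    case True
    then show ?thesis using uz dil_0[OF vertex_in_M[OF ch(1)]] by simp
  next
    case False
    then show ?thesis
      using vcell_adapted[OF ch(1) uz(1,2)] vcell_in_ball[OF ch(1) yz] yu s
        dil_shrink_bound[OF vertex_conic[OF ch(1)] vcell_in_ball[OF ch(1) yz]]
      unfolding conic_set_def by auto
  qed
  then show ?case unfolding y_def s_def join_point.simps .
qed

lemma join_point_in_own_cell:
  assumes ch: "chain (z # zs)" and t: "\<And>x. x \<in> set (z # zs) \<Longrightarrow> 0 \<le> t x"
  shows "join_point (z # zs) t \<in> vcell z"
proof (cases zs)
  case Nil
  then show ?thesis using ch vcell_center by (auto simp: chain_def)
next
  case (Cons w ws)
  then have z: "z \<in> vertices" and ws: "chain zs" "\<And>x. x \<in> set zs \<Longrightarrow> adj z x" using ch chain_Cons by auto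
  have ne: "zs \<noteq> []" using Cons by simp
  have "join_point zs t \<in> vcell z" using join_point_in_cell[OF ws(1) _ ws(2)] t by auto
  from vcell_star[OF z this] show ?thesis
    using ratio_bounds[of z zs t] t by (simp only: join_point_Cons[OF ne])
qed

lemma join_point_in_M:
  assumes "chain zs" "\<And>x. x \<in> set zs \<Longrightarrow> 0 \<le> t x"
  shows "join_point zs t \<in> M"
proof (cases zs)
  case (Cons z ws)
  then show ?thesis using join_point_in_own_cell[of z ws t] assms vcell_sub_M[of z] chain_sub[of zs] by auto
qed (use assms in \<open>simp add: chain_def\<close>)

lemma sum_zero_imp_zero:
  fixes t :: "'b \<Rightarrow> real"
  assumes "finite S" "\<And>x. x \<in> S \<Longrightarrow> 0 \<le> t x" "sum t S = 0" "x \<in> S"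
  shows "t x = 0"
  using assms by (simp add: sum_nonneg_eq_0_iff)

text \<open>The squared distance to an earlier centre is determined along each segment by Stewart's
  identity, hence on the whole join by induction on the number of vertices. Clearing the denominators
  avoids a separate treatment of weights with sum 0.\<close>
lemma dist_center_formula:
  assumes "chain zs" "\<And>x. x \<in> set zs \<Longrightarrow> 0 \<le> t x" "u \<in> vertices" "\<And>x. x \<in> set zs \<Longrightarrow> adj u x"
  shows "(sum t (set zs))\<^sup>2 * (d u (join_point zs t))\<^sup>2
    = sum t (set zs) * (\<Sum>x\<in>set zs. t x * (d u x)\<^sup>2) - dist_form (set zs) t t / 2"
  using assms
proof (induction zs t arbitrary: u rule: join_point.induct)
  case (1 t)
  then show ?case by (simp add: chain_def)
next
  case (2 z t)
  then show ?case using chain_sub[of "[z]"] vertex_in_M[of z] by (simp add: dist_form_def power2_eq_square)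
next
  case (3 z w zs t)
  define S where "S = set (w # zs)"
  define y where "y = join_point (w # zs) t"
  define T where "T = sum t S"
  have ch: "z \<in> vertices" "chain (w # zs)" "\<And>x. x \<in> S \<Longrightarrow> adj z x" using 3(2) chain_Cons by (auto simp: S_def)
  have fin: "finite S" and zS: "z \<notin> S" using chain_distinct[OF 3(2)] by (auto simp: S_def)
  have ins: "set (z # w # zs) = insert z S" by (simp add: S_def)
  have sumins: "sum t (insert z S) = t z + T" using fin zS by (simp add: T_def)
  have tn: "0 \<le> t z" "\<And>x. x \<in> S \<Longrightarrow> 0 \<le> t x" using 3(3) by (auto simp: S_def)
  have T0: "0 \<le> T" unfolding T_def using tn by (intro sum_nonneg) auto
  have zM: "z \<in> M" using vertex_in_M ch by blast
  have uz: "adj u z" using 3(5) by simp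
  define lu lz q where "lu = (\<Sum>x\<in>S. t x * (d u x)\<^sup>2)" and "lz = (\<Sum>x\<in>S. t x * (d z x)\<^sup>2)" and "q = dist_form S t t"
  have IHu: "T\<^sup>2 * (d u y)\<^sup>2 = T * lu - q / 2"
    unfolding T_def S_def y_def lu_def q_def by (rule 3(1)) (use ch 3(3,4,5) in auto)
  have IHz: "T\<^sup>2 * (d z y)\<^sup>2 = T * lz - q / 2"
    unfolding T_def S_def y_def lz_def q_def by (rule 3(1)) (use ch 3(3) S_def in auto)
  define s where "s = T / (t z + T)"
  define m where "m = dil z s y"
  have m_eq: "join_point (z # w # zs) t = m"
    unfolding join_point.simps ins sumins m_def s_def y_def S_def[symmetric] T_def ..
  have yC: "y \<in> vcell z" unfolding y_def using join_point_in_cell[OF ch(2)] tn ch(3) by (auto simp: S_def)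
  have yb: "y \<in> mball z (2 * radius z)" using vcell_in_ball[OF ch(1) yC] .
  have yu: "y \<in> vcell u" unfolding y_def using join_point_in_cell[OF ch(2)] tn 3(5) by (auto simp: S_def)
  have mu: "m \<in> vcell u" unfolding m_eq[symmetric] using join_point_in_cell[OF 3(2,3,5)] by simp
  have goal: "(t z + T)\<^sup>2 * (d u m)\<^sup>2 = (t z + T) * (t z * (d u z)\<^sup>2 + lu) - (q + 2 * t z * lz) / 2"
  proof (cases "t z + T = 0")
    case True
    then have tz: "t z = 0" "T = 0" using tn T0 by auto
    then have "t x = 0" if "x \<in> S" for x using sum_zero_imp_zero[OF fin tn(2)] that by (simp add: T_def)
    then have "q = 0" by (simp add: q_def dist_form_def)
    then show ?thesis using tz by simp
  next
    case False
    then have pos: "0 < t z + T" using tn T0 by simp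
    have s: "0 \<le> s" "s \<le> 1" using T0 tn pos by (auto simp: s_def)
    note c = vertex_conic[OF ch(1)]
    have sb: "s * d z y < 2 * radius z" using dil_shrink_bound[OF c yb s] .
    have zb: "z \<in> mball u (2 * radius u)" using uz vcell_in_ball[of u z] by (simp add: adj_def)
    have D: "(d u m)\<^sup>2 = (1 - s) * (d u z)\<^sup>2 + s * (d u y)\<^sup>2 - s * (1 - s) * (d z y)\<^sup>2"
      using dil_dist_center[OF c yb s(1) sb] dil_dist_self[OF c yb s(1) sb] s
      by (intro stewart[OF vertex_conic[OF 3(4)] zb vcell_in_ball[OF 3(4) mu] vcell_in_ball[OF 3(4) yu] s])
        (simp_all add: m_def commute)
    have "(t z + T)\<^sup>2 * (d u m)\<^sup>2
        = (t z + T)\<^sup>2 * (1 - s) * (d u z)\<^sup>2 + (t z + T)\<^sup>2 * s * (d u y)\<^sup>2 - (t z + T)\<^sup>2 * (s * (1 - s)) * (d z y)\<^sup>2"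
      unfolding D by (simp add: algebra_simps)
    also have "(t z + T)\<^sup>2 * (1 - s) = (t z + T) * t z"
      using pos by (simp add: s_def divide_simps) (simp add: power2_eq_square algebra_simps)
    also have "(t z + T)\<^sup>2 * s = (t z + T) * T"
      using pos by (simp add: s_def divide_simps power2_eq_square)
    also have "(t z + T)\<^sup>2 * (s * (1 - s)) = t z * T"
      using pos by (simp add: s_def divide_simps) (simp add: power2_eq_square algebra_simps)
    finally have e: "(t z + T)\<^sup>2 * (d u m)\<^sup>2
        = (t z + T) * t z * (d u z)\<^sup>2 + (t z + T) * T * (d u y)\<^sup>2 - t z * T * (d z y)\<^sup>2" .
    show ?thesis
    proof (cases "T = 0")
      case True
      then have t0: "t x = 0" if "x \<in> S" for x using sum_zero_imp_zero[OF fin tn(2)] that by (simp add: T_def)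
      then have "q = 0" "lu = 0" "lz = 0" by (simp_all add: q_def dist_form_def lu_def lz_def)
      then show ?thesis using e True by (simp add: power2_eq_square algebra_simps)
    next
      case False
      have "T * x = l - q / (2 * T)" if "T\<^sup>2 * x = T * l - q / 2" for x l
      proof -
        have "T * x = T\<^sup>2 * x / T" using False by (simp add: power2_eq_square)
        also have "\<dots> = l - q / (2 * T)"
          unfolding that using False by (simp add: diff_divide_distrib mult.commute)
        finally show ?thesis .
      qed
      define Q where "Q = q / (2 * T)"
      note 1 = \<open>\<And>x l. T\<^sup>2 * x = T * l - q / 2 \<Longrightarrow> T * x = l - q / (2 * T)\<close>[OF IHu, folded Q_def]
        \<open>\<And>x l. T\<^sup>2 * x = T * l - q / 2 \<Longrightarrow> T * x = l - q / (2 * T)\<close>[OF IHz, folded Q_def]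
      have "(t z + T)\<^sup>2 * (d u m)\<^sup>2
          = (t z + T) * t z * (d u z)\<^sup>2 + (t z + T) * (T * (d u y)\<^sup>2) - t z * (T * (d z y)\<^sup>2)"
        using e by (simp add: mult.assoc)
      also have "\<dots> = (t z + T) * (t z * (d u z)\<^sup>2 + lu) - t z * lz - T * Q"
        unfolding 1 by (simp add: algebra_simps)
      also have "T * Q = q / 2" using False by (simp add: Q_def)
      finally show ?thesis by (simp add: field_simps)
    qed
  qed
  have sl: "(\<Sum>x\<in>insert z S. t x * (d u x)\<^sup>2) = t z * (d u z)\<^sup>2 + lu"
    using fin zS by (simp add: lu_def)
  have sq: "dist_form (insert z S) t t = q + 2 * t z * lz"
    unfolding dist_form_insert[OF fin zS zM] q_def lz_def by simp
  show ?case unfolding m_eq ins sumins sl sq by (rule goal)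
qed

text \<open>Two points of a cone over a simplex are dilations of points of the base, so the law of cosines
  reduces the claim to the base and to the distances from the apex, which are known from
  \<open>dist_center_formula\<close>.\<close>
lemma dist_formula:
  assumes "chain zs" "\<And>x. x \<in> set zs \<Longrightarrow> 0 \<le> t x" "\<And>x. x \<in> set zs \<Longrightarrow> 0 \<le> t' x"
  shows "(sum t (set zs))\<^sup>2 * (sum t' (set zs))\<^sup>2 * (d (join_point zs t) (join_point zs t'))\<^sup>2
    = - dist_form (set zs) (\<lambda>x. sum t' (set zs) * t x - sum t (set zs) * t' x)
        (\<lambda>x. sum t' (set zs) * t x - sum t (set zs) * t' x) / 2"
  using assms
proof (induction zs t rule: join_point.induct)
  case (1 t)
  then show ?case by (simp add: chain_def)
next
  case (2 z t)
  then show ?case using chain_sub[of "[z]"] vertex_in_M[of z] by (simp add: dist_form_def)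
next
  case (3 z w zs t)
  define S where "S = set (w # zs)"
  define y y' where "y = join_point (w # zs) t" and "y' = join_point (w # zs) t'"
  define T U where "T = sum t S" and "U = sum t' S"
  have ch: "z \<in> vertices" "chain (w # zs)" "\<And>x. x \<in> S \<Longrightarrow> adj z x" using 3(2) chain_Cons by (auto simp: S_def)
  have fin: "finite S" and zS: "z \<notin> S" using chain_distinct[OF 3(2)] by (auto simp: S_def)
  have ins: "set (z # w # zs) = insert z S" by (simp add: S_def)
  have sumins: "sum t (insert z S) = t z + T" "sum t' (insert z S) = t' z + U"
    using fin zS by (simp_all add: T_def U_def)
  have tn: "0 \<le> t z" "\<And>x. x \<in> S \<Longrightarrow> 0 \<le> t x" and un: "0 \<le> t' z" "\<And>x. x \<in> S \<Longrightarrow> 0 \<le> t' x"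
    using 3(3,4) by (auto simp: S_def)
  have T0: "0 \<le> T" "0 \<le> U" unfolding T_def U_def using tn un by (auto intro!: sum_nonneg)
  have zM: "z \<in> M" using vertex_in_M ch by blast
  define l l' q q' b where "l = (\<Sum>x\<in>S. t x * (d z x)\<^sup>2)" and "l' = (\<Sum>x\<in>S. t' x * (d z x)\<^sup>2)"
    and "q = dist_form S t t" and "q' = dist_form S t' t'" and "b = dist_form S t t'"
  have zeroT: "l = 0 \<and> q = 0 \<and> b = 0" if "T = 0"
  proof -
    have "t x = 0" if "x \<in> S" for x
      using sum_zero_imp_zero[OF fin tn(2)] that \<open>T = 0\<close> by (simp add: T_def)
    then show ?thesis by (simp add: l_def q_def b_def dist_form_def)
  qed
  have zeroU: "l' = 0 \<and> q' = 0 \<and> b = 0" if "U = 0"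
  proof -
    have "t' x = 0" if "x \<in> S" for x
      using sum_zero_imp_zero[OF fin un(2)] that \<open>U = 0\<close> by (simp add: U_def)
    then show ?thesis by (simp add: l'_def q'_def b_def dist_form_def)
  qed
  have a1: "T\<^sup>2 * (d z y)\<^sup>2 = T * l - q / 2"
    using dist_center_formula[OF ch(2) tn(2) ch(1,3), unfolded S_def] by (simp add: T_def S_def y_def l_def q_def)
  have a2: "U\<^sup>2 * (d z y')\<^sup>2 = U * l' - q' / 2"
    using dist_center_formula[OF ch(2) un(2) ch(1,3), unfolded S_def] by (simp add: U_def S_def y'_def l'_def q'_def)
  have IH: "T\<^sup>2 * U\<^sup>2 * (d y y')\<^sup>2 = - (U\<^sup>2 * q + T\<^sup>2 * q' - 2 * U * T * b) / 2"
    using 3(1)[OF ch(2)] tn un unfolding dist_form_diff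
    by (simp add: T_def U_def S_def y_def y'_def q_def q'_def b_def)
  have yC: "y \<in> vcell z" "y' \<in> vcell z" unfolding y_def y'_def
    using join_point_in_cell[OF ch(2)] tn un ch(3) by (auto simp: S_def)
  note yb = vcell_in_ball[OF ch(1) yC(1)] vcell_in_ball[OF ch(1) yC(2)] and c = vertex_conic[OF ch(1)]
  define s s' where "s = T / (t z + T)" and "s' = U / (t' z + U)"
  define X Y where "X = t z + T" and "Y = t' z + U"
  have m_eq: "join_point (z # w # zs) t = dil z s y" "join_point (z # w # zs) t' = dil z s' y'"
    unfolding join_point.simps ins sumins s_def s'_def y_def y'_def S_def[symmetric] T_def U_def by rule+
  have goal: "X\<^sup>2 * Y\<^sup>2 * (d (dil z s y) (dil z s' y'))\<^sup>2
    = - (Y\<^sup>2 * q + X\<^sup>2 * q' - 2 * Y * X * b + 2 * (Y * t z - X * t' z) * (Y * l - X * l')) / 2"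
  proof (cases "X = 0 \<or> Y = 0")
    case True
    then show ?thesis
    proof
      assume "X = 0"
      then have "t z = 0" "T = 0" using tn T0 by (auto simp: X_def)
      then show ?thesis using zeroT \<open>X = 0\<close> by simp
    next
      assume "Y = 0"
      then have "t' z = 0" "U = 0" using un T0 by (auto simp: Y_def)
      then show ?thesis using zeroU \<open>Y = 0\<close> by simp
    qed
  next
    case False
    then have pos: "0 < X" "0 < Y" using tn un T0 by (auto simp: X_def Y_def)
    have s: "0 \<le> s" "s \<le> 1" "0 \<le> s'" "s' \<le> 1"
      using T0 tn un pos by (auto simp: s_def s'_def X_def Y_def)
    have sX: "s * X = T" "s' * Y = U" using pos by (auto simp: s_def s'_def X_def Y_def)
    define k where "k = (d z y)\<^sup>2 + (d z y')\<^sup>2 - (d y y')\<^sup>2"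
    have k: "T * U * k = U * l + T * l' - b"
    proof (cases "T = 0 \<or> U = 0")
      case True
      then show ?thesis using zeroT zeroU by auto
    next
      case False
      have "T * U * (T * U * k) = U\<^sup>2 * (T\<^sup>2 * (d z y)\<^sup>2) + T\<^sup>2 * (U\<^sup>2 * (d z y')\<^sup>2) - T\<^sup>2 * U\<^sup>2 * (d y y')\<^sup>2"
        by (simp add: k_def power2_eq_square algebra_simps)
      also have "\<dots> = T * U * (U * l + T * l' - b)"
        unfolding a1 a2 IH by (simp add: power2_eq_square field_simps)
      finally show ?thesis using False by simp
    qed
    have D: "(d (dil z s y) (dil z s' y'))\<^sup>2 = s\<^sup>2 * (d z y)\<^sup>2 + s'\<^sup>2 * (d z y')\<^sup>2 - s * s' * k"
      unfolding k_def using s dil_shrink_bound[OF c] yb by (intro dil_law[OF c]) auto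
    have "X\<^sup>2 * Y\<^sup>2 * (d (dil z s y) (dil z s' y'))\<^sup>2
      = Y\<^sup>2 * ((s * X)\<^sup>2 * (d z y)\<^sup>2) + X\<^sup>2 * ((s' * Y)\<^sup>2 * (d z y')\<^sup>2) - X * Y * ((s * X) * (s' * Y) * k)"
      unfolding D by (simp add: power2_eq_square algebra_simps)
    also have "\<dots> = Y\<^sup>2 * (T * l - q / 2) + X\<^sup>2 * (U * l' - q' / 2) - X * Y * (U * l + T * l' - b)"
      unfolding sX a1 a2 k ..
    also have "\<dots> = - (Y\<^sup>2 * q + X\<^sup>2 * q' - 2 * Y * X * b + 2 * (Y * t z - X * t' z) * (Y * l - X * l')) / 2"
      by (simp add: X_def Y_def power2_eq_square field_simps)
    finally show ?thesis .
  qed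
  have bilX: "dist_form (insert z S) (\<lambda>x. Y * t x - X * t' x) (\<lambda>x. Y * t x - X * t' x)
    = Y\<^sup>2 * q + X\<^sup>2 * q' - 2 * Y * X * b + 2 * (Y * t z - X * t' z) * (Y * l - X * l')"
    unfolding dist_form_insert[OF fin zS zM] dist_form_diff
    by (simp add: q_def q'_def b_def l_def l'_def sum_subtractf sum_distrib_left power2_eq_square algebra_simps)
  show ?case
    unfolding m_eq ins sumins X_def[symmetric] Y_def[symmetric] bilX by (rule goal)
qed

text \<open>Positive weight of the first centre means a dilation factor below 1, so the point is strictly
  before the wall on its ray.\<close>
lemma join_point_notin_next_level:
  assumes ch: "chain (z # zs)" and t: "\<And>x. x \<in> set (z # zs) \<Longrightarrow> 0 < t x"
  shows "join_point (z # zs) t \<notin> L (Suc (level z))"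
proof (cases zs)
  case Nil
  then show ?thesis using ch center_notin_Suc by (auto simp: chain_def)
next
  case (Cons w ws)
  then have z: "z \<in> vertices" and ws: "chain zs" "\<And>x. x \<in> set zs \<Longrightarrow> adj z x" using ch chain_Cons by auto
  have y: "join_point zs t \<in> vcell z" using join_point_in_cell[OF ws(1) _ ws(2)] t by (simp add: less_imp_le)
  have "z \<notin> set zs" using chain_distinct[OF ch] by simp
  then have e: "sum t (set (z # zs)) = t z + sum t (set zs)" by simp
  have "0 < t z" "0 \<le> sum t (set zs)" using t by (auto intro!: sum_nonneg simp: less_imp_le)
  then have "sum t (set zs) / sum t (set (z # zs)) < 1" "0 \<le> sum t (set zs) / sum t (set (z # zs))"
    unfolding e by (simp_all add: divide_less_eq_1)
  moreover have ne: "zs \<noteq> []" using Cons by simp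
  ultimately show ?thesis unfolding join_point_Cons[OF ne] by (intro vcell_ray[OF z y])
qed

text \<open>The point determines the first centre, as it lies in the cell of exactly one centre of its level.
  It also determines where the ray from this centre hits the wall, since rays cross the wall only once.
  The rest follows by induction.\<close>
lemma join_point_inj:
  assumes "chain zs" "chain zs'" "\<And>x. x \<in> set zs \<Longrightarrow> 0 < t x" "\<And>x. x \<in> set zs' \<Longrightarrow> 0 < t' x"
    and "join_point zs t = join_point zs' t'"
  shows "zs = zs' \<and> (\<forall>x\<in>set zs. t x / sum t (set zs) = t' x / sum t' (set zs))"
  using assms
proof (induction zs arbitrary: zs')
  case Nil
  then show ?case by (simp add: chain_def)
next
  case (Cons z ws)
  obtain z' ws' where zs': "zs' = z' # ws'" using Cons.prems(2) by (cases zs') (auto simp: chain_def)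
  define p where "p = join_point (z # ws) t"
  have p': "p = join_point (z' # ws') t'" using Cons.prems(5) by (simp add: p_def zs')
  have zV: "z \<in> vertices" "z' \<in> vertices"     using chain_sub[OF Cons.prems(1)] chain_sub[OF Cons.prems(2)] zs' by auto
  have pC: "p \<in> vcell z" unfolding p_def using Cons.prems by (intro join_point_in_own_cell) (auto simp: less_imp_le)
  have pC': "p \<in> vcell z'" unfolding p' using Cons.prems zs' by (intro join_point_in_own_cell) (auto simp: less_imp_le)
  have nS: "p \<notin> L (Suc (level z))" "p \<notin> L (Suc (level z'))"
    using join_point_notin_next_level[of z ws t] join_point_notin_next_level[of z' ws' t'] Cons.prems zs' p' by (auto simp: p_def)
  have "level z = level z'"
  proof (rule ccontr)
    assume "level z \<noteq> level z'"
    then have "Suc (level z) \<le> level z' \<or> Suc (level z') \<le> level z" by linarith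
    then show False
      using L_antimono nS vcell_sub_L[OF zV(1)] vcell_sub_L[OF zV(2)] pC pC' by blast
  qed
  have zz: "z' = z"
  proof (rule ccontr)
    assume "z' \<noteq> z"
    then have "p \<in> P.wall (level z)"
      using pC pC' N_level[OF zV(1)] N_level[OF zV(2)] \<open>level z = level z'\<close>
      unfolding P.wall_def vcell_def by auto
    then show False using nS by (simp add: L_Suc)
  qed
  have tail: "\<exists>s y. p = dil z s y \<and> 0 < s \<and> s < 1 \<and> y \<in> vcell z \<and> y \<in> L (Suc (level z)) \<and> y = join_point vs u
      \<and> s = sum u (set vs) / (u z + sum u (set vs))"
    if vs: "chain (z # vs)" "vs \<noteq> []" "\<And>x. x \<in> set (z # vs) \<Longrightarrow> 0 < u x" "p = join_point (z # vs) u" for vs u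
  proof -
    obtain v vs' where v: "vs = v # vs'" using vs(2) by (cases vs) auto
    then have ws: "chain vs" "\<And>x. x \<in> set vs \<Longrightarrow> adj z x" using vs(1) chain_Cons by auto
    define y where "y = join_point vs u"
    have y: "y \<in> vcell z" using join_point_in_cell[OF ws(1) _ ws(2)] vs(3) by (simp add: less_imp_le y_def)
    have vV: "v \<in> vertices" and lv: "level z < level v" using ws(2)[of v] by (auto simp: v adj_def)
    have "y \<in> vcell v" unfolding y_def v using vs(3) ws(1) by (intro join_point_in_own_cell) (auto simp: v less_imp_le)
    then have yL: "y \<in> L (Suc (level z))" using vcell_sub_L[OF vV] L_antimono[of "Suc (level z)" "level v"] lv by auto
    have "z \<notin> set vs" using chain_distinct[OF vs(1)] by simp
    then have e: "sum u (set (z # vs)) = u z + sum u (set vs)" by simp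
    have pos: "0 < u z" "0 < sum u (set vs)" using vs(3) by (auto intro!: sum_pos simp: v)
    show ?thesis
      using pos y yL vs(4) unfolding join_point_Cons[OF vs(2)] e y_def[symmetric]
      by (intro exI[of _ "sum u (set vs) / (u z + sum u (set vs))"] exI[of _ y]) (simp add: divide_less_eq_1)
  qed
  have center_ne: "p \<noteq> z" if "p = dil z s y" "0 < s" "s < 1" "y \<in> vcell z" "y \<in> L (Suc (level z))" for s y
  proof
    assume "p = z"
    have yb: "y \<in> mball z (2 * radius z)" using vcell_in_ball[OF zV(1) that(4)] .
    have "d z p = s * d z y"
      using dil_dist_center[OF vertex_conic[OF zV(1)] yb] dil_shrink_bound[OF vertex_conic[OF zV(1)] yb] that by simp
    then have "d z y = 0" using \<open>p = z\<close> that vertex_in_M[OF zV(1)] by simp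
    then have "y = z" using yb by auto
    then show False using that(5) center_notin_Suc[OF zV(1)] by simp
  qed
  note pr = Cons.prems(1) Cons.prems(2)[unfolded zs' zz]
  show ?case
  proof (cases "ws = [] \<or> ws' = []")
    case True
    have "ws = [] \<and> ws' = []"
    proof (rule ccontr)
      assume "\<not> ?thesis"
      then consider "ws = []" "ws' \<noteq> []" | "ws \<noteq> []" "ws' = []" using True by blast
      then show False
      proof cases
        case 1
        then have "p = z" by (simp add: p_def)
        then show False using tail[OF pr(2) 1(2), of t'] Cons.prems(4) p' zs' zz center_ne by force
      next
        case 2
        then have "p = z" using p' zz by simp
        then show False using tail[OF pr(1) 2(1), of t] Cons.prems(3) p_def center_ne by force
      qed
    qed
    moreover have "0 < t z" "0 < t' z" using Cons.prems zs' zz by auto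
    ultimately show ?thesis using zs' zz by simp
  next
    case False
    obtain s y where sy: "p = dil z s y" "0 < s" "s < 1" "y \<in> vcell z" "y \<in> L (Suc (level z))" "y = join_point ws t"
      "s = sum t (set ws) / (t z + sum t (set ws))"
      using tail[OF pr(1), of t] False Cons.prems(3) p_def by blast
    obtain s' y' where sy': "p = dil z s' y'" "0 < s'" "s' < 1" "y' \<in> vcell z" "y' \<in> L (Suc (level z))"
      "y' = join_point ws' t'" "s' = sum t' (set ws') / (t' z + sum t' (set ws'))"
      using tail[OF pr(2), of t'] False Cons.prems(4) p' zs' zz by blast
    note c = vertex_conic[OF zV(1)]
    \<comment> \<open>Two points of the wall on the same ray from \<open>z\<close> coincide.\<close>
    have key: "\<not> a < a'" if "p = dil z a x" "p = dil z a' x'" "0 < a" "a < 1" "0 < a'" "a' < 1"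
        "x \<in> vcell z" "x' \<in> vcell z" "x' \<in> L (Suc (level z))" for a a' x x'
    proof
      assume "a < a'"
      note xb = vcell_in_ball[OF zV(1) that(7)] vcell_in_ball[OF zV(1) that(8)]
      have "x' = dil z (1 / a') p"
        using dil_inverse[OF c xb(2), of a'] dil_shrink_bound[OF c xb(2), of a'] that by simp
      also have "\<dots> = dil z (a / a') x"
      proof -
        have "a * d z x < 2 * radius z" "1 / a' * a * d z x < 2 * radius z"
          using dil_shrink_bound[OF c xb(1), of a] dil_shrink_bound[OF c xb(1), of "a / a'"] that \<open>a < a'\<close> by auto
        then show ?thesis using dil_dil[OF c xb(1), of a "1 / a'"] that by simp
      qed
      finally show False using vcell_ray[OF zV(1) that(7), of "a / a'"] that \<open>a < a'\<close> by simp
    qed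
    have "s = s'"
      using key[OF sy(1) sy'(1) sy(2,3) sy'(2,3) sy(4) sy'(4,5)] key[OF sy'(1) sy(1) sy'(2,3) sy(2,3) sy'(4) sy(4,5)]
      by simp
    have "y = y'"
      using dil_inverse[OF c vcell_in_ball[OF zV(1) sy(4)] sy(2)] dil_inverse[OF c vcell_in_ball[OF zV(1) sy'(4)] sy'(2)]
        dil_shrink_bound[OF c vcell_in_ball[OF zV(1) sy(4)]] dil_shrink_bound[OF c vcell_in_ball[OF zV(1) sy'(4)]]
        sy sy' \<open>s = s'\<close> by (metis less_imp_le)
    have ch: "chain ws" "chain ws'"
      using pr False chain_Cons by (metis neq_Nil_conv)+
    have IH: "ws = ws' \<and> (\<forall>x\<in>set ws. t x / sum t (set ws) = t' x / sum t' (set ws))"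
      using Cons.prems(3,4) zs' sy(6) sy'(6) \<open>y = y'\<close> by (intro Cons.IH[OF ch]) auto
    define T U where "T = sum t (set ws)" and "U = sum t' (set ws)"
    have zn: "z \<notin> set ws" using chain_distinct[OF Cons.prems(1)] by simp
    have TU: "0 < T" "0 < U" "0 < t z" "0 < t' z" unfolding T_def U_def
      using Cons.prems(3,4) zs' zz IH False by (auto intro!: sum_pos)
    have sT: "sum t (set (z # ws)) = t z + T" "sum t' (set (z # ws)) = t' z + U"
      using zn by (simp_all add: T_def U_def)
    have ss: "T / (t z + T) = U / (t' z + U)" using sy(7) sy'(7) \<open>s = s'\<close> IH by (simp add: T_def U_def)
    have "t x / (t z + T) = t' x / (t' z + U)" if "x \<in> set ws" for x
    proof -
      have "t x / (t z + T) = (t x / T) * (T / (t z + T))" using TU by simp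
      also have "t x / T = t' x / U" using conjunct2[OF IH] that by (simp add: T_def U_def)
      also have "T / (t z + T) = U / (t' z + U)" by (rule ss)
      also have "t' x / U * (U / (t' z + U)) = t' x / (t' z + U)" using TU by simp

      finally show ?thesis .
    qed
    moreover have "t z / (t z + T) = t' z / (t' z + U)"
    proof -
      have "t z / (t z + T) = 1 - T / (t z + T)" "t' z / (t' z + U) = 1 - U / (t' z + U)"
        using TU by (simp_all add: field_simps)
      then show ?thesis using ss by simp
    qed
    ultimately show ?thesis using IH zs' zz unfolding sT by auto
  qed
qed

text \<open>In its conic ball a closed conic set contains with each point the ray through it and the
  centre.\<close>
lemma vertices_in_cell:
  assumes "chain zs" "\<And>x. x \<in> set zs \<Longrightarrow> 0 < t x" "u \<in> vertices" "\<And>x. x \<in> set zs \<Longrightarrow> level u < level x"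
    "join_point zs t \<in> vcell u" "x \<in> set zs"
  shows "x \<in> vcell u"
  using assms
proof (induction zs t arbitrary: x rule: join_point.induct)
  case (3 z w zs t)
  define y where "y = join_point (w # zs) t"
  define s where "s = sum t (set (w # zs)) / sum t (set (z # w # zs))"
  have p: "dil z s y \<in> vcell u" using 3(6) unfolding y_def s_def join_point.simps .
  have "0 < sum t (set (w # zs))" "0 < sum t (set (z # w # zs))"
    using 3(3) by (auto intro!: sum_pos)
  then have s: "0 < s" "s \<le> 1" using ratio_bounds[of z "w # zs" t] 3(3) by (auto simp: s_def less_imp_le)
  have ch: "z \<in> vertices" "chain (w # zs)" "\<And>x. x \<in> set (w # zs) \<Longrightarrow> adj z x" using 3(2) chain_Cons by auto
  have yz: "y \<in> vcell z" unfolding y_def using 3(3) ch by (intro join_point_in_cell) (auto simp: less_imp_le)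
  note c = vertex_conic[OF ch(1)] and yb = vcell_in_ball[OF ch(1) yz]
  have sb: "s * d z y < 2 * radius z" using dil_shrink_bound[OF c yb] s by simp
  have cs: "conic_set z (2 * radius z) (vcell u)" using vcell_adapted[OF ch(1) 3(4)] 3(5)[of z] by simp
  have pb: "dil z s y \<in> mball z (2 * radius z)" using dil_in_ball[OF c yb _ sb] s by simp
  have "1 / s * d z (dil z s y) < 2 * radius z"
    using dil_dist_center[OF c yb _ sb] s yb by simp
  then have "dil z (1 / s) (dil z s y) \<in> vcell u"
    using cs pb p s unfolding conic_set_def by auto
  then have yu: "y \<in> vcell u" using dil_inverse[OF c yb s(1) sb] by simp
  have "z \<in> vcell u" using conic_set_center[OF c cs vcell_closed[OF 3(4)] yu yb] .
  moreover have "x \<in> vcell u" if "x \<in> set (w # zs)"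
    using 3(1)[OF ch(2) _ 3(4)] 3(3,5) yu that by (simp add: y_def)
  ultimately show ?case using 3(7) by auto
qed (auto simp: chain_def)

text \<open>Project from the centre of the cell to the wall and use induction on the remaining levels. The
  new centre is joined to all others because its cell contains the projected point, hence its vertices.\<close>
theorem join_point_surj:
  assumes "p \<in> L m"
  shows "\<exists>zs t. chain zs \<and> (\<forall>x\<in>set zs. 0 < t x \<and> m \<le> level x) \<and> join_point zs t = p"
  using assms
proof (induction "K - m" arbitrary: m p rule: less_induct)
  case less
  have "m < K" using less.prems L_antimono[of K m] L_K by (metis empty_iff not_le subsetD)
  have IH: "\<exists>zs t. chain zs \<and> (\<forall>x\<in>set zs. 0 < t x \<and> Suc m \<le> level x) \<and> join_point zs t = q"
    if "q \<in> L (Suc m)" for q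
    using less.hyps[OF _ that] \<open>m < K\<close> by simp
  show ?case
  proof (cases "p \<in> L (Suc m)")
    case True
    obtain zs t where *: "chain zs" "\<forall>x\<in>set zs. 0 < t x \<and> Suc m \<le> level x" "join_point zs t = p"
      using IH[OF True] by blast
    then have "\<forall>x\<in>set zs. 0 < t x \<and> m \<le> level x" by (auto dest: Suc_leD)
    then show ?thesis using * by blast
  next
    case False
    obtain z where z: "z \<in> N m" "p \<in> P.cell m z" using P.cell_ex[OF less.prems] by blast
    have zV: "z \<in> vertices" and lz: "level z = m" using N_in_vertices level_eq z(1) by auto
    have Cz: "vcell z = P.cell m z" by (simp add: vcell_def lz)
    show ?thesis
    proof (cases "p = z")
      case True
      then show ?thesis using zV lz by (intro exI[of _ "[z]"] exI[of _ "\<lambda>_. 1"]) (simp add: chain_def)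
    next
      case ne: False
      obtain q s where q: "q \<in> P.cell m z" "q \<in> L (Suc m)" "0 < s" "s \<le> 1" "p = dil z s q"
        using P.exit_point[OF z ne] by (auto simp: L_Suc)
      have "s \<noteq> 1" using q False dil_1[of q z] P.cell_in_M[OF q(1)] by auto
      then have s1: "s < 1" using q by simp
      obtain zs t where zs: "chain zs" "\<And>x. x \<in> set zs \<Longrightarrow> 0 < t x" "\<And>x. x \<in> set zs \<Longrightarrow> Suc m \<le> level x"
        "join_point zs t = q" using IH[OF q(2)] by blast
      have inC: "x \<in> vcell z" if "x \<in> set zs" for x
        using vertices_in_cell[OF zs(1,2) zV _ _ that] zs(3,4) q(1) lz Cz by (simp add: Suc_le_eq)
      have adj: "adj z x" if "x \<in> set zs" for x
        using inC[OF that] zs(3)[OF that] zV chain_sub[OF zs(1)] that lz by (auto simp: adj_def)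
      have ch: "chain (z # zs)" using zs(1) adj zV by (simp add: chain_def)
      define T where "T = sum t (set zs)"
      have "zs \<noteq> []" using zs(1) by (simp add: chain_def)
      then have T: "0 < T" unfolding T_def using zs(2) by (intro sum_pos) auto
      \<comment> \<open>The weight for which the tail has relative weight \<open>s\<close>.\<close>
      define t' where "t' = t(z := T * (1 - s) / s)"
      have zn: "z \<notin> set zs" using chain_distinct[OF ch] by simp
      have sum': "sum t' (set zs) = T"
        using zn by (auto simp: T_def t'_def intro!: sum.cong)
      have jp: "join_point zs t' = q"
        unfolding zs(4)[symmetric] using zn by (intro join_point_cong) (auto simp: t'_def)
      have sum2: "sum t' (set (z # zs)) = T / s"
        using zn sum' q(3) by (simp add: t'_def field_simps)
      have "join_point (z # zs) t' = dil z (T / (T / s)) q"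
        unfolding join_point_Cons[OF \<open>zs \<noteq> []\<close>] sum' sum2 jp ..
      then have "join_point (z # zs) t' = p" using T q by simp
      moreover have "0 < t' x \<and> m \<le> level x" if "x \<in> set (z # zs)" for x
        using that zs(2,3) T q(3) s1 lz by (auto simp: t'_def dest: Suc_leD)
      ultimately show ?thesis using ch by blast
    qed
  qed
qed

end

section \<open>Euclidean realization of distance matrices\<close>

text \<open>Cholesky decomposition. The last vector gets a new coordinate, the others are corrected so
  that the remaining entries form the Schur complement, which is again positive definite.\<close>
lemma gram_vectors:
  fixes Q :: "nat \<Rightarrow> nat \<Rightarrow> real"
  assumes "\<And>i j. Q i j = Q j i"
    and "\<And>c. \<exists>i<k. c i \<noteq> 0 \<Longrightarrow> 0 < (\<Sum>i<k. \<Sum>j<k. c i * c j * Q i j)"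
  shows "\<exists>v :: nat \<Rightarrow> nat \<Rightarrow> real. (\<forall>i<k. \<forall>m\<ge>k. v i m = 0) \<and>
    (\<forall>i<k. \<forall>j<k. (\<Sum>m<k. v i m * v j m) = Q i j)"
  using assms
proof (induction k arbitrary: Q)
  case 0
  then show ?case by simp
next
  case (Suc k)
  define a where "a = Q k k"
  have "0 < (\<Sum>i<Suc k. \<Sum>j<Suc k. (if i = k then 1 else 0) * (if j = k then 1 else 0) * Q i j)"
    by (rule Suc.prems(2)) auto
  also have "\<dots> = a" by (simp add: a_def)
  finally have a: "0 < a" .
  define Q' where "Q' i j = Q i j - Q i k * Q j k / a" for i j
  have "\<exists>v :: nat \<Rightarrow> nat \<Rightarrow> real. (\<forall>i<k. \<forall>m\<ge>k. v i m = 0) \<and>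
    (\<forall>i<k. \<forall>j<k. (\<Sum>m<k. v i m * v j m) = Q' i j)"
  proof (rule Suc.IH)
    show "Q' i j = Q' j i" for i j
      unfolding Q'_def using Suc.prems(1)[of i j] by (simp add: mult.commute)
    fix c :: "nat \<Rightarrow> real" assume c: "\<exists>i<k. c i \<noteq> 0"
    define b where "b = (\<Sum>i<k. c i * Q i k)"
    \<comment> \<open>The last coefficient minimizes the form; the minimum is the form of the Schur complement at \<open>c\<close>.\<close>
    define e where "e = c(k := - b / a)"
    have "0 < (\<Sum>i<Suc k. \<Sum>j<Suc k. e i * e j * Q i j)"
      using c by (intro Suc.prems(2)) (auto simp: e_def intro: less_SucI)
    also have "\<dots> = (\<Sum>i<k. \<Sum>j<k. c i * c j * Q i j) + 2 * (- b / a) * b + (- b / a)\<^sup>2 * a"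
    proof -
      have 1: "(\<Sum>i<k. e i * e k * Q i k) = (- b / a) * b"
        unfolding b_def sum_distrib_left by (intro sum.cong) (simp_all add: e_def b_def mult_ac)
      have 2: "(\<Sum>j<k. e k * e j * Q k j) = (- b / a) * b"
        unfolding b_def sum_distrib_left
        using Suc.prems(1)[of k] by (intro sum.cong) (simp_all add: e_def b_def mult_ac)
      have 3: "(\<Sum>i<k. \<Sum>j<k. e i * e j * Q i j) = (\<Sum>i<k. \<Sum>j<k. c i * c j * Q i j)"
        by (intro sum.cong) (simp_all add: e_def)
      show ?thesis
        unfolding sum.lessThan_Suc sum.distrib 1 2 3 by (simp add: e_def a_def power2_eq_square)
    qed
    also have "\<dots> = (\<Sum>i<k. \<Sum>j<k. c i * c j * Q i j) - b * b / a"
      using a by (simp add: power2_eq_square field_simps)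
    also have "b * b / a = (\<Sum>i<k. \<Sum>j<k. c i * c j * (Q i k * Q j k / a))"
      unfolding b_def sum_product sum_divide_distrib by (intro sum.cong) (simp_all add: mult_ac)
    also have "(\<Sum>i<k. \<Sum>j<k. c i * c j * Q i j) - (\<Sum>i<k. \<Sum>j<k. c i * c j * (Q i k * Q j k / a))
        = (\<Sum>i<k. \<Sum>j<k. c i * c j * Q' i j)"
      by (simp add: Q'_def sum_subtractf right_diff_distrib)
    finally show "0 < (\<Sum>i<k. \<Sum>j<k. c i * c j * Q' i j)" .
  qed
  then obtain w :: "nat \<Rightarrow> nat \<Rightarrow> real" where w: "\<And>i m. i < k \<Longrightarrow> k \<le> m \<Longrightarrow> w i m = 0"
    "\<And>i j. i < k \<Longrightarrow> j < k \<Longrightarrow> (\<Sum>m<k. w i m * w j m) = Q' i j" by blast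
  define v where "v i m = (if m = k then Q i k / sqrt a else if i = k then 0 else w i m)" for i m
  have ss: "sqrt a * sqrt a = a" using a by simp
  have "(\<Sum>m<Suc k. v i m * v j m) = Q i j" if ij: "i < Suc k" "j < Suc k" for i j
  proof -
    have last: "v i k * v j k = Q i k * Q j k / a" using ss by (simp add: v_def)
    have "(\<Sum>m<k. v i m * v j m) = (if i = k \<or> j = k then 0 else Q' i j)"
    proof (cases "i = k \<or> j = k")
      case True
      then show ?thesis by (auto simp: v_def intro!: sum.neutral)
    next
      case False
      have "(\<Sum>m<k. v i m * v j m) = (\<Sum>m<k. w i m * w j m)"
        using False by (intro sum.cong) (auto simp: v_def)
      then show ?thesis using w(2)[of i j] ij False by simp
    qed
    then show ?thesis
      using last a Suc.prems(1)[of j k] by (auto simp: Q'_def a_def)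
  qed
  moreover have "\<forall>i<Suc k. \<forall>m\<ge>Suc k. v i m = 0" using w(1) by (auto simp: v_def)
  ultimately show ?case by blast
qed

text \<open>With the first point as origin, the prescribed inner products are given by polarization.\<close>
lemma euclidean_realization:
  fixes D :: "nat \<Rightarrow> nat \<Rightarrow> real"
  assumes sym: "\<And>i j. D i j = D j i" and diag: "\<And>i. D i i = 0"
    and pd: "\<And>c. (\<Sum>i\<le>k. c i) = 0 \<Longrightarrow> \<exists>i\<le>k. c i \<noteq> 0 \<Longrightarrow> 0 < - (\<Sum>i\<le>k. \<Sum>j\<le>k. c i * c j * D i j)"
  shows "\<exists>v :: nat \<Rightarrow> nat \<Rightarrow> real. (\<forall>j\<le>k. \<forall>m\<ge>k. v j m = 0) \<and>
    (\<forall>c. (\<Sum>i\<le>k. c i) = 0 \<longrightarrow>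
      (\<Sum>m<k. (\<Sum>j\<le>k. c j * v j m)\<^sup>2) = - (\<Sum>i\<le>k. \<Sum>j\<le>k. c i * c j * D i j) / 2)"
proof -
  define Q where "Q i j = (D 0 (Suc i) + D 0 (Suc j) - D (Suc i) (Suc j)) / 2" for i j
  have form: "- (\<Sum>i\<le>k. \<Sum>j\<le>k. c i * c j * D i j) / 2 = (\<Sum>i<k. \<Sum>j<k. c (Suc i) * c (Suc j) * Q i j)"
    if c: "(\<Sum>i\<le>k. c i) = 0" for c :: "nat \<Rightarrow> real"
  proof -
    define b where "b = (\<Sum>i<k. c (Suc i) * D 0 (Suc i))"
    define s where "s = (\<Sum>i<k. c (Suc i))"
    have c0: "c 0 = - s" using c by (simp add: sum.atMost_shift s_def)
    have 1: "(\<Sum>i<k. c (Suc i) * c 0 * D (Suc i) 0) = c 0 * b"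
      unfolding b_def sum_distrib_left using sym[of _ 0] by (intro sum.cong) (auto simp: mult_ac)
    have 2: "(\<Sum>i<k. c 0 * c (Suc i) * D 0 (Suc i)) = c 0 * b"
      unfolding b_def sum_distrib_left by (simp add: mult_ac)
    define q where "q = (\<Sum>i<k. \<Sum>j<k. c (Suc i) * c (Suc j) * D (Suc i) (Suc j))"
    have L: "(\<Sum>i\<le>k. \<Sum>j\<le>k. c i * c j * D i j) = 2 * c 0 * b + q"
      unfolding sum.atMost_shift sum.distrib 1 2 q_def[symmetric] by (simp add: diag)
    have "(\<Sum>i<k. \<Sum>j<k. c (Suc i) * c (Suc j) * Q i j)
      = ((\<Sum>i<k. \<Sum>j<k. c (Suc i) * c (Suc j) * D 0 (Suc i))
        + (\<Sum>i<k. \<Sum>j<k. c (Suc i) * c (Suc j) * D 0 (Suc j)) - q) / 2"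
      unfolding q_def Q_def
      by (simp add: sum.distrib[symmetric] sum_subtractf[symmetric] sum_divide_distrib field_simps)
    also have "(\<Sum>i<k. \<Sum>j<k. c (Suc i) * c (Suc j) * D 0 (Suc i)) = b * s"
      unfolding b_def s_def sum_product by (intro sum.cong) (simp_all add: mult_ac)
    also have "(\<Sum>i<k. \<Sum>j<k. c (Suc i) * c (Suc j) * D 0 (Suc j)) = s * b"
      unfolding b_def s_def sum_product by (intro sum.cong) (simp_all add: mult_ac)
    finally show ?thesis unfolding L c0 by simp
  qed
  have "\<exists>v :: nat \<Rightarrow> nat \<Rightarrow> real. (\<forall>i<k. \<forall>m\<ge>k. v i m = 0) \<and>
    (\<forall>i<k. \<forall>j<k. (\<Sum>m<k. v i m * v j m) = Q i j)"
  proof (rule gram_vectors)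
    show "Q i j = Q j i" for i j unfolding Q_def using sym[of "Suc i" "Suc j"] by simp
    fix c :: "nat \<Rightarrow> real" assume c: "\<exists>i<k. c i \<noteq> 0"
    define e where "e i = (case i of 0 \<Rightarrow> - (\<Sum>i<k. c i) | Suc j \<Rightarrow> c j)" for i
    have e: "(\<Sum>i\<le>k. e i) = 0" by (simp add: sum.atMost_shift e_def)
    obtain i where "i < k" "c i \<noteq> 0" using c by blast
    then have "\<exists>i\<le>k. e i \<noteq> 0" by (intro exI[of _ "Suc i"]) (simp add: e_def)
    from pd[OF e this] form[OF e] show "0 < (\<Sum>i<k. \<Sum>j<k. c i * c j * Q i j)"
      by (simp add: e_def)
  qed
  then obtain w :: "nat \<Rightarrow> nat \<Rightarrow> real" where w: "\<And>i m. i < k \<Longrightarrow> k \<le> m \<Longrightarrow> w i m = 0"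
    "\<And>i j. i < k \<Longrightarrow> j < k \<Longrightarrow> (\<Sum>m<k. w i m * w j m) = Q i j" by blast
  define v where "v j m = (case j of 0 \<Rightarrow> 0 | Suc i \<Rightarrow> w i m)" for j m
  have "(\<Sum>m<k. (\<Sum>j\<le>k. c j * v j m)\<^sup>2) = - (\<Sum>i\<le>k. \<Sum>j\<le>k. c i * c j * D i j) / 2"
    if c: "(\<Sum>i\<le>k. c i) = 0" for c :: "nat \<Rightarrow> real"
  proof -
    have "(\<Sum>j\<le>k. c j * v j m) = (\<Sum>i<k. c (Suc i) * w i m)" for m
      by (simp add: sum.atMost_shift v_def)
    then have "(\<Sum>m<k. (\<Sum>j\<le>k. c j * v j m)\<^sup>2)
        = (\<Sum>m<k. \<Sum>i<k. \<Sum>j<k. c (Suc i) * c (Suc j) * (w i m * w j m))"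
      by (simp add: power2_eq_square sum_product mult_ac)
    also have "\<dots> = (\<Sum>i<k. \<Sum>m<k. \<Sum>j<k. c (Suc i) * c (Suc j) * (w i m * w j m))"
      by (rule sum.swap)
    also have "\<dots> = (\<Sum>i<k. \<Sum>j<k. \<Sum>m<k. c (Suc i) * c (Suc j) * (w i m * w j m))"
      by (intro sum.cong refl sum.swap)
    also have "\<dots> = (\<Sum>i<k. \<Sum>j<k. c (Suc i) * c (Suc j) * Q i j)"
      using w(2) by (simp add: sum_distrib_left[symmetric])
    finally show ?thesis using form[OF c] by simp
  qed
  moreover have "\<forall>j\<le>k. \<forall>m\<ge>k. v j m = 0" using w(1) by (auto simp: v_def split: nat.splits)
  ultimately show ?thesis by blast
qed

section \<open>The triangulation\<close>

lemma closedin_closed_simplex: "closedin (powertop_real UNIV) (closed_simplex \<sigma>)"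
  if "finite \<sigma>"
proof -
  have 1: "closed {t :: nat \<Rightarrow> real. 0 \<le> t i}" for i
    by (intro closed_Collect_le continuous_intros continuous_on_product_coordinates)
  have 2: "closed {t :: nat \<Rightarrow> real. t i = 0}" for i
    by (intro closed_Collect_eq continuous_intros continuous_on_product_coordinates)
  have 3: "closed {t :: nat \<Rightarrow> real. sum t \<sigma> = 1}"
    by (intro closed_Collect_eq continuous_intros continuous_on_product_coordinates)
  have "closed_simplex \<sigma> = (\<Inter>i. {t. 0 \<le> t i}) \<inter> (\<Inter>i\<in>-\<sigma>. {t. t i = 0}) \<inter> {t. sum t \<sigma> = 1}"
    by (auto simp: closed_simplex_def)
  then have "closed (closed_simplex \<sigma>)"
    using 1 2 3 by (simp only:) (intro closed_Int closed_INT ballI)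
  then show ?thesis by (simp add: euclidean_product_topology)
qed

lemma compactin_closed_simplex: "compactin (powertop_real UNIV) (closed_simplex \<sigma>)"
  if "finite \<sigma>"
proof -
  have "compactin (powertop_real UNIV) (PiE UNIV (\<lambda>_. {0..1}))"
    unfolding compactin_PiE by simp
  moreover have "closed_simplex \<sigma> \<subseteq> PiE UNIV (\<lambda>_. {0..1})"
  proof
    fix t assume t: "t \<in> closed_simplex \<sigma>"
    have "t i \<le> 1" for i
    proof (cases "i \<in> \<sigma>")
      case True
      then have "t i \<le> sum t \<sigma>" using t that by (intro member_le_sum) (auto simp: closed_simplex_def)
      then show ?thesis using t by (simp add: closed_simplex_def)
    qed (use t in \<open>simp add: closed_simplex_def\<close>)
    then show "t \<in> PiE UNIV (\<lambda>_. {0..1})" using t by (auto simp: closed_simplex_def)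
  qed
  ultimately show ?thesis using closedin_closed_simplex[OF that] closed_compactin by blast
qed

lemma compact_space_realization:
  assumes "finite K" "\<And>\<sigma>. \<sigma> \<in> K \<Longrightarrow> finite \<sigma>"
  shows "compact_space (realization K)"
  unfolding realization_def using assms compactin_closed_simplex
  by (intro compact_space_subtopology) (auto intro!: compactin_Union)

context Metric_space
begin

lemma join_point_scale:
  assumes "c \<noteq> 0"
  shows "join_point zs (\<lambda>x. c * t x) = join_point zs t"
proof (induction zs t rule: join_point.induct)
  case (3 z w zs t)
  have "sum (\<lambda>x. c * t x) S / sum (\<lambda>x. c * t x) S' = sum t S / sum t S'" for S S'
    using assms by (simp add: sum_distrib_left[symmetric])
  then show ?case unfolding join_point.simps 3 by simp
qed auto

end

context finite_tower
begin

text \<open>Vertices of weight 0 may be dropped from a chain, so the points computed from different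
  simplices agree on common faces.\<close>
lemma join_point_filter:
  assumes "chain zs" "\<And>x. x \<in> set zs \<Longrightarrow> 0 \<le> t x" "0 < sum t (set zs)"
  shows "join_point zs t = join_point (filter (\<lambda>x. 0 < t x) zs) t"
  using assms
proof (induction zs)
  case Nil
  then show ?case by simp
next
  case (Cons z zs)
  have zV: "z \<in> vertices" using chain_sub[OF Cons.prems(1)] by simp
  have zn: "z \<notin> set zs" using chain_distinct[OF Cons.prems(1)] by simp
  have tn: "0 \<le> t z" "\<And>x. x \<in> set zs \<Longrightarrow> 0 \<le> t x" using Cons.prems(2) by auto
  have sm: "sum t (set (z # zs)) = t z + sum t (set zs)" using zn by simp
  show ?case
  proof (cases "zs = []")
    case True
    then show ?thesis using Cons.prems(3) by simp
  next
    case ne: False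
    have ch: "chain zs" using Cons.prems(1) ne by (cases zs) (auto simp: chain_Cons)
    have yM: "join_point zs t \<in> M" using join_point_in_M[OF ch tn(2)] by simp
    show ?thesis
    proof (cases "sum t (set zs) = 0")
      case True
      then have "filter (\<lambda>x. 0 < t x) zs = []"
        using sum_zero_imp_zero[OF _ tn(2) True] by (auto simp: filter_empty_conv)
      moreover have "0 < t z" using Cons.prems(3) True sm by simp
      ultimately have r: "filter (\<lambda>x. 0 < t x) (z # zs) = [z]" by simp
      show ?thesis unfolding r join_point_Cons[OF ne] True using dil_0[OF vertex_in_M[OF zV]] by simp
    next
      case False
      then have pos: "0 < sum t (set zs)" using tn(2) sum_nonneg[of "set zs" t] by simp
      have IH: "join_point zs t = join_point (filter (\<lambda>x. 0 < t x) zs) t"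
        using Cons.IH[OF ch tn(2) pos] by simp
      show ?thesis
      proof (cases "0 < t z")
        case True
        have s: "sum t (set (filter (\<lambda>x. 0 < t x) zs)) = sum t (set zs)"
          using tn(2) by (intro sum.mono_neutral_left) (auto simp: less_le)
        have ne': "filter (\<lambda>x. 0 < t x) zs \<noteq> []"
        proof
          assume "filter (\<lambda>x. 0 < t x) zs = []"
          then show False using s pos by (simp only: list.set sum.empty)
        qed
        have r: "filter (\<lambda>x. 0 < t x) (z # zs) = z # filter (\<lambda>x. 0 < t x) zs" using True by simp
        have s2: "sum t (set (z # filter (\<lambda>x. 0 < t x) zs)) = t z + sum t (set zs)"
          using s zn by simp
        show ?thesis unfolding r join_point_Cons[OF ne] join_point_Cons[OF ne'] s s2 sm IH ..
      next
        case False
        then have tz: "t z = 0" using tn(1) by simp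
        then have r: "filter (\<lambda>x. 0 < t x) (z # zs) = filter (\<lambda>x. 0 < t x) zs" by simp
        show ?thesis unfolding r join_point_Cons[OF ne] sm tz IH[symmetric]
          using pos dil_1[OF yM] by simp
      qed
    qed
  qed
qed

lemma chain_filter: "chain zs \<Longrightarrow> filter P zs \<noteq> [] \<Longrightarrow> chain (filter P zs)"
  by (auto simp: chain_def sorted_wrt_filter)

lemma dist_formula_normalized:
  assumes "chain zs" "\<And>x. x \<in> set zs \<Longrightarrow> 0 \<le> t x" "\<And>x. x \<in> set zs \<Longrightarrow> 0 \<le> t' x"
    and "sum t (set zs) = 1" "sum t' (set zs) = 1"
  shows "(d (join_point zs t) (join_point zs t'))\<^sup>2
    = - dist_form (set zs) (\<lambda>x. t x - t' x) (\<lambda>x. t x - t' x) / 2"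
proof -
  have "(sum t (set zs))\<^sup>2 * (sum t' (set zs))\<^sup>2 * (d (join_point zs t) (join_point zs t'))\<^sup>2
    = - dist_form (set zs) (\<lambda>x. sum t' (set zs) * t x - sum t (set zs) * t' x)
        (\<lambda>x. sum t' (set zs) * t x - sum t (set zs) * t' x) / 2"
    by (rule dist_formula) (use assms in auto)
  then show ?thesis using assms(4,5) by simp
qed

text \<open>Weights with sum 0 are multiples of a difference of two positive weights with sum 1. For these
  the form is a squared distance, and it is not 0 by uniqueness of barycentric coordinates.\<close>
lemma dist_form_negative_definite:
  assumes ch: "chain zs" and c: "sum c (set zs) = 0" "x0 \<in> set zs" "c x0 \<noteq> 0"
  shows "0 < - dist_form (set zs) c c"
proof -
  define B where "B = 1 + (\<Sum>x\<in>set zs. \<bar>c x\<bar>)"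
  have cB: "\<bar>c x\<bar> < B" if "x \<in> set zs" for x
    using member_le_sum[of x "set zs" "\<lambda>x. \<bar>c x\<bar>"] that by (simp add: B_def)
  have B0: "0 < B" using cB[OF c(2)] by linarith
  define n where "n = real (card (set zs))"
  have n: "0 < n" using c(2) by (auto simp: n_def card_gt_0_iff)
  define t where "t x = (B + c x) / (n * B)" for x
  define t' where "t' x = B / (n * B)" for x :: 'a
  have s: "sum t (set zs) = 1" "sum t' (set zs) = 1"
    using c n B0 by (auto simp: t_def t'_def sum_divide_distrib[symmetric] sum.distrib n_def)
  have pos: "0 < t x" "0 < t' x" if "x \<in> set zs" for x
    using cB[OF that] n B0 by (auto simp: t_def t'_def)
  have diff: "t x - t' x = (1 / (n * B)) * c x" for x
    by (simp add: t_def t'_def add_divide_distrib)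
  have scale: "dist_form S (\<lambda>x. k * c x) (\<lambda>x. k * c x) = k\<^sup>2 * dist_form S c c" for S k
    by (simp add: dist_form_def sum_distrib_left power2_eq_square mult_ac)
  have "(d (join_point zs t) (join_point zs t'))\<^sup>2 = - ((1 / (n * B))\<^sup>2 * dist_form (set zs) c c) / 2"
    using dist_formula_normalized[OF ch _ _ s] pos unfolding diff scale by (simp add: less_imp_le)
  moreover have "join_point zs t \<noteq> join_point zs t'"
  proof
    assume "join_point zs t = join_point zs t'"
    then have "\<forall>x\<in>set zs. t x = t' x" using join_point_inj[of zs zs t t', OF ch ch pos] s by simp
    then have "t x0 - t' x0 = 0" using c(2) by simp
    then show False unfolding diff using c(3) n B0 by simp
  qed
  then have "d (join_point zs t) (join_point zs t') > 0"
    using join_point_in_M[OF ch] pos by (simp add: less_imp_le mdist_pos_less)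
  then have "0 < (d (join_point zs t) (join_point zs t'))\<^sup>2" by simp
  ultimately have "0 < (1 / (n * B))\<^sup>2 * (- dist_form (set zs) c c)" by simp
  moreover have "0 < (1 / (n * B))\<^sup>2" using n B0 by simp
  ultimately show ?thesis by (rule zero_less_mult_pos)
qed

text \<open>Vertices of the abstract complex are natural numbers. The labelling is increasing in the level, so
  sorting labels sorts a clique into a chain.\<close>
definition label :: "'a \<Rightarrow> nat" where
  "label = (SOME e. inj_on e vertices \<and> (\<forall>u\<in>vertices. \<forall>v\<in>vertices. level u < level v \<longrightarrow> e u < e v))"

lemma label: "inj_on label vertices" "u \<in> vertices \<Longrightarrow> v \<in> vertices \<Longrightarrow> level u < level v \<Longrightarrow> label u < label v"
proof -
  obtain f :: "'a \<Rightarrow> nat" and n where f: "f ` vertices = {i. i < n}" "inj_on f vertices"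
    using finite_imp_inj_to_nat_seg[OF finite_vertices] by blast
  define e where "e u = level u * n + f u" for u
  have less: "f u < n" if "u \<in> vertices" for u using f(1) that by auto
  have mono: "e u < e v" if "u \<in> vertices" "v \<in> vertices" "level u < level v" for u v
  proof -
    have "e u < Suc (level u) * n" using less[OF that(1)] by (simp add: e_def)
    also have "\<dots> \<le> level v * n" using that(3) by (intro mult_le_mono1) simp
    finally show ?thesis by (simp add: e_def)
  qed
  have "inj_on e vertices"
  proof (rule inj_onI)
    fix u v assume uv: "u \<in> vertices" "v \<in> vertices" "e u = e v"
    then have "level u = level v" using mono by (metis linorder_neqE_nat less_irrefl)
    then show "u = v" using uv f(2) by (simp add: e_def inj_on_eq_iff)
  qed
  then have "\<exists>e :: 'a \<Rightarrow> nat. inj_on e vertices \<and> (\<forall>u\<in>vertices. \<forall>v\<in>vertices. level u < level v \<longrightarrow> e u < e v)"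
    using mono by blast
  from someI_ex[OF this] show "inj_on label vertices"
    "u \<in> vertices \<Longrightarrow> v \<in> vertices \<Longrightarrow> level u < level v \<Longrightarrow> label u < label v"
    unfolding label_def by blast+
qed

definition unlabel :: "nat \<Rightarrow> 'a" where "unlabel = inv_into vertices label"

lemma unlabel_label: "x \<in> vertices \<Longrightarrow> unlabel (label x) = x"
  unfolding unlabel_def using label(1) by simp

definition clique :: "'a set \<Rightarrow> bool" where
  "clique S \<longleftrightarrow> S \<noteq> {} \<and> S \<subseteq> vertices \<and> (\<forall>u\<in>S. \<forall>v\<in>S. u \<noteq> v \<longrightarrow> adj u v \<or> adj v u)"

text \<open>The vertex sets of simplices are exactly the sets of pairwise related centres, so faces of simplices
  are simplices by definition.\<close>
definition cliques :: "nat set set" where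
  "cliques = {label ` S | S. clique S}"

definition vertex_list :: "nat set \<Rightarrow> 'a list" where
  "vertex_list \<sigma> = map unlabel (sorted_list_of_set \<sigma>)"

lemma finite_simplicial_complex_cliques: "finite_simplicial_complex cliques"
  unfolding finite_simplicial_complex_def
proof (intro conjI ballI allI impI)
  have "cliques \<subseteq> Pow (label ` vertices)" by (auto simp: cliques_def clique_def)
  then show "finite cliques" using finite_vertices by (meson finite_Pow_iff finite_imageI finite_subset)
  fix \<sigma> assume "\<sigma> \<in> cliques"
  then obtain S where S: "clique S" "\<sigma> = label ` S" by (auto simp: cliques_def)
  then have "finite S" using finite_vertices finite_subset by (auto simp: clique_def)
  then show "finite \<sigma>" "\<sigma> \<noteq> {}" using S by (auto simp: clique_def)
  fix \<tau> assume "\<tau> \<subseteq> \<sigma> \<and> \<tau> \<noteq> {}"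
  then obtain T where "T \<subseteq> S" "\<tau> = label ` T" "T \<noteq> {}" using S(2) by (auto simp: subset_image_iff)
  moreover have "clique T" using S(1) calculation by (auto simp: clique_def)
  ultimately show "\<tau> \<in> cliques" by (auto simp: cliques_def)
qed

lemma set_vertex_list: "S \<subseteq> vertices \<Longrightarrow> set (vertex_list (label ` S)) = S"
proof -
  assume S: "S \<subseteq> vertices"
  then have "finite (label ` S)" using finite_vertices finite_subset by blast
  then have "set (vertex_list (label ` S)) = unlabel ` label ` S" by (simp add: vertex_list_def)
  also have "\<dots> = S" using S unlabel_label by (force simp: image_image)
  finally show ?thesis .
qed

lemma chain_vertex_list:
  assumes "clique S"
  shows "chain (vertex_list (label ` S))"
proof -
  have S: "S \<subseteq> vertices" "S \<noteq> {}" using assms by (auto simp: clique_def)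
  then have fin: "finite (label ` S)" using finite_vertices finite_subset by blast
  have "sorted_wrt (<) (sorted_list_of_set (label ` S))" by simp
  then have "sorted_wrt (\<lambda>i j. adj (unlabel i) (unlabel j)) (sorted_list_of_set (label ` S))"
  proof (rule sorted_wrt_mono_rel[rotated])
    fix i j assume "i \<in> set (sorted_list_of_set (label ` S))" "j \<in> set (sorted_list_of_set (label ` S))" "i < j"
    then obtain u v where uv: "u \<in> S" "v \<in> S" "i = label u" "j = label v" "label u < label v" using fin by auto
    then have "adj u v \<or> adj v u" using assms by (auto simp: clique_def)
    moreover have "\<not> adj v u" using label(2)[of v u] uv(5) by (auto simp: adj_def)
    ultimately show "adj (unlabel i) (unlabel j)" using uv S unlabel_label by (simp add: subset_iff)
  qed
  then have "sorted_wrt adj (vertex_list (label ` S))" by (simp add: vertex_list_def sorted_wrt_map)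
  moreover have "vertex_list (label ` S) \<noteq> []" using set_vertex_list[OF S(1)] S(2) by auto
  ultimately show ?thesis using set_vertex_list[OF S(1)] S(1) by (simp add: chain_def)
qed

lemma chain_clique: "chain zs \<Longrightarrow> clique (set zs)"
proof -
  assume ch: "chain zs"
  have "sorted_wrt adj zs" using ch by (simp add: chain_def)
  then have "\<forall>u\<in>set zs. \<forall>v\<in>set zs. u \<noteq> v \<longrightarrow> adj u v \<or> adj v u" by (induction zs) auto
  then show ?thesis using ch by (auto simp: clique_def chain_def)
qed

lemma vertex_list_chain: "chain zs \<Longrightarrow> vertex_list (label ` set zs) = zs"
proof -
  assume ch: "chain zs"
  have "sorted_wrt (\<lambda>u v. label u < label v) zs"
    using ch label(2) unfolding chain_def
    by (auto elim!: sorted_wrt_mono_rel[rotated] simp: adj_def)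
  then have "sorted_wrt (<) (map label zs)" by (simp add: sorted_wrt_map)
  then have "sorted_list_of_set (set (map label zs)) = map label zs"
    by (intro strict_sorted_equal) auto
  then have "vertex_list (label ` set zs) = map unlabel (map label zs)" by (simp add: vertex_list_def)
  also have "\<dots> = zs" using chain_sub[OF ch] unlabel_label by (auto simp: map_idI subset_iff)
  finally show ?thesis .
qed

text \<open>Using the support of \<open>t\<close> instead of a simplex containing \<open>t\<close> gives one map for all simplices.\<close>
definition realize :: "(nat \<Rightarrow> real) \<Rightarrow> 'a" where
  "realize t = join_point (vertex_list {i. 0 < t i}) (\<lambda>x. t (label x))"

lemma closed_simplex_weights:
  assumes S: "clique S" and t: "t \<in> closed_simplex (label ` S)"
  shows "sum (\<lambda>x. t (label x)) S = 1" "0 \<le> t (label x)"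
proof -
  have inj: "inj_on label S" using label(1) S by (auto simp: clique_def intro: inj_on_subset)
  show "sum (\<lambda>x. t (label x)) S = 1"
    using t sum.reindex[OF inj, of t] by (simp add: closed_simplex_def)
  show "0 \<le> t (label x)" using t by (simp add: closed_simplex_def)
qed

lemma vertex_list_support:
  assumes S: "clique S" and t: "t \<in> closed_simplex (label ` S)"
  shows "vertex_list {i. 0 < t i} = filter (\<lambda>x. 0 < t (label x)) (vertex_list (label ` S))"
    and "filter (\<lambda>x. 0 < t (label x)) (vertex_list (label ` S)) \<noteq> []"
proof -
  have sub: "S \<subseteq> vertices" using S by (simp add: clique_def)
  have ch: "chain (vertex_list (label ` S))" by (rule chain_vertex_list[OF S])
  define zs where "zs = filter (\<lambda>x. 0 < t (label x)) (vertex_list (label ` S))"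
  have set: "set zs = {x\<in>S. 0 < t (label x)}" using set_vertex_list[OF sub] by (auto simp: zs_def)
  show ne: "zs \<noteq> []"
  proof
    assume "zs = []"
    then have "\<forall>x\<in>S. t (label x) = 0"
      using set closed_simplex_weights(2)[OF S t] by (auto simp: less_le)
    then show False using closed_simplex_weights(1)[OF S t] by simp
  qed
  have "i \<in> label ` S" if "0 < t i" for i using t that by (auto simp: closed_simplex_def)
  then have "label ` set zs = {i. 0 < t i}" unfolding set by auto
  then show "vertex_list {i. 0 < t i} = zs"
    using vertex_list_chain[OF chain_filter[OF ch ne[unfolded zs_def]]] by (simp add: zs_def)
qed

lemma realize_eq:
  assumes S: "clique S" and t: "t \<in> closed_simplex (label ` S)"
  shows "realize t = join_point (vertex_list (label ` S)) (\<lambda>x. t (label x))"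
proof -
  have sub: "S \<subseteq> vertices" using S by (simp add: clique_def)
  show ?thesis
    unfolding realize_def vertex_list_support(1)[OF S t]
    by (rule join_point_filter[OF chain_vertex_list[OF S], symmetric])
      (simp_all add: closed_simplex_weights[OF S t] set_vertex_list[OF sub])
qed

lemma realize_dist:
  assumes S: "clique S" and t: "t \<in> closed_simplex (label ` S)" and t': "t' \<in> closed_simplex (label ` S)"
  shows "(d (realize t) (realize t'))\<^sup>2
    = - dist_form S (\<lambda>x. t (label x) - t' (label x)) (\<lambda>x. t (label x) - t' (label x)) / 2"
proof -
  have set: "set (vertex_list (label ` S)) = S" using S by (intro set_vertex_list) (simp add: clique_def)
  show ?thesis
    unfolding realize_eq[OF S t] realize_eq[OF S t']
    by (rule dist_formula_normalized[OF chain_vertex_list[OF S], unfolded set])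
      (simp_all add: closed_simplex_weights[OF S t] closed_simplex_weights[OF S t'])
qed

lemma realize_in_M:
  assumes S: "clique S" and t: "t \<in> closed_simplex (label ` S)"
  shows "realize t \<in> M"
  unfolding realize_eq[OF S t]
  by (rule join_point_in_M[OF chain_vertex_list[OF S]]) (rule closed_simplex_weights(2)[OF S t])

lemma realize_inj:
  assumes S: "clique S" "t \<in> closed_simplex (label ` S)" and S': "clique S'" "t' \<in> closed_simplex (label ` S')"
    and eq: "realize t = realize t'"
  shows "t = t'"
proof -
  define zs zs' where "zs = vertex_list {i. 0 < t i}" and "zs' = vertex_list {i. 0 < t' i}"
  have zs: "chain zs" "\<And>x. x \<in> set zs \<Longrightarrow> 0 < t (label x)"
    "set zs = {x\<in>S. 0 < t (label x)}" "sum (\<lambda>x. t (label x)) (set zs) = 1"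
    if "clique S" "t \<in> closed_simplex (label ` S)" "zs = vertex_list {i. 0 < t i}" for S t zs
  proof -
    have sub: "S \<subseteq> vertices" using that by (simp add: clique_def)
    note * = vertex_list_support[OF that(1,2), folded that(3)]
    show "chain zs" unfolding *(1) by (rule chain_filter[OF chain_vertex_list[OF that(1)] *(2)])
    show set: "set zs = {x\<in>S. 0 < t (label x)}" unfolding *(1) using set_vertex_list[OF sub] by auto
    then show "0 < t (label x)" if "x \<in> set zs" for x using that by simp
    have "finite S" using sub finite_vertices finite_subset by blast
    then have "sum (\<lambda>x. t (label x)) (set zs) = sum (\<lambda>x. t (label x)) S"
      unfolding set using closed_simplex_weights(2)[OF that(1,2)]
      by (intro sum.mono_neutral_left) (auto simp: less_le)
    then show "sum (\<lambda>x. t (label x)) (set zs) = 1" using closed_simplex_weights(1)[OF that(1,2)] by simp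
  qed
  note a = zs[OF S zs_def] and b = zs[OF S' zs'_def]
  have "join_point zs (\<lambda>x. t (label x)) = join_point zs' (\<lambda>x. t' (label x))"
    using eq by (simp add: realize_def zs_def zs'_def)
  then have r: "zs = zs' \<and> (\<forall>x\<in>set zs. t (label x) / sum (\<lambda>x. t (label x)) (set zs)
      = t' (label x) / sum (\<lambda>x. t' (label x)) (set zs))"
    using a(1,2) b(1,2) by (intro join_point_inj)
  then have e: "t (label x) = t' (label x)" if "x \<in> set zs" for x
    using that a(4) b(4) by simp
  have zero: "t i = 0" if "i \<notin> label ` {x\<in>S. 0 < t (label x)}" "t \<in> closed_simplex (label ` S)" for i t S
    using that by (cases "i \<in> label ` S") (auto simp: closed_simplex_def less_le)
  show ?thesis
  proof
    fix i
    show "t i = t' i"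
    proof (cases "i \<in> label ` set zs")
      case True
      then show ?thesis using e by auto
    next
      case False
      then show ?thesis using zero[OF _ S(2), of i] zero[OF _ S'(2), of i] a(3) b(3) r by metis
    qed
  qed
qed

lemma realize_surj:
  assumes "p \<in> M"
  shows "\<exists>S t. clique S \<and> t \<in> closed_simplex (label ` S) \<and> realize t = p"
proof -
  obtain zs t where zs: "chain zs" "\<And>x. x \<in> set zs \<Longrightarrow> 0 < t x" "join_point zs t = p"
    using join_point_surj[of p 0] assms L_0 by blast
  define T where "T = sum t (set zs)"
  have "set zs \<noteq> {}" using zs(1) by (auto simp: chain_def)
  then have T: "0 < T" unfolding T_def using zs(2) by (intro sum_pos) auto
  define t' where "t' i = (if i \<in> label ` set zs then t (unlabel i) / T else 0)" for i
  have sub: "set zs \<subseteq> vertices" using chain_sub[OF zs(1)] .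
  have t': "t' (label x) = t x / T" if "x \<in> set zs" for x
    using that sub unlabel_label by (auto simp: t'_def)
  have inj: "inj_on label (set zs)" using label(1) sub by (rule inj_on_subset)
  have "sum t' (label ` set zs) = 1"
    using T t' by (simp add: sum.reindex[OF inj] sum_divide_distrib[symmetric] T_def)
  moreover have "0 \<le> t' i" for i
  proof (cases "i \<in> label ` set zs")
    case True
    then obtain x where "x \<in> set zs" "i = label x" by blast
    then show ?thesis using t' zs(2)[of x] T by simp
  qed (simp add: t'_def)
  moreover have "t' i = 0" if "i \<notin> label ` set zs" for i using that by (simp add: t'_def)
  ultimately have cs: "t' \<in> closed_simplex (label ` set zs)" by (simp add: closed_simplex_def)
  have "realize t' = join_point zs (\<lambda>x. t' (label x))"
    using realize_eq[OF chain_clique[OF zs(1)] cs] vertex_list_chain[OF zs(1)] by simp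
  also have "\<dots> = join_point zs (\<lambda>x. (1 / T) * t x)" using t' by (intro join_point_cong) simp
  also have "\<dots> = p" using join_point_scale[of "1 / T" zs t] T zs(3) by simp
  finally show ?thesis using chain_clique[OF zs(1)] cs by blast
qed

lemma topspace_realization_cliques:
  "t \<in> topspace (realization cliques) \<longleftrightarrow> (\<exists>S. clique S \<and> t \<in> closed_simplex (label ` S))"
  by (auto simp: realization_def cliques_def)

lemma realize_homeomorphic: "homeomorphic_map (realization cliques) mtopology realize"
proof (rule continuous_imp_homeomorphic_map)
  have fsc: "finite cliques" "\<And>\<sigma>. \<sigma> \<in> cliques \<Longrightarrow> finite \<sigma>"
    using finite_simplicial_complex_cliques by (auto simp: finite_simplicial_complex_def)
  show "compact_space (realization cliques)" by (rule compact_space_realization[OF fsc])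
  show "Hausdorff_space mtopology" by (rule Hausdorff_space_mtopology)
  show "inj_on realize (topspace (realization cliques))"
    by (rule inj_onI) (metis topspace_realization_cliques realize_inj)
  show "realize ` topspace (realization cliques) = topspace mtopology"
  proof (intro equalityI subsetI)
    fix p assume "p \<in> realize ` topspace (realization cliques)"
    then show "p \<in> topspace mtopology" using topspace_realization_cliques realize_in_M by auto
  next
    fix p assume "p \<in> topspace mtopology"
    then have "p \<in> M" by simp
    then obtain S t where "clique S" "t \<in> closed_simplex (label ` S)" "realize t = p"
      using realize_surj by blast
    then show "p \<in> realize ` topspace (realization cliques)" using topspace_realization_cliques by blast
  qed
  show "continuous_map (realization cliques) mtopology realize"
  proof (rule pasting_lemma_closed[where I = cliques and T = closed_simplex and f = "\<lambda>_. realize"])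
    show "finite cliques" by fact
    show "closedin (realization cliques) (closed_simplex \<sigma>)" if "\<sigma> \<in> cliques" for \<sigma>
      unfolding realization_def using closedin_closed_simplex[OF fsc(2)[OF that]] that
      by (intro closedin_subset_topspace) auto
    show "\<exists>j. j \<in> cliques \<and> t \<in> closed_simplex j \<and> realize t = realize t" if "t \<in> topspace (realization cliques)" for t
      using that by (auto simp: realization_def)
    show "continuous_map (subtopology (realization cliques) (closed_simplex \<sigma>)) mtopology realize"
      if \<sigma>: "\<sigma> \<in> cliques" for \<sigma>
    proof -
      obtain S where S: "clique S" "\<sigma> = label ` S" using \<sigma> by (auto simp: cliques_def)
      define Y where "Y = subtopology (realization cliques) (closed_simplex \<sigma>)"
      have top: "topspace Y = closed_simplex \<sigma>" using \<sigma> by (auto simp: Y_def realization_def)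
      have Y: "Y = subtopology (powertop_real UNIV) (closed_simplex \<sigma>)"
        unfolding Y_def realization_def subtopology_subtopology using \<sigma>
        by (intro arg_cong[where f = "subtopology _"]) auto
      have "\<exists>U. openin Y U \<and> t \<in> U \<and> (\<forall>t'\<in>U. realize t' \<in> mball (realize t) \<epsilon>)"
        if t: "t \<in> closed_simplex \<sigma>" and \<epsilon>: "0 < \<epsilon>" for t \<epsilon>
      proof -
        define \<phi> where "\<phi> t' = - dist_form S (\<lambda>x. t (label x) - t' (label x)) (\<lambda>x. t (label x) - t' (label x)) / 2"
          for t' :: "nat \<Rightarrow> real"
        have fS: "finite S" using S(1) finite_vertices finite_subset by (auto simp: clique_def)
        have "continuous_map Y euclideanreal (\<lambda>t'. t' i)" for i
          unfolding Y by (intro continuous_map_from_subtopology continuous_map_product_projection) simp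
        then have "continuous_map Y euclideanreal \<phi>"
          unfolding \<phi>_def dist_form_def using fS by (intro continuous_intros) auto
        from openin_continuous_map_preimage[OF this, of "{..<\<epsilon>\<^sup>2}"]
        have "openin Y {t' \<in> topspace Y. \<phi> t' \<in> {..<\<epsilon>\<^sup>2}}" by simp
        moreover have "\<phi> t = 0" by (simp add: \<phi>_def dist_form_def)
        then have "t \<in> {t' \<in> topspace Y. \<phi> t' \<in> {..<\<epsilon>\<^sup>2}}" using t \<epsilon> top by simp
        moreover have "realize t' \<in> mball (realize t) \<epsilon>" if t': "t' \<in> {t' \<in> topspace Y. \<phi> t' \<in> {..<\<epsilon>\<^sup>2}}" for t'
        proof -
          have t'': "t' \<in> closed_simplex (label ` S)" using t' top S(2) by simp
          have "(d (realize t) (realize t'))\<^sup>2 < \<epsilon>\<^sup>2"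
            using realize_dist[OF S(1) _ t'', of t] t t' S(2) by (simp add: \<phi>_def)
          then have "d (realize t) (realize t') < \<epsilon>" using \<epsilon> by (simp add: power_less_imp_less_base)
          then show ?thesis using realize_in_M[OF S(1)] t t'' S(2) by simp
        qed
        ultimately show ?thesis by blast
      qed
      then show ?thesis unfolding continuous_map_to_metric Y_def[symmetric] top by blast
    qed
  qed simp
qed

text \<open>The vertices are numbered along the chain; \<open>V\<close> is the affine map sending the \<open>j\<close>-th vertex to the
  \<open>j\<close>-th Euclidean vector.\<close>
lemma realize_simplex_isometric:
  assumes \<sigma>: "\<sigma> \<in> cliques"
  shows "isometric_to_Euclidean_simplex (realize ` closed_simplex \<sigma>) d"
proof -
  obtain S where S: "clique S" "\<sigma> = label ` S" using \<sigma> by (auto simp: cliques_def)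
  define zs where "zs = vertex_list \<sigma>"
  have ch: "chain zs" using chain_vertex_list[OF S(1)] by (simp add: zs_def S(2))
  have set: "set zs = S" using S set_vertex_list by (simp add: zs_def clique_def)
  have dist: "distinct zs" by (rule chain_distinct[OF ch])
  have ne: "zs \<noteq> []" using ch by (simp add: chain_def)
  define k where "k = length zs - 1"
  have idx: "{..k} = {..<length zs}" using ne by (auto simp: k_def less_Suc_eq_le) (metis Suc_pred le_simps(2) length_greater_0_conv)
  have reidx: "(\<Sum>x\<in>S. F x) = (\<Sum>j\<le>k. F (zs ! j))" for F :: "'a \<Rightarrow> real"
    unfolding idx set[symmetric] using dist by (intro sum.reindex_bij_betw[symmetric] bij_betw_nth) auto
  have nth_S: "zs ! j \<in> S" if "j \<le> k" for j using that idx set by (metis atMost_iff lessThan_iff nth_mem)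
  have SM: "S \<subseteq> vertices" using S(1) by (simp add: clique_def)
  define D where "D i j = (d (zs ! i) (zs ! j))\<^sup>2" for i j
  have D0: "(if i \<le> k \<and> j \<le> k then D i j else 0) = (if j \<le> k \<and> i \<le> k then D j i else 0)" for i j
    by (simp add: D_def commute)
  define D' where "D' i j = (if i \<le> k \<and> j \<le> k then D i j else 0)" for i j
  have D'D: "(\<Sum>i\<le>k. \<Sum>j\<le>k. c i * c j * D' i j) = (\<Sum>i\<le>k. \<Sum>j\<le>k. c i * c j * D i j)" for c :: "nat \<Rightarrow> real"
    by (intro sum.cong) (auto simp: D'_def)
  have bilD: "dist_form S (\<lambda>x. c x) (\<lambda>x. c x) = (\<Sum>i\<le>k. \<Sum>j\<le>k. c (zs ! i) * c (zs ! j) * D i j)" for c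
    by (simp add: dist_form_def reidx D_def)
  obtain pos where pos: "\<And>j. j \<le> k \<Longrightarrow> pos (zs ! j) = j"
  proof
    show "inv_into {..k} ((!) zs) (zs ! j) = j" if "j \<le> k" for j
      using that dist idx by (intro inv_into_f_f) (auto simp: inj_on_nth)
  qed
  have pd: "0 < - (\<Sum>i\<le>k. \<Sum>j\<le>k. c i * c j * D' i j)" if c: "(\<Sum>i\<le>k. c i) = 0" "\<exists>i\<le>k. c i \<noteq> 0" for c :: "nat \<Rightarrow> real"
  proof -
    define c' where "c' x = c (pos x)" for x
    have e: "c' (zs ! j) = c j" if "j \<le> k" for j using pos[OF that] by (simp add: c'_def)
    obtain i where i: "i \<le> k" "c i \<noteq> 0" using c(2) by blast
    have "sum c' (set zs) = 0" unfolding set reidx using c(1) e by simp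
    then have "0 < - dist_form (set zs) c' c'"
      using dist_form_negative_definite[OF ch, of c' "zs ! i"] i e nth_S set by simp
    moreover have "dist_form S c' c' = (\<Sum>i\<le>k. \<Sum>j\<le>k. c i * c j * D i j)"
      using bilD[of c'] e by simp
    ultimately show ?thesis by (simp add: set D'D)
  qed
  have "\<exists>v :: nat \<Rightarrow> nat \<Rightarrow> real. (\<forall>j\<le>k. \<forall>m\<ge>k. v j m = 0) \<and>
    (\<forall>c. (\<Sum>i\<le>k. c i) = 0 \<longrightarrow>
      (\<Sum>m<k. (\<Sum>j\<le>k. c j * v j m)\<^sup>2) = - (\<Sum>i\<le>k. \<Sum>j\<le>k. c i * c j * D' i j) / 2)"
  proof (rule euclidean_realization[OF _ _ pd])
    show "D' i j = D' j i" for i j using D0[of i j] by (simp add: D'_def)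
    show "D' i i = 0" for i
      using nth_S[of i] SM vertex_in_M by (auto simp: D'_def D_def subset_iff)
  qed
  then obtain v :: "nat \<Rightarrow> nat \<Rightarrow> real" where v: "\<And>j m. j \<le> k \<Longrightarrow> k \<le> m \<Longrightarrow> v j m = 0"
    and vf: "\<And>c. (\<Sum>i\<le>k. c i) = 0 \<Longrightarrow>
      (\<Sum>m<k. (\<Sum>j\<le>k. c j * v j m)\<^sup>2) = - (\<Sum>i\<le>k. \<Sum>j\<le>k. c i * c j * D' i j) / 2" by blast
  define V where "V t m = (\<Sum>j\<le>k. v j m * t (label (zs ! j)))" for t :: "nat \<Rightarrow> real" and m
  have inj: "inj_on realize (closed_simplex \<sigma>)"
    using realize_inj[OF S(1) _ S(1)] S(2) by (auto simp: inj_on_def)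
  define f where "f p = V (inv_into (closed_simplex \<sigma>) realize p)" for p
  have f: "f (realize t) = V t" if "t \<in> closed_simplex \<sigma>" for t
    using inj that by (simp add: f_def)
  have injl: "inj_on label S" using label(1) SM by (rule inj_on_subset)
  have img: "V ` closed_simplex \<sigma> = oriented_simplex k v ` standard_simplex k"
  proof (intro equalityI subsetI)
    fix y assume "y \<in> V ` closed_simplex \<sigma>"
    then obtain t where t: "t \<in> closed_simplex \<sigma>" "y = V t" by blast
    define s where "s j = (if j \<le> k then t (label (zs ! j)) else 0)" for j
    have t0: "0 \<le> t i" for i using t(1) by (simp add: closed_simplex_def)
    have s1: "(\<Sum>j\<le>k. s j) = 1"
      using closed_simplex_weights(1)[OF S(1), of t] t(1) S(2) by (simp add: reidx s_def)
    have "s j \<le> 1" for j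
    proof (cases "j \<le> k")
      case True
      then have "s j \<le> (\<Sum>j\<le>k. s j)" using t0 by (intro member_le_sum) (auto simp: s_def)
      then show ?thesis using s1 by simp
    qed (simp add: s_def)
    then have "s \<in> standard_simplex k" using s1 t0 by (auto simp: standard_simplex_def s_def)
    moreover have "oriented_simplex k v s = y"
      using calculation by (auto simp: oriented_simplex_def t(2) V_def s_def fun_eq_iff intro!: sum.cong)
    ultimately show "y \<in> oriented_simplex k v ` standard_simplex k" by blast
  next
    fix y assume "y \<in> oriented_simplex k v ` standard_simplex k"
    then obtain s where s: "s \<in> standard_simplex k" "y = oriented_simplex k v s" by blast
    define t where "t i = (if i \<in> \<sigma> then s (pos (unlabel i)) else 0)" for i
    have e: "t (label (zs ! j)) = s j" if "j \<le> k" for j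
      using nth_S[OF that] SM unlabel_label pos[OF that] by (auto simp: t_def S(2))
    have "sum t \<sigma> = (\<Sum>j\<le>k. t (label (zs ! j)))"
      unfolding S(2) sum.reindex[OF injl] by (simp add: reidx)
    also have "\<dots> = 1" using e s(1) by (simp add: standard_simplex_def)
    finally have "t \<in> closed_simplex \<sigma>"
      using s(1) by (auto simp: closed_simplex_def t_def standard_simplex_def)
    moreover have "V t = y"
      using s e by (auto simp: V_def oriented_simplex_def fun_eq_iff intro!: sum.cong)
    ultimately show "y \<in> V ` closed_simplex \<sigma>" by blast
  qed
  show ?thesis
    unfolding isometric_to_Euclidean_simplex_def
  proof (intro exI conjI)
    show "\<forall>j\<le>k. v j \<in> topspace (Euclidean_space k)" using v by (simp add: topspace_Euclidean_space)
    show "affinely_independent k v"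
      unfolding affinely_independent_def
    proof (intro allI impI)
      fix c j assume c: "(\<Sum>j\<le>k. c j) = 0 \<and> (\<forall>i. (\<Sum>j\<le>k. c j * v j i) = 0)" and "j \<le> k"
      then show "c j = 0" using vf[of c] pd[of c] by force
    qed
    show "f ` realize ` closed_simplex \<sigma> = oriented_simplex k v ` standard_simplex k"
      unfolding img[symmetric] image_image using f by (rule image_cong[OF refl])
    show "\<forall>x\<in>realize ` closed_simplex \<sigma>. \<forall>y\<in>realize ` closed_simplex \<sigma>. L2_set (\<lambda>i. f x i - f y i) {..<k} = d x y"
    proof (intro ballI)
      fix x y assume "x \<in> realize ` closed_simplex \<sigma>" "y \<in> realize ` closed_simplex \<sigma>"
      then obtain t t' where t: "t \<in> closed_simplex \<sigma>" "x = realize t" and t': "t' \<in> closed_simplex \<sigma>" "y = realize t'"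
        by blast
      define c where "c j = t (label (zs ! j)) - t' (label (zs ! j))" for j
      have "(\<Sum>j\<le>k. c j) = 0"
        using closed_simplex_weights(1)[OF S(1)] t(1) t'(1) S(2) by (simp add: c_def sum_subtractf reidx)
      from vf[OF this] have "(\<Sum>m<k. (\<Sum>j\<le>k. c j * v j m)\<^sup>2) = (d x y)\<^sup>2"
        using realize_dist[OF S(1), of t t'] t t' S(2)
        unfolding D'D bilD[of "\<lambda>x. t (label x) - t' (label x)"] by (simp add: c_def)
      moreover have "f x m - f y m = (\<Sum>j\<le>k. c j * v j m)" for m
        using f t t' by (simp add: V_def c_def sum_subtractf[symmetric] algebra_simps)
      ultimately show "L2_set (\<lambda>i. f x i - f y i) {..<k} = d x y"
        by (simp add: L2_set_def)
    qed
  qed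
qed

end

theorem (in Metric_space) locally_conic_imp_triangulated:
  assumes comp: "compact_space mtopology" and conic: "\<And>p. p \<in> M \<Longrightarrow> \<exists>\<rho>. conic p \<rho>"
  shows "\<exists>K h. finite_simplicial_complex K \<and> homeomorphic_map (realization K) mtopology h \<and>
    (\<forall>\<sigma>\<in>K. isometric_to_Euclidean_simplex (h ` closed_simplex \<sigma>) d)"
proof -
  obtain L N R where T: "tower M d L N R" using tower_exists[OF assms] by blast
  obtain m where "L m = {}" using tower.tower_terminates[OF T assms] by blast
  then interpret finite_tower M d L N R m
    using T by (simp add: finite_tower_def finite_tower_axioms_def)
  show ?thesis
    using finite_simplicial_complex_cliques realize_homeomorphic realize_simplex_isometric by blast
qed

section \<open>From cones to conic balls\<close>

lemma cone_dist_tip: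
  assumes base: "cone_base \<Sigma> e" and a: "0 \<le> a" "s \<in> \<Sigma>"
  shows "cone_dist e (cone_tip \<Sigma>) (cone_rel \<Sigma> `` {(a, s)}) = a"
proof -
  have "cone_tip \<Sigma> = cone_rel \<Sigma> `` {(0, s)}" using a by (auto simp: cone_tip_def cone_rel_def)
  then show ?thesis using cone_dist_class[OF base _ a(1) a(2,2), of 0] a(1) by simp
qed

lemma cone_space_empty: "cone_space {} = {{}}"
  by (simp add: cone_space_def cone_tip_def)

context Metric_space
begin

text \<open>The image of the embedding contains a ball around the tip; the dilations of the cone restricted to
  this ball are pulled back.\<close>
lemma cone_embedding_imp_conic:
  assumes nb: "neighborhood_of M d x U" and base: "cone_base \<Sigma> e"
    and emb: "open_isometric_embedding U d (cone_space \<Sigma>) (cone_dist e) \<iota>"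
    and tip: "\<iota> x = cone_tip \<Sigma>"
  shows "\<exists>\<rho>. conic x \<rho>"
proof -
  obtain W where W: "U \<subseteq> M" "openin mtopology W" "x \<in> W" "W \<subseteq> U"
    using nb by (auto simp: neighborhood_of_def)
  then have xM: "x \<in> M" and xU: "x \<in> U" by auto
  interpret U: Metric_space U d using subspace[OF W(1)] .
  interpret C: Metric_space "cone_space \<Sigma>" "cone_dist e" by (rule Metric_space_cone[OF base])
  have iso: "cone_dist e (\<iota> u) (\<iota> v) = d u v" if "u \<in> U" "v \<in> U" for u v
    using emb that by (simp add: open_isometric_embedding_def)
  have im: "\<iota> u \<in> cone_space \<Sigma>" if "u \<in> U" for u
    using emb that by (auto simp: open_isometric_embedding_def)
  have inj: "u = v" if "u \<in> U" "v \<in> U" "\<iota> u = \<iota> v" for u v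
    using iso[OF that(1,2)] C.mdist_zero[OF im[OF that(2)]] that by simp
  obtain r1 where r1: "0 < r1" "mball x r1 \<subseteq> U"
    using W unfolding openin_mtopology by (meson order_trans)
  have "openin C.mtopology (\<iota> ` U)"
    using emb openin_topspace[of U.mtopology] by (auto simp: open_isometric_embedding_def open_map_def)
  moreover have "cone_tip \<Sigma> \<in> \<iota> ` U" using tip xU by force
  ultimately obtain r2 where r2: "0 < r2" "C.mball (cone_tip \<Sigma>) r2 \<subseteq> \<iota> ` U"
    unfolding C.openin_mtopology by blast
  define \<rho> where "\<rho> = min r1 r2"
  have \<rho>: "0 < \<rho>" using r1 r2 by (simp add: \<rho>_def)
  have ballU: "p \<in> U" if "p \<in> mball x \<rho>" for p using that r1(2) by (auto simp: \<rho>_def)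
  show ?thesis
  proof (cases "\<Sigma> = {}")
    case True
    then have px: "p = x" if "p \<in> mball x \<rho>" for p
      using inj[OF ballU[OF that] xU] im[OF ballU[OF that]] im[OF xU] by (simp add: cone_space_empty)
    have "conic x \<rho>"
    proof (rule conicI[where h = "\<lambda>t p. p"])
      fix p q :: 'a and s t :: real
      assume "p \<in> mball x \<rho>" "q \<in> mball x \<rho>"
      then have "p = x" "q = x" using px by blast+
      then show "(d p q)\<^sup>2 = s\<^sup>2 * (d x p)\<^sup>2 + t\<^sup>2 * (d x q)\<^sup>2 - s * t * ((d x p)\<^sup>2 + (d x q)\<^sup>2 - (d p q)\<^sup>2)"
        using xM by simp
    qed (use xM \<rho> in auto)
    then show ?thesis by blast
  next
    case False
    define Q where "Q a s = cone_rel \<Sigma> `` {(a, s)}" for a :: real and s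
    have "\<exists>a s. 0 \<le> a \<and> s \<in> \<Sigma> \<and> \<iota> p = Q a s" if "p \<in> U" for p
      using cone_space_cases[OF im[OF that] False] unfolding Q_def by metis
    then obtain A S where AS: "\<And>p. p \<in> U \<Longrightarrow> 0 \<le> A p" "\<And>p. p \<in> U \<Longrightarrow> S p \<in> \<Sigma>"
      "\<And>p. p \<in> U \<Longrightarrow> \<iota> p = Q (A p) (S p)" by metis
    have dA: "d x p = A p" if "p \<in> U" for p
      using iso[OF xU that] cone_dist_tip[OF base AS(1,2)] that tip AS(3) by (simp add: Q_def)
    have dQ: "(cone_dist e (Q a s) (Q b t))\<^sup>2 = a\<^sup>2 + b\<^sup>2 - 2 * a * b * cos (e s t)"
      if "0 \<le> a" "0 \<le> b" "s \<in> \<Sigma>" "t \<in> \<Sigma>" for a b s t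
    proof -
      interpret S: Metric_space \<Sigma> e using base by (simp add: cone_base_def)
      have "e s t \<le> pi" using base that by (simp add: cone_base_def)
      then show ?thesis
        using cone_dist_class[OF base that] cone_pair_dist_eq_0(1)[OF that(1,2) S.nonneg] by (simp add: Q_def)
    qed
    have ex: "\<exists>y. y \<in> U \<and> \<iota> y = Q (t * A p) (S p)" if p: "p \<in> U" and t: "0 \<le> t" "t * A p < \<rho>" for t p
    proof -
      have "Q (t * A p) (S p) \<in> C.mball (cone_tip \<Sigma>) r2"
        using cone_dist_tip[OF base _ AS(2)[OF p], of "t * A p"] AS(1,2)[OF p] t
          cone_class_in(1)[OF _ AS(2)[OF p], of "t * A p"] im[OF xU] tip
        by (simp add: Q_def \<rho>_def)
      then show ?thesis using r2(2) by force
    qed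
    define h where "h t p = (SOME y. y \<in> U \<and> \<iota> y = Q (t * A p) (S p))" for t p
    have h: "h t p \<in> U" "\<iota> (h t p) = Q (t * A p) (S p)"
      if "p \<in> U" "0 \<le> t" "t * d x p < \<rho>" for t p
      using someI_ex[OF ex[OF that(1,2)]] that dA[OF that(1)] by (simp_all add: h_def)
    have "conic x \<rho>"
    proof (rule conicI[where h = h, OF xM \<rho>])
      show "h t p \<in> M" if "p \<in> mball x \<rho>" "0 \<le> t" "t * d x p < \<rho>" for p t
        using h(1)[OF ballU[OF that(1)] that(2,3)] W(1) by blast
      show "h 1 p = p" if p: "p \<in> mball x \<rho>" for p
      proof -
        have "1 * d x p < \<rho>" using p by simp
        then show ?thesis
          using h[OF ballU[OF p], of 1] inj[OF _ ballU[OF p]] AS(3)[OF ballU[OF p]] by simp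
      qed
      fix p q s t assume p: "p \<in> mball x \<rho>" and q: "q \<in> mball x \<rho>"
        and st: "0 \<le> (s::real)" "0 \<le> (t::real)" "s * d x p < \<rho>" "t * d x q < \<rho>"
      note pU = ballU[OF p] and qU = ballU[OF q]
      have 1: "(d (h s p) (h t q))\<^sup>2
          = (s * A p)\<^sup>2 + (t * A q)\<^sup>2 - 2 * (s * A p) * (t * A q) * cos (e (S p) (S q))"
        unfolding iso[OF h(1)[OF pU st(1,3)] h(1)[OF qU st(2,4)], symmetric] h(2)[OF pU st(1,3)] h(2)[OF qU st(2,4)]
        using AS(1,2)[OF pU] AS(1,2)[OF qU] st by (intro dQ) auto
      have 2: "(d p q)\<^sup>2 = (A p)\<^sup>2 + (A q)\<^sup>2 - 2 * A p * A q * cos (e (S p) (S q))"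
        unfolding iso[OF pU qU, symmetric] AS(3)[OF pU] AS(3)[OF qU]
        using AS(1,2)[OF pU] AS(1,2)[OF qU] by (intro dQ) auto
      show "(d (h s p) (h t q))\<^sup>2 = s\<^sup>2 * (d x p)\<^sup>2 + t\<^sup>2 * (d x q)\<^sup>2
          - s * t * ((d x p)\<^sup>2 + (d x q)\<^sup>2 - (d p q)\<^sup>2)"
        unfolding 1 2 dA[OF pU] dA[OF qU] by (simp add: power2_eq_square algebra_simps)
    qed
    then show ?thesis by blast
  qed
qed

end

section \<open>Euclidean simplices are conic at each point\<close>

text \<open>Affine independence says that the right-hand side does not vanish on the compact set of weights
  with sum 0 and \<open>l\<^sup>1\<close>-norm 1, so it has a positive minimum there.\<close>
lemma affinely_independent_coordinate_bound:
  fixes v :: "nat \<Rightarrow> nat \<Rightarrow> real"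
  assumes v: "\<And>j. j \<le> k \<Longrightarrow> v j \<in> topspace (Euclidean_space n)" and ai: "affinely_independent k v"
  shows "\<exists>\<mu>>0. \<forall>c. (\<Sum>j\<le>k. c j) = 0 \<longrightarrow>
    \<mu> * (\<Sum>j\<le>k. \<bar>c j\<bar>) \<le> L2_set (\<lambda>m. \<Sum>j\<le>k. c j * v j m) {..<n}"
proof -
  define Z where "Z = {c :: nat \<Rightarrow> real. (\<forall>j. j > k \<longrightarrow> c j = 0) \<and> (\<Sum>j\<le>k. c j) = 0 \<and> (\<Sum>j\<le>k. \<bar>c j\<bar>) = 1}"
  define F where "F c = L2_set (\<lambda>m. \<Sum>j\<le>k. c j * v j m) {..<n}" for c
  have coord: "continuous_on UNIV (\<lambda>c :: nat \<Rightarrow> real. c j)" for j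
    by (rule continuous_on_product_coordinates)
  have "Z = (\<Inter>j\<in>{k<..}. {c. c j = 0}) \<inter> {c. (\<Sum>j\<le>k. c j) = 0} \<inter> {c. (\<Sum>j\<le>k. \<bar>c j\<bar>) = 1}"
    by (auto simp: Z_def)
  moreover have "closed {c :: nat \<Rightarrow> real. c j = 0}" for j
    by (intro closed_Collect_eq continuous_intros coord)
  moreover have "closed {c :: nat \<Rightarrow> real. (\<Sum>j\<le>k. c j) = 0}" "closed {c :: nat \<Rightarrow> real. (\<Sum>j\<le>k. \<bar>c j\<bar>) = 1}"
    by (intro closed_Collect_eq continuous_intros coord)+
  ultimately have "closed Z" by (simp only:) (intro closed_Int closed_INT ballI)
  moreover have "compactin (powertop_real UNIV) (PiE UNIV (\<lambda>_. {-1..1}))"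
    unfolding compactin_PiE by simp
  then have "compact (PiE UNIV (\<lambda>_ :: nat. {-1..1 :: real}))" by (simp add: euclidean_product_topology)
  moreover have "Z \<subseteq> PiE UNIV (\<lambda>_. {-1..1})"
  proof
    fix c assume c: "c \<in> Z"
    have "\<bar>c j\<bar> \<le> 1" for j
    proof (cases "j \<le> k")
      case True
      then have "\<bar>c j\<bar> \<le> (\<Sum>j\<le>k. \<bar>c j\<bar>)" by (intro member_le_sum) auto
      then show ?thesis using c by (simp add: Z_def)
    qed (use c in \<open>simp add: Z_def\<close>)
    then show "c \<in> PiE UNIV (\<lambda>_. {-1..1})" by (auto simp: abs_le_iff minus_le_iff)
  qed
  ultimately have "compact Z" using compact_Int_closed[of "PiE UNIV (\<lambda>_. {-1..1})" Z] by (simp add: Int_absorb1)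
  have pos: "0 < F c" if "c \<in> Z" for c
  proof (rule ccontr)
    assume "\<not> 0 < F c"
    then have "F c = 0" by (simp add: F_def less_le)
    then have 0: "(\<Sum>j\<le>k. c j * v j m) = 0" if "m < n" for m
      using that by (simp add: F_def L2_set_eq_0_iff)
    have "(\<Sum>j\<le>k. c j * v j m) = 0" for m
    proof (cases "m < n")
      case False
      then show ?thesis using v by (intro sum.neutral) (auto simp: topspace_Euclidean_space)
    qed (use 0 in simp)
    then have "\<forall>j\<le>k. c j = 0" using ai that unfolding affinely_independent_def Z_def by blast
    then show False using that by (simp add: Z_def)
  qed
  have "\<exists>\<mu>>0. \<forall>c\<in>Z. \<mu> \<le> F c"
  proof (cases "Z = {}")
    case False
    have "continuous_on UNIV F" unfolding F_def L2_set_def by (intro continuous_intros coord)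
    then have "continuous_on Z F" by (rule continuous_on_subset) simp
    from continuous_attains_inf[OF \<open>compact Z\<close> False this] show ?thesis using pos by blast
  qed (auto intro: exI[of _ 1])
  then obtain \<mu> where \<mu>: "0 < \<mu>" "\<And>c. c \<in> Z \<Longrightarrow> \<mu> \<le> F c" by blast
  have "\<mu> * (\<Sum>j\<le>k. \<bar>c j\<bar>) \<le> F c" if c: "(\<Sum>j\<le>k. c j) = 0" for c
  proof (cases "(\<Sum>j\<le>k. \<bar>c j\<bar>) = 0")
    case True
    then show ?thesis by (simp add: F_def)
  next
    case False
    define s where "s = (\<Sum>j\<le>k. \<bar>c j\<bar>)"
    have "0 \<le> s" unfolding s_def by (intro sum_nonneg) auto
    then have s: "0 < s" using False unfolding s_def[symmetric] by simp
    define e where "e j = (if j \<le> k then c j / s else 0)" for j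
    have "e \<in> Z"
      using c s by (simp add: Z_def e_def sum_divide_distrib[symmetric] abs_divide s_def[symmetric])
    moreover have "F e = F c / s"
    proof -
      have "(\<Sum>j\<le>k. e j * v j m) = (1 / s) * (\<Sum>j\<le>k. c j * v j m)" for m
        unfolding sum_distrib_left by (intro sum.cong) (auto simp: e_def)
      then have "F e = L2_set (\<lambda>m. (1 / s) * (\<Sum>j\<le>k. c j * v j m)) {..<n}" by (simp only: F_def)
      also have "\<dots> = (1 / s) * F c"
        unfolding F_def by (rule L2_set_right_distrib[symmetric]) (use s in simp)
      finally show ?thesis by simp
    qed
    ultimately have "\<mu> \<le> F c / s" using \<mu>(2) by metis
    then show ?thesis using s by (simp add: s_def[symmetric] le_divide_eq)
  qed
  then show ?thesis using \<mu>(1) unfolding F_def by blast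
qed

lemma sum_squares_law:
  fixes P Q :: "'b \<Rightarrow> real"
  shows "(\<Sum>m\<in>A. (s * P m - t * Q m)\<^sup>2) = s\<^sup>2 * (\<Sum>m\<in>A. (P m)\<^sup>2) + t\<^sup>2 * (\<Sum>m\<in>A. (Q m)\<^sup>2)
    - s * t * ((\<Sum>m\<in>A. (P m)\<^sup>2) + (\<Sum>m\<in>A. (Q m)\<^sup>2) - (\<Sum>m\<in>A. (P m - Q m)\<^sup>2))"
proof -
  have e: "(\<Sum>m\<in>A. (s * P m - t * Q m)\<^sup>2)
    = s\<^sup>2 * (\<Sum>m\<in>A. (P m)\<^sup>2) + t\<^sup>2 * (\<Sum>m\<in>A. (Q m)\<^sup>2) - 2 * s * t * (\<Sum>m\<in>A. P m * Q m)" for s t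
  proof -
    have "(\<Sum>m\<in>A. (s * P m - t * Q m)\<^sup>2)
        = (\<Sum>m\<in>A. s\<^sup>2 * (P m)\<^sup>2 + t\<^sup>2 * (Q m)\<^sup>2 - 2 * s * t * (P m * Q m))"
      by (intro sum.cong refl) (simp add: power2_eq_square algebra_simps)
    then show ?thesis by (simp add: sum.distrib sum_subtractf sum_distrib_left)
  qed
  have k: "(\<Sum>m\<in>A. (P m)\<^sup>2) + (\<Sum>m\<in>A. (Q m)\<^sup>2) - (\<Sum>m\<in>A. (P m - Q m)\<^sup>2) = 2 * (\<Sum>m\<in>A. P m * Q m)"
    using e[of 1 1] by simp
  show ?thesis unfolding k e by simp
qed

text \<open>A point of the simplex stays in it as long as its barycentric coordinates stay nonnegative.
  Coordinates vanishing at \<open>x\<close> only grow along the ray from \<open>x\<close>, the others change little near \<open>x\<close>.\<close>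
lemma Euclidean_simplex_conic:
  assumes S: "Metric_space S d" and iso: "isometric_to_Euclidean_simplex S d" and x: "x \<in> S"
  shows "\<exists>r. Metric_space.conic S d x r"
proof -
  interpret Metric_space S d by (rule S)
  obtain n k v f where v: "\<And>j. j \<le> k \<Longrightarrow> v j \<in> topspace (Euclidean_space n)" and ai: "affinely_independent k v"
    and im: "f ` S = oriented_simplex k v ` standard_simplex k"
    and fd: "\<And>y z. y \<in> S \<Longrightarrow> z \<in> S \<Longrightarrow> L2_set (\<lambda>i. f y i - f z i) {..<n} = d y z"
    using iso unfolding isometric_to_Euclidean_simplex_def by metis
  obtain \<mu> where \<mu>: "0 < \<mu>" "\<And>c. (\<Sum>j\<le>k. c j) = 0 \<Longrightarrow>
      \<mu> * (\<Sum>j\<le>k. \<bar>c j\<bar>) \<le> L2_set (\<lambda>m. \<Sum>j\<le>k. c j * v j m) {..<n}"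
    using affinely_independent_coordinate_bound[OF v ai] by blast
  have "\<exists>t. t \<in> standard_simplex k \<and> f y = (\<lambda>m. \<Sum>j\<le>k. v j m * t j)" if "y \<in> S" for y
  proof -
    have "f y \<in> oriented_simplex k v ` standard_simplex k" using im that by blast
    then show ?thesis by (auto simp: oriented_simplex_def)
  qed
  then obtain b where b: "\<And>y. y \<in> S \<Longrightarrow> b y \<in> standard_simplex k"
    "\<And>y m. y \<in> S \<Longrightarrow> f y m = (\<Sum>j\<le>k. v j m * b y j)" by metis
  define B where "B = b x"
  have B: "B \<in> standard_simplex k" using b(1) x by (simp add: B_def)
  define J where "J = {j. j \<le> k \<and> 0 < B j}"
  have "J \<noteq> {}"
  proof
    assume "J = {}"
    then have "\<forall>j\<le>k. B j = 0" using B by (auto simp: J_def standard_simplex_def less_le)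
    then show False using B by (simp add: standard_simplex_def)
  qed
  have finJ: "finite J" by (rule finite_subset[of _ "{..k}"]) (auto simp: J_def)
  define r where "r = \<mu> * Min (B ` J)"
  have "0 < Min (B ` J)" using finJ \<open>J \<noteq> {}\<close> by (auto simp: J_def)
  then have r: "0 < r" using \<mu>(1) by (simp add: r_def)
  have ex: "\<exists>w. w \<in> S \<and> (\<forall>m. f w m = f x m + t * (f y m - f x m))"
    if y: "y \<in> S" and t: "0 \<le> t" "t * d x y < r" for y t
  proof -
    define c where "c j = b y j - B j" for j
    have bY: "b y \<in> standard_simplex k" using b(1)[OF y] .
    have c0: "(\<Sum>j\<le>k. c j) = 0" using B bY by (simp add: c_def sum_subtractf standard_simplex_def)
    have fc: "f y m - f x m = (\<Sum>j\<le>k. c j * v j m)" for m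
      using b(2)[OF y] b(2)[OF x] by (simp add: c_def B_def sum_subtractf[symmetric] algebra_simps)
    have "\<mu> * (\<Sum>j\<le>k. \<bar>c j\<bar>) \<le> d x y"
      using \<mu>(2)[OF c0] fd[OF y x] commute by (simp add: fc)
    then have "t * (\<mu> * (\<Sum>j\<le>k. \<bar>c j\<bar>)) \<le> t * d x y" using t(1) by (rule mult_left_mono)
    then have bound: "\<mu> * (t * (\<Sum>j\<le>k. \<bar>c j\<bar>)) < r" using t(2) by (simp add: mult.left_commute)
    then have bound: "t * (\<Sum>j\<le>k. \<bar>c j\<bar>) < Min (B ` J)"
      unfolding r_def using \<mu>(1) by simp
    define e where "e j = B j + t * c j" for j
    have e1: "(\<Sum>j\<le>k. e j) = 1"
      using B c0 by (simp add: e_def sum.distrib sum_distrib_left[symmetric] standard_simplex_def)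
    have e0: "0 \<le> e j" for j
    proof (cases "j \<in> J")
      case True
      then have "\<bar>c j\<bar> \<le> (\<Sum>j\<le>k. \<bar>c j\<bar>)" by (intro member_le_sum) (auto simp: J_def)
      then have "t * \<bar>c j\<bar> \<le> t * (\<Sum>j\<le>k. \<bar>c j\<bar>)" using t(1) by (rule mult_left_mono)
      also have "\<dots> < Min (B ` J)" by (rule bound)
      also have "\<dots> \<le> B j" using True finJ by simp
      finally have "\<bar>t * c j\<bar> < B j" using t(1) by (simp add: abs_mult)
      then show ?thesis by (simp add: e_def)
    next
      case False
      then have "B j = 0" using B by (cases "j \<le> k") (auto simp: J_def standard_simplex_def less_le)
      moreover have "0 \<le> b y j" using bY by (simp add: standard_simplex_def)
      ultimately show ?thesis using t(1) by (simp add: e_def c_def)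
    qed
    have "e j \<le> 1" for j
    proof (cases "j \<le> k")
      case True
      then have "e j \<le> (\<Sum>j\<le>k. e j)" using e0 by (intro member_le_sum) auto
      then show ?thesis using e1 by simp
    next
      case False
      then show ?thesis using B bY by (simp add: e_def c_def standard_simplex_def)
    qed
    then have "e \<in> standard_simplex k"
      using e0 e1 B bY by (auto simp: standard_simplex_def e_def c_def)
    then obtain w where w: "w \<in> S" "f w = oriented_simplex k v e" using im by (metis imageE imageI)
    have "f w m = f x m + t * (f y m - f x m)" for m
      unfolding w(2) fc using \<open>e \<in> standard_simplex k\<close> b(2)[OF x]
      by (simp add: oriented_simplex_def e_def B_def sum_distrib_left sum.distrib[symmetric] algebra_simps)
    then show ?thesis using w(1) by blast
  qed
  define h where "h t y = (SOME w. w \<in> S \<and> (\<forall>m. f w m = f x m + t * (f y m - f x m)))" for t y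
  have h: "h t y \<in> S" "\<And>m. f (h t y) m = f x m + t * (f y m - f x m)"
    if "y \<in> S" "0 \<le> t" "t * d x y < r" for t y
    using someI_ex[OF ex[OF that]] by (simp_all add: h_def)
  have sq: "(d y z)\<^sup>2 = (\<Sum>m<n. (f y m - f z m)\<^sup>2)" if "y \<in> S" "z \<in> S" for y z
    unfolding fd[OF that, symmetric] L2_set_def by (simp add: sum_nonneg)
  have "conic x r"
  proof (rule conicI[where h = h, OF x r])
    show "h t y \<in> S" if "y \<in> mball x r" "0 \<le> t" "t * d x y < r" for y t
      using h(1) that by simp
    show "h 1 y = y" if y: "y \<in> mball x r" for y
    proof -
      have yS: "y \<in> S" "1 * d x y < r" using y by auto
      have "(d (h 1 y) y)\<^sup>2 = 0"
        using h[OF yS(1) _ yS(2)] yS by (simp add: sq)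
      then show ?thesis using h(1)[OF yS(1) _ yS(2)] yS by simp
    qed
    fix p q s t assume p: "p \<in> mball x r" and q: "q \<in> mball x r"
      and st: "0 \<le> (s::real)" "0 \<le> (t::real)" "s * d x p < r" "t * d x q < r"
    have S: "p \<in> S" "q \<in> S" using p q by auto
    note hp = h[OF S(1) st(1,3)] and hq = h[OF S(2) st(2,4)]
    show "(d (h s p) (h t q))\<^sup>2 = s\<^sup>2 * (d x p)\<^sup>2 + t\<^sup>2 * (d x q)\<^sup>2
        - s * t * ((d x p)\<^sup>2 + (d x q)\<^sup>2 - (d p q)\<^sup>2)"
    proof -
      have e: "(\<Sum>m<n. (f (h s p) m - f (h t q) m)\<^sup>2)
          = (\<Sum>m<n. (s * (f p m - f x m) - t * (f q m - f x m))\<^sup>2)"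
        by (simp only: hp(2) hq(2) add_diff_cancel_left)
      have 1: "(d x p)\<^sup>2 = (\<Sum>m<n. (f p m - f x m)\<^sup>2)" "(d x q)\<^sup>2 = (\<Sum>m<n. (f q m - f x m)\<^sup>2)"
        using sq[OF S(1) x] sq[OF S(2) x] commute by simp_all
      have 2: "(d p q)\<^sup>2 = (\<Sum>m<n. ((f p m - f x m) - (f q m - f x m))\<^sup>2)"
        by (simp add: sq[OF S])
      show ?thesis unfolding sq[OF hp(1) hq(1)] e 1 2 by (rule sum_squares_law)
    qed
  qed
  then show ?thesis by blast
qed

section \<open>Chords of a plane fan\<close>

text \<open>The third side of a Euclidean triangle with sides \<open>a\<close>, \<open>b\<close> enclosing the angle \<open>t\<close>.\<close>
definition cone_chord :: "real \<Rightarrow> real \<Rightarrow> real \<Rightarrow> real" where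
  "cone_chord a b t = sqrt (a\<^sup>2 + b\<^sup>2 - 2 * a * b * cos t)"

lemma cone_chord_sq: "0 \<le> a \<Longrightarrow> 0 \<le> b \<Longrightarrow> (cone_chord a b t)\<^sup>2 = a\<^sup>2 + b\<^sup>2 - 2 * a * b * cos t"
proof -
  assume ab: "0 \<le> a" "0 \<le> b"
  have "a\<^sup>2 + b\<^sup>2 - 2 * a * b * cos t = (a - b)\<^sup>2 + 2 * (a * b) * (1 - cos t)"
    by (simp add: power2_eq_square algebra_simps)
  also have "\<dots> \<ge> 0" using ab by (intro add_nonneg_nonneg mult_nonneg_nonneg) auto
  finally show ?thesis by (simp add: cone_chord_def)
qed

lemma cone_chord_nonneg: "0 \<le> a \<Longrightarrow> 0 \<le> b \<Longrightarrow> 0 \<le> cone_chord a b t"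
proof -
  assume ab: "0 \<le> a" "0 \<le> b"
  have "0 \<le> a\<^sup>2 + b\<^sup>2 - 2 * a * b * cos t" unfolding cone_chord_sq[OF ab, symmetric] by simp
  then show ?thesis by (simp add: cone_chord_def)
qed

lemma cone_chord_0_left: "0 \<le> b \<Longrightarrow> cone_chord 0 b t = b"
  and cone_chord_0_right: "0 \<le> a \<Longrightarrow> cone_chord a 0 t = a"
  by (auto simp: cone_chord_def)

lemma cone_chord_zero_angle: "cone_chord a b 0 = \<bar>a - b\<bar>"
proof -
  have "a\<^sup>2 + b\<^sup>2 - 2 * a * b = (a - b)\<^sup>2" by (simp add: power2_eq_square algebra_simps)
  then show ?thesis by (simp add: cone_chord_def)
qed

lemma cone_chord_mono:
  assumes "0 \<le> a" "0 \<le> b" "0 \<le> s" "s \<le> t" "t \<le> pi"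
  shows "cone_chord a b s \<le> cone_chord a b t"
proof -
  have "cos t \<le> cos s" using assms by (intro cos_monotone_0_pi_le) auto
  then have "2 * a * b * cos t \<le> 2 * a * b * cos s" using assms by (intro mult_left_mono) auto
  then show ?thesis by (simp add: cone_chord_def)
qed

lemma cone_chord_pi: "0 \<le> a \<Longrightarrow> 0 \<le> b \<Longrightarrow> cone_chord a b pi = a + b"
proof -
  assume ab: "0 \<le> a" "0 \<le> b"
  have "a\<^sup>2 + b\<^sup>2 - 2 * a * b * cos pi = (a + b)\<^sup>2" by (simp add: power2_eq_square algebra_simps)
  then show ?thesis using ab by (simp add: cone_chord_def)
qed

text \<open>Two adjacent triangles with angles \<open>\<alpha>\<close> and \<open>\<beta>\<close> in the plane: as \<open>\<alpha> + \<beta> < \<pi>\<close>, the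
  segment joining the outer corners meets the common side at distance \<open>c\<close> from the apex.\<close>
lemma cone_chord_crossing:
  assumes ab: "0 \<le> a" "0 \<le> b" and ang: "0 \<le> \<alpha>" "0 \<le> \<beta>" "\<alpha> + \<beta> < pi"
  shows "\<exists>c\<ge>0. c \<le> max a b \<and> cone_chord a c \<alpha> + cone_chord c b \<beta> = cone_chord a b (\<alpha> + \<beta>)"
proof -
  consider "a = 0 \<or> b = 0" | "\<alpha> = 0" "\<beta> = 0" | "0 < a" "0 < b" "0 < \<alpha> \<or> 0 < \<beta>" using assms by linarith
  then show ?thesis
  proof cases
    case 1
    then show ?thesis using ab by (intro exI[of _ 0]) (auto simp: cone_chord_0_left cone_chord_0_right)
  next
    case 2
    then show ?thesis using ab by (intro exI[of _ a]) (simp add: cone_chord_zero_angle)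
  next
    case 3
    have sn: "0 \<le> sin \<alpha>" "0 \<le> sin \<beta>" using ang by (auto intro!: sin_ge_zero)
    have "0 < sin \<alpha> \<or> 0 < sin \<beta>" using 3(3) ang by (auto intro: sin_gt_zero)
    define D where "D = a * sin \<alpha> + b * sin \<beta>"
    have D: "0 < D" using 3 sn \<open>0 < sin \<alpha> \<or> 0 < sin \<beta>\<close>
      by (auto simp: D_def intro: add_pos_nonneg add_nonneg_pos)
    \<comment> \<open>The position of the crossing point on the segment, found by comparing areas.\<close>
    define \<tau> where "\<tau> = a * sin \<alpha> / D"
    define c where "c = a * b * sin (\<alpha> + \<beta>) / D"
    have \<tau>: "0 \<le> \<tau>" "\<tau> \<le> 1" using D 3 sn by (auto simp: \<tau>_def D_def)
    have \<tau>': "1 - \<tau> = b * sin \<beta> / D" using D by (simp add: \<tau>_def D_def field_simps)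
    have "0 \<le> sin (\<alpha> + \<beta>)" using ang by (intro sin_ge_zero) auto
    then have c: "0 \<le> c" using D 3 by (simp add: c_def)
    define P Q W where "P = of_real a * cis 0" and "Q = of_real b * cis (\<alpha> + \<beta>)" and "W = of_real c * cis \<alpha>"
    have W: "W = (1 - \<tau>) *\<^sub>R P + \<tau> *\<^sub>R Q"
    proof -
      have c1: "D * (c * cos \<alpha>) = b * sin \<beta> * a + a * sin \<alpha> * (b * cos (\<alpha> + \<beta>))"
      proof -
        have "D * (c * cos \<alpha>) = a * b * (sin (\<alpha> + \<beta>) * cos \<alpha>)" using D by (simp add: c_def)
        also have "sin (\<alpha> + \<beta>) * cos \<alpha> = sin \<beta> + sin \<alpha> * cos (\<alpha> + \<beta>)"
          using sin_diff[of "\<alpha> + \<beta>" \<alpha>] by (simp add: algebra_simps)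
        finally show ?thesis by (simp add: algebra_simps)
      qed
      have c2: "D * (c * sin \<alpha>) = a * sin \<alpha> * (b * sin (\<alpha> + \<beta>))" using D by (simp add: c_def)
      have "c * cos \<alpha> = (1 - \<tau>) * a + \<tau> * (b * cos (\<alpha> + \<beta>))"
        unfolding \<tau>' unfolding \<tau>_def using c1 D by (simp add: field_simps)
      moreover have "c * sin \<alpha> = \<tau> * (b * sin (\<alpha> + \<beta>))"
        unfolding \<tau>_def using c2 D by (simp add: field_simps)
      ultimately show ?thesis by (simp add: W_def P_def Q_def complex_eq_iff)
    qed
    have "P - W = \<tau> *\<^sub>R (P - Q)" "W - Q = (1 - \<tau>) *\<^sub>R (P - Q)"
      unfolding W by (simp_all add: algebra_simps)
    then have "norm (P - W) + norm (W - Q) = \<tau> * norm (P - Q) + (1 - \<tau>) * norm (P - Q)"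
      using \<tau> by simp
    also have "\<dots> = norm (P - Q)" by (simp add: algebra_simps)
    finally have "cone_chord a c \<alpha> + cone_chord c b \<beta> = cone_chord a b (\<alpha> + \<beta>)"
      unfolding P_def Q_def W_def norm_cis_diff cone_chord_def by (simp add: cos_diff cos_add algebra_simps)
    moreover have "c \<le> max a b"
    proof -
      have "c = norm W" using c by (simp add: W_def norm_mult)
      also have "\<dots> \<le> norm ((1 - \<tau>) *\<^sub>R P) + norm (\<tau> *\<^sub>R Q)" unfolding W by (rule norm_triangle_ineq)
      also have "\<dots> = (1 - \<tau>) * a + \<tau> * b" using \<tau> 3 by (simp add: P_def Q_def norm_mult)
      also have "\<dots> \<le> (1 - \<tau>) * max a b + \<tau> * max a b" using \<tau> by (intro add_mono mult_left_mono) auto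
      finally show ?thesis by (simp add: algebra_simps)
    qed
    ultimately show ?thesis using c by blast
  qed
qed

text \<open>Stay with one set until the last time it is met. From then on the other sets cover, also at that
  time because they are closed, so each set is used at most once.\<close>
lemma closed_cover_chain:
  fixes a b :: real
  assumes "finite \<T>" "\<And>T. T \<in> \<T> \<Longrightarrow> closed T" "a \<le> b" "{a..b} \<subseteq> \<Union>\<T>"
  shows "\<exists>n t. t 0 = a \<and> t n = b \<and> mono_on {..n} t \<and> t ` {..n} \<subseteq> {a..b} \<and>
    (\<forall>i<n. \<exists>T\<in>\<T>. t i \<in> T \<and> t (Suc i) \<in> T)"
  using assms
proof (induction "card \<T>" arbitrary: \<T> a rule: less_induct)
  case less
  have "a \<in> {a..b}" using less.prems(3) by simp
  then have "a \<in> \<Union>\<T>" using less.prems(4) by blast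
  then obtain T where T: "T \<in> \<T>" "a \<in> T" by blast
  have cT: "compact (T \<inter> {a..b})" by (rule closed_Int_compact[OF less.prems(2)[OF T(1)] compact_Icc])
  have neT: "T \<inter> {a..b} \<noteq> {}" using T(2) less.prems(3) by auto
  from compact_attains_sup[OF cT neT]
  obtain s where s: "s \<in> T \<inter> {a..b}" "\<And>u. u \<in> T \<inter> {a..b} \<Longrightarrow> u \<le> s" by blast
  show ?case
  proof (cases "s = b")
    case True
    have "mono_on {..1::nat} (\<lambda>i. if i = 0 then a else b)"
      using less.prems(3) by (auto simp: mono_on_def)
    then show ?thesis
      using T s True less.prems(3)
      by (intro exI[of _ 1] exI[of _ "\<lambda>i. if i = 0 then a else b"]) auto
  next
    case False
    then have sb: "s < b" using s(1) by simp
    define \<T>' where "\<T>' = \<T> - {T}"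
    have "closed (\<Union>\<T>')" using less.prems(1,2) by (intro closed_Union) (auto simp: \<T>'_def)
    have sub: "{s<..b} \<subseteq> \<Union>\<T>'"
    proof
      fix u assume u: "u \<in> {s<..b}"
      then have "u \<in> {a..b}" using s(1) by auto
      then obtain T' where T': "T' \<in> \<T>" "u \<in> T'" using less.prems(4) by blast
      have "u \<notin> T" using s(2)[of u] u s(1) by auto
      then show "u \<in> \<Union>\<T>'" using T' by (auto simp: \<T>'_def)
    qed
    have "closure {s<..b} \<subseteq> \<Union>\<T>'" using sub \<open>closed (\<Union>\<T>')\<close> by (rule closure_minimal)
    then have cov: "{s..b} \<subseteq> \<Union>\<T>'" using sb by simp
    have "card \<T>' < card \<T>" unfolding \<T>'_def by (rule card_Diff1_less[OF less.prems(1) T(1)])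
    then have "\<exists>n t. t 0 = s \<and> t n = b \<and> mono_on {..n} t \<and> t ` {..n} \<subseteq> {s..b} \<and>
      (\<forall>i<n. \<exists>T\<in>\<T>'. t i \<in> T \<and> t (Suc i) \<in> T)"
    proof (rule less.hyps)
      show "finite \<T>'" using less.prems(1) by (simp add: \<T>'_def)
      show "closed T'" if "T' \<in> \<T>'" for T' using less.prems(2) that by (simp add: \<T>'_def)
    qed (use sb cov in auto)
    then obtain n t where t: "t 0 = s" "t n = b" "mono_on {..n} t" "t ` {..n} \<subseteq> {s..b}"
      "\<forall>i<n. \<exists>T\<in>\<T>'. t i \<in> T \<and> t (Suc i) \<in> T"
      by (elim exE conjE)
    define t' where "t' i = (case i of 0 \<Rightarrow> a | Suc j \<Rightarrow> t j)" for i
    have as: "a \<le> s" using s(1) by simp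
    have ge: "a \<le> t j \<and> t j \<le> b" if "j \<le> n" for j using t(4) that as by fastforce
    have "mono_on {..Suc n} t'"
    proof (rule mono_onI)
      fix i j assume "i \<in> {..Suc n}" "j \<in> {..Suc n}" "i \<le> j"
      then show "t' i \<le> t' j" using mono_onD[OF t(3)] ge less.prems(3)
        by (auto simp: t'_def split: nat.splits)
    qed
    moreover have "t' ` {..Suc n} \<subseteq> {a..b}" using ge less.prems(3) by (auto simp: t'_def split: nat.splits)
    moreover have "\<exists>T\<in>\<T>. t' i \<in> T \<and> t' (Suc i) \<in> T" if "i < Suc n" for i
    proof (cases i)
      case 0
      then show ?thesis using T s(1) t(1) by (auto simp: t'_def)
    next
      case (Suc j)
      then show ?thesis using t(5)[rule_format, of j] that by (auto simp: t'_def \<T>'_def)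
    qed
    moreover have "t' 0 = a" "t' (Suc n) = b" using t(2) by (auto simp: t'_def)
    ultimately show ?thesis by blast
  qed
qed

section \<open>From simplices to cones\<close>

text \<open>The pieces are the simplices of a polyhedral space, each flat near \<open>x\<close>. The intersection
  property is used to see that dilations in different pieces agree.\<close>
locale conic_pieces = Metric_space +
  fixes \<S> :: "'a set set" and x :: 'a and r :: real
  assumes piece_sub: "S \<in> \<S> \<Longrightarrow> S \<subseteq> M"
    and pieces_finite: "finite \<S>"
    and piece_closed: "S \<in> \<S> \<Longrightarrow> closedin mtopology S"
    and pieces_cover: "M \<subseteq> \<Union>\<S>"
    and piece_Int: "S \<in> \<S> \<Longrightarrow> T \<in> \<S> \<Longrightarrow> S \<inter> T \<noteq> {} \<Longrightarrow> S \<inter> T \<in> \<S>"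
    and x_in: "x \<in> M" and r_pos: "0 < r"
    and piece_near: "S \<in> \<S> \<Longrightarrow> y \<in> S \<Longrightarrow> d x y < r \<Longrightarrow> x \<in> S"
    and piece_conic: "S \<in> \<S> \<Longrightarrow> x \<in> S \<Longrightarrow> Metric_space.conic S d x r"
begin

text \<open>The dilation is taken in a piece, since the whole space is not yet known to be conic.\<close>
definition dilate :: "real \<Rightarrow> 'a \<Rightarrow> 'a" where
  "dilate t y = Metric_space.dil (SOME S. S \<in> \<S> \<and> y \<in> S) d x t y"

lemma piece_metric: "S \<in> \<S> \<Longrightarrow> Metric_space S d"
  using subspace piece_sub by blast

lemma piece_ball: "S \<in> \<S> \<Longrightarrow> x \<in> S \<Longrightarrow> y \<in> S \<Longrightarrow> d x y < r \<Longrightarrow> y \<in> Metric_space.mball S d x r"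
  using Metric_space.in_mball[OF piece_metric] by simp

text \<open>Dilations in two pieces agree with the one in their intersection, because they are determined by
  distances.\<close>
lemma dilate_eq:
  assumes S: "S \<in> \<S>" "y \<in> S" and y: "d x y < r" and t: "0 \<le> t" "t * d x y < r"
  shows "dilate t y = Metric_space.dil S d x t y"
proof -
  have agree: "Metric_space.dil (S1 \<inter> S2) d x t y = Metric_space.dil S1 d x t y"
    if S12: "S1 \<in> \<S>" "S2 \<in> \<S>" "y \<in> S1" "y \<in> S2" for S1 S2
  proof -
    have xS: "x \<in> S1" "x \<in> S2" using piece_near S12 y by blast+
    have I: "S1 \<inter> S2 \<in> \<S>" using piece_Int S12 by blast
    define w where "w = Metric_space.dil (S1 \<inter> S2) d x t y"
    have c: "Metric_space.conic (S1 \<inter> S2) d x r" using piece_conic[OF I] xS by blast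
    have b: "y \<in> Metric_space.mball (S1 \<inter> S2) d x r" using piece_ball[OF I] xS S12 y by blast
    have w: "w \<in> S1 \<inter> S2" "d x w = t * d x y" "d y w = \<bar>1 - t\<bar> * d x y"
      unfolding w_def using Metric_space.dil_in_M[OF piece_metric[OF I] c b t]
        Metric_space.dil_dist_center[OF piece_metric[OF I] c b t]
        Metric_space.dil_dist_self[OF piece_metric[OF I] c b t] by blast+
    have "w = Metric_space.dil S1 d x t y"
      using w commute[of w y]
      by (intro Metric_space.dil_unique[OF piece_metric[OF S12(1)] piece_conic[OF S12(1) xS(1)]
            piece_ball[OF S12(1) xS(1) S12(3) y] t]) auto
    then show ?thesis by (simp add: w_def)
  qed
  define S0 where "S0 = (SOME S. S \<in> \<S> \<and> y \<in> S)"
  have S0: "S0 \<in> \<S>" "y \<in> S0" unfolding S0_def using S someI[of "\<lambda>S. S \<in> \<S> \<and> y \<in> S"] by blast+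
  show ?thesis
    using agree[OF S(1) S0(1) S(2) S0(2)] agree[OF S0(1) S(1) S0(2) S(2)]
    by (simp add: dilate_def S0_def[symmetric] Int_commute)
qed

context
  fixes S assumes S: "S \<in> \<S>"
begin

lemma dilate_in_piece:
  assumes "y \<in> S" "d x y < r" "0 \<le> t" "t * d x y < r"
  shows "dilate t y \<in> S"
proof -
  have xS: "x \<in> S" using piece_near S assms by blast
  show ?thesis unfolding dilate_eq[OF S assms]
    by (rule Metric_space.dil_in_M[OF piece_metric[OF S] piece_conic[OF S xS] piece_ball[OF S xS assms(1,2)] assms(3,4)])
qed

lemma dilate_law:
  assumes y: "y \<in> S" "d x y < r" "0 \<le> s" "s * d x y < r" and z: "z \<in> S" "d x z < r" "0 \<le> t" "t * d x z < r"
  shows "(d (dilate s y) (dilate t z))\<^sup>2 =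
    s\<^sup>2 * (d x y)\<^sup>2 + t\<^sup>2 * (d x z)\<^sup>2 - s * t * ((d x y)\<^sup>2 + (d x z)\<^sup>2 - (d y z)\<^sup>2)"
proof -
  have xS: "x \<in> S" using piece_near S y by blast
  show ?thesis unfolding dilate_eq[OF S y] dilate_eq[OF S z]
    by (rule Metric_space.dil_law[OF piece_metric[OF S] piece_conic[OF S xS]
          piece_ball[OF S xS y(1,2)] piece_ball[OF S xS z(1,2)] y(3) z(3) y(4) z(4)])
qed

end

lemma piece_ex: "y \<in> M \<Longrightarrow> \<exists>S\<in>\<S>. y \<in> S"
  using pieces_cover by blast

lemma dilate_props:
  assumes y: "y \<in> M" "d x y < r" and t: "0 \<le> t" "t * d x y < r"
  shows "dilate t y \<in> M" "d x (dilate t y) = t * d x y" "dilate 1 y = y"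
    "0 \<le> s \<Longrightarrow> s * (t * d x y) < r \<Longrightarrow> dilate s (dilate t y) = dilate (s * t) y"
proof -
  obtain S where S: "S \<in> \<S>" "y \<in> S" using piece_ex[OF y(1)] by blast
  have xS: "x \<in> S" using piece_near S y by blast
  note m = piece_metric[OF S(1)] and c = piece_conic[OF S(1) xS] and b = piece_ball[OF S(1) xS S(2) y(2)]
  note e = dilate_eq[OF S y(2)]
  show "dilate t y \<in> M" using dilate_in_piece[OF S y(2) t] piece_sub[OF S(1)] by blast
  show dx: "d x (dilate t y) = t * d x y" unfolding e[OF t] by (rule Metric_space.dil_dist_center[OF m c b t])
  show "dilate 1 y = y" using e[of 1] y Metric_space.dil_1[OF m S(2)] by simp
  assume s: "0 \<le> s" "s * (t * d x y) < r"
  have "dilate s (dilate t y) = Metric_space.dil S d x s (dilate t y)"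
    using dx s t by (intro dilate_eq[OF S(1) dilate_in_piece[OF S y(2) t]]) auto
  also have "\<dots> = Metric_space.dil S d x (s * t) y"
    unfolding e[OF t] using s Metric_space.dil_dil[OF m c b t s(1)] by (simp add: mult.assoc)
  also have "\<dots> = dilate (s * t) y" using e[of "s * t"] s t by (simp add: mult.assoc)
  finally show "dilate s (dilate t y) = dilate (s * t) y" .
qed

definition \<rho> :: real where "\<rho> = r / 2"

definition directions :: "'a set" where "directions = {u\<in>M. d x u = \<rho>}"

definition link :: "'a \<Rightarrow> 'a \<Rightarrow> bool" where "link y z \<longleftrightarrow> (\<exists>S\<in>\<S>. y \<in> S \<and> z \<in> S)"

definition polar :: "real \<Rightarrow> 'a \<Rightarrow> 'a" where "polar a u = dilate (a / \<rho>) u"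

definition ang :: "'a \<Rightarrow> 'a \<Rightarrow> real" where
  "ang u v = arccos ((2 * \<rho>\<^sup>2 - (d u v)\<^sup>2) / (2 * \<rho>\<^sup>2))"

text \<open>A sequence of directions in which neighbours span a flat triangle with \<open>x\<close>; the number is its
  total angle at \<open>x\<close>.\<close>
inductive fan :: "'a \<Rightarrow> real \<Rightarrow> 'a \<Rightarrow> bool" for u where
  fan_base: "u \<in> directions \<Longrightarrow> fan u 0 u"
| fan_step: "fan u \<alpha> w \<Longrightarrow> v \<in> directions \<Longrightarrow> link w v \<Longrightarrow> fan u (\<alpha> + ang w v) v"

text \<open>The distance in the base of the cone. Without fans between \<open>u\<close> and \<open>v\<close>, or if all are wide, it is
  \<open>\<pi>\<close>: then the shortest path runs through \<open>x\<close>.\<close>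
definition \<theta> :: "'a \<Rightarrow> 'a \<Rightarrow> real" where
  "\<theta> u v = Inf (insert pi {\<alpha>. fan u \<alpha> v})"

lemma \<rho>_pos: "0 < \<rho>" and \<rho>_less: "\<rho> < r" using r_pos by (auto simp: \<rho>_def)

lemma directions_D: "u \<in> directions \<Longrightarrow> u \<in> M \<and> d x u = \<rho>" by (simp add: directions_def)

lemma polar_props:
  assumes u: "u \<in> directions" and a: "0 \<le> a" "a < r"
  shows "polar a u \<in> M" "d x (polar a u) = a"
  unfolding polar_def using dilate_props(1,2)[of u "a / \<rho>"] directions_D[OF u] \<rho>_pos \<rho>_less a by auto

lemma cos_ang:
  assumes "u \<in> directions" "v \<in> directions"
  shows "2 * \<rho>\<^sup>2 * cos (ang u v) = 2 * \<rho>\<^sup>2 - (d u v)\<^sup>2" and "0 \<le> ang u v" "ang u v \<le> pi"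
proof -
  have "d u v \<le> 2 * \<rho>" using triangle''[of u x v] directions_D[OF assms(1)] directions_D[OF assms(2)] x_in by simp
  then have "(d u v)\<^sup>2 \<le> (2 * \<rho>)\<^sup>2" by (intro power_mono) auto
  then have le: "(d u v)\<^sup>2 \<le> 4 * \<rho>\<^sup>2" by (simp add: power_mult_distrib)
  have p: "0 < 2 * \<rho>\<^sup>2" using \<rho>_pos by simp
  have "- 1 \<le> (2 * \<rho>\<^sup>2 - (d u v)\<^sup>2) / (2 * \<rho>\<^sup>2)"
    unfolding pos_le_divide_eq[OF p] using le by linarith
  moreover have "(2 * \<rho>\<^sup>2 - (d u v)\<^sup>2) / (2 * \<rho>\<^sup>2) \<le> 1"
    unfolding pos_divide_le_eq[OF p] using zero_le_power2[of "d u v"] by linarith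
  ultimately show "2 * \<rho>\<^sup>2 * cos (ang u v) = 2 * \<rho>\<^sup>2 - (d u v)\<^sup>2" "0 \<le> ang u v" "ang u v \<le> pi"
    using \<rho>_pos by (simp_all add: ang_def cos_arccos arccos_lbound arccos_ubound)
qed

lemma dist_polar_link:
  assumes u: "u \<in> directions" "v \<in> directions" "link u v" and a: "0 \<le> a" "a < r" and b: "0 \<le> b" "b < r"
  shows "d (polar a u) (polar b v) = cone_chord a b (ang u v)"
proof -
  obtain S where S: "S \<in> \<S>" "u \<in> S" "v \<in> S" using u(3) by (auto simp: link_def)
  note D = directions_D[OF u(1)] directions_D[OF u(2)]
  have "(d (polar a u) (polar b v))\<^sup>2
      = (a / \<rho>)\<^sup>2 * \<rho>\<^sup>2 + (b / \<rho>)\<^sup>2 * \<rho>\<^sup>2 - (a / \<rho>) * (b / \<rho>) * (2 * \<rho>\<^sup>2 - (d u v)\<^sup>2)"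
    using dilate_law[OF S(1,2) _ _ _ S(3), of "a / \<rho>" "b / \<rho>"] D \<rho>_pos \<rho>_less a b
    by (simp add: polar_def)
  also have "\<dots> = a\<^sup>2 + b\<^sup>2 - 2 * a * b * cos (ang u v)"
    unfolding cos_ang(1)[OF u(1,2), symmetric] using \<rho>_pos by (simp add: power2_eq_square field_simps)
  also have "\<dots> = (cone_chord a b (ang u v))\<^sup>2" using cone_chord_sq[OF a(1) b(1)] by simp
  finally show ?thesis by (rule power2_eq_imp_eq[OF _ nonneg cone_chord_nonneg[OF a(1) b(1)]])
qed

lemma link_refl: "y \<in> M \<Longrightarrow> link y y" using piece_ex by (auto simp: link_def)

lemma link_sym: "link y z \<Longrightarrow> link z y" by (auto simp: link_def)

lemma ang_refl: "u \<in> directions \<Longrightarrow> ang u u = 0"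
  using directions_D[of u] \<rho>_pos by (simp add: ang_def)

lemma ang_sym: "ang u v = ang v u" by (simp add: ang_def commute)

lemma fan_directions: "fan u \<alpha> v \<Longrightarrow> u \<in> directions \<and> v \<in> directions \<and> 0 \<le> \<alpha>"
  by (induction rule: fan.induct) (auto intro: add_nonneg_nonneg cos_ang(2))

lemma fan_trans: "fan v \<beta> w \<Longrightarrow> fan u \<alpha> v \<Longrightarrow> fan u (\<alpha> + \<beta>) w"
proof (induction rule: fan.induct)
  case (fan_step \<beta> w' w)
  then show ?case using fan.fan_step[of u "\<alpha> + \<beta>" w' w] by (simp add: add.assoc)
qed simp

lemma fan_link: "u \<in> directions \<Longrightarrow> v \<in> directions \<Longrightarrow> link u v \<Longrightarrow> fan u (ang u v) v"
  using fan_step[OF fan_base, of u v] by simp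

lemma fan_sym: "fan u \<alpha> v \<Longrightarrow> fan v \<alpha> u"
proof (induction rule: fan.induct)
  case fan_base
  then show ?case by (rule fan.fan_base)
next
  case (fan_step \<alpha> w v)
  then have "w \<in> directions" using fan_directions by blast
  then have "fan v (ang w v) w"
    using fan_link[OF fan_step.hyps(2) _ link_sym[OF fan_step.hyps(3)]] ang_sym[of v w] by simp
  from fan_trans[OF fan_step.IH this] show ?case by (simp add: add.commute)
qed

lemma \<theta>_bdd: "bdd_below (insert pi {\<alpha>. fan u \<alpha> v})"
  by (rule bdd_belowI[of _ 0]) (auto dest: fan_directions)

lemma \<theta>_nonneg: "0 \<le> \<theta> u v"
  unfolding \<theta>_def by (rule cInf_greatest) (auto dest: fan_directions)

lemma \<theta>_le_pi: "\<theta> u v \<le> pi"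
  unfolding \<theta>_def by (rule cInf_lower[OF _ \<theta>_bdd]) simp

lemma \<theta>_le_fan: "fan u \<alpha> v \<Longrightarrow> \<theta> u v \<le> \<alpha>"
  unfolding \<theta>_def by (rule cInf_lower[OF _ \<theta>_bdd]) simp

lemma \<theta>_approx: "\<theta> u v < c \<Longrightarrow> c \<le> pi \<Longrightarrow> \<exists>\<alpha><c. fan u \<alpha> v"
  using cInf_lessD[of "insert pi {\<alpha>. fan u \<alpha> v}" c] by (auto simp: \<theta>_def)

lemma \<theta>_refl: "u \<in> directions \<Longrightarrow> \<theta> u u = 0"
  using \<theta>_le_fan[OF fan_base] \<theta>_nonneg[of u u] by force

lemma \<theta>_sym: "\<theta> u v = \<theta> v u"
proof -
  have "{\<alpha>. fan u \<alpha> v} = {\<alpha>. fan v \<alpha> u}" using fan_sym by blast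
  then show ?thesis by (simp add: \<theta>_def)
qed

lemma \<theta>_triangle: "\<theta> u w \<le> \<theta> u v + \<theta> v w"
proof (rule ccontr)
  assume "\<not> ?thesis"
  then have *: "\<theta> u v + \<theta> v w < \<theta> u w" by simp
  define \<delta> where "\<delta> = (\<theta> u w - \<theta> u v - \<theta> v w) / 2"
  have \<delta>: "0 < \<delta>" "\<theta> u v + \<delta> + (\<theta> v w + \<delta>) = \<theta> u w" using * by (auto simp: \<delta>_def)
  have le: "\<theta> u v + \<delta> \<le> pi" "\<theta> v w + \<delta> \<le> pi"
    using \<delta> \<theta>_nonneg[of u v] \<theta>_nonneg[of v w] \<theta>_le_pi[of u w] by linarith+
  obtain \<alpha> \<beta> where "\<alpha> < \<theta> u v + \<delta>" "fan u \<alpha> v" "\<beta> < \<theta> v w + \<delta>" "fan v \<beta> w"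
    using \<theta>_approx[OF _ le(1), of u v] \<theta>_approx[OF _ le(2), of v w] \<delta>(1) by auto
  then show False using \<theta>_le_fan[OF fan_trans, of v \<beta> w u \<alpha>] \<delta>(2) by linarith
qed

text \<open>Unfold the fan into the plane triangle by triangle: the straight segment crosses each common ray at
  some distance \<open>c\<close> from \<open>x\<close>, and the corresponding points form a path in the space.\<close>
lemma dist_polar_le_fan:
  assumes "fan u \<alpha> v" "\<alpha> < pi" "0 \<le> a" "a < r" "0 \<le> b" "b < r"
  shows "d (polar a u) (polar b v) \<le> cone_chord a b \<alpha>"
  using assms
proof (induction arbitrary: b rule: fan.induct)
  case fan_base
  have "link u u" using link_refl directions_D[OF fan_base(1)] by blast
  then show ?case
    using dist_polar_link[OF fan_base(1,1) _ fan_base(3,4,5,6)] ang_refl[OF fan_base(1)] by simp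
next
  case (fan_step \<alpha> w v)
  have D: "u \<in> directions" "w \<in> directions" "0 \<le> \<alpha>" using fan_directions[OF fan_step(1)] by auto
  have ang: "0 \<le> ang w v" using cos_ang(2)[OF D(2) fan_step(2)] .
  obtain c where c: "0 \<le> c" "c \<le> max a b"
    "cone_chord a c \<alpha> + cone_chord c b (ang w v) = cone_chord a b (\<alpha> + ang w v)"
    using cone_chord_crossing[OF fan_step.prems(2,4) D(3) ang fan_step.prems(1)] by blast
  have cr: "c < r" using c fan_step.prems by auto
  have "d (polar a u) (polar b v) \<le> d (polar a u) (polar c w) + d (polar c w) (polar b v)"
    using D fan_step.prems fan_step(2) c(1) cr by (intro triangle polar_props) auto
  also have "d (polar a u) (polar c w) \<le> cone_chord a c \<alpha>"
    using fan_step.prems c(1) cr ang by (intro fan_step.IH) auto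
  also have "d (polar c w) (polar b v) = cone_chord c b (ang w v)"
    using dist_polar_link[OF D(2) fan_step(2,3) c(1) cr] fan_step.prems by simp
  finally show ?case using c(3) by simp
qed

lemma dist_polar_le:
  assumes u: "u \<in> directions" "v \<in> directions" and a: "0 \<le> a" "a < r" and b: "0 \<le> b" "b < r"
  shows "d (polar a u) (polar b v) \<le> cone_chord a b (\<theta> u v)"
proof (cases "\<theta> u v = pi")
  case True
  have "d (polar a u) (polar b v) \<le> a + b"
    using triangle''[of "polar a u" x "polar b v"] polar_props[OF u(1) a] polar_props[OF u(2) b] x_in by simp
  then show ?thesis using cone_chord_pi[OF a(1) b(1)] True by simp
next
  case False
  then have lt: "\<theta> u v < pi" using \<theta>_le_pi[of u v] by simp
  show ?thesis
  proof (rule ccontr)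
    assume "\<not> ?thesis"
    then have "cone_chord a b (\<theta> u v) < d (polar a u) (polar b v)" by simp
    moreover have "isCont (cone_chord a b) (\<theta> u v)" unfolding cone_chord_def by (intro continuous_intros)
    ultimately have "eventually (\<lambda>t. cone_chord a b t < d (polar a u) (polar b v)) (at (\<theta> u v))"
      unfolding isCont_def using order_tendstoD(2) by blast
    then obtain \<delta> where \<delta>: "0 < \<delta>"
      "\<And>t. t \<noteq> \<theta> u v \<Longrightarrow> dist t (\<theta> u v) < \<delta> \<Longrightarrow> cone_chord a b t < d (polar a u) (polar b v)"
      unfolding eventually_at by blast
    obtain \<alpha> where \<alpha>: "\<alpha> < min pi (\<theta> u v + \<delta>)" "fan u \<alpha> v"
      using \<theta>_approx[of u v "min pi (\<theta> u v + \<delta>)"] \<delta>(1) lt by auto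
    have "\<theta> u v \<le> \<alpha>" using \<theta>_le_fan[OF \<alpha>(2)] .
    have "d (polar a u) (polar b v) \<le> cone_chord a b \<alpha>"
      using dist_polar_le_fan[OF \<alpha>(2) _ a b] \<alpha>(1) by simp
    moreover have "cone_chord a b \<alpha> < d (polar a u) (polar b v)"
      using \<delta>(2)[of \<alpha>] \<alpha>(1) \<open>\<theta> u v \<le> \<alpha>\<close> \<open>cone_chord a b (\<theta> u v) < d (polar a u) (polar b v)\<close>
      by (cases "\<alpha> = \<theta> u v") (auto simp: dist_real_def)
    ultimately show False by simp
  qed
qed

text \<open>The value at \<open>x\<close> is a default: the length of a chord from the apex does not depend on the
  angle.\<close>
definition direction :: "'a \<Rightarrow> 'a" where
  "direction y = (if y = x then SOME u. u \<in> directions else dilate (\<rho> / d x y) y)"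

lemma direction_props:
  assumes y: "y \<in> M" "d x y < r" "y \<noteq> x"
  shows "direction y \<in> directions" "polar (d x y) (direction y) = y"
proof -
  have p: "0 < d x y" using y x_in by (metis mdist_pos_less)
  have b: "0 \<le> \<rho> / d x y" "\<rho> / d x y * d x y < r" using p \<rho>_pos \<rho>_less by auto
  note sp = dilate_props[OF y(1,2) b]
  show "direction y \<in> directions" using sp(1,2) p y(3) by (simp add: direction_def directions_def)
  have "dilate (d x y / \<rho>) (dilate (\<rho> / d x y) y) = dilate (d x y / \<rho> * (\<rho> / d x y)) y"
    using sp(4)[of "d x y / \<rho>"] p \<rho>_pos y(2) by simp
  then show "polar (d x y) (direction y) = y" using y(3) p \<rho>_pos sp(3) by (simp add: polar_def direction_def)
qed

lemma direction_polar:
  assumes u: "u \<in> directions" and a: "0 < a" "a < r"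
  shows "direction (polar a u) = u"
proof -
  note p = polar_props[OF u _ a(2)]
  have "polar a u \<noteq> x" using p(2) a x_in by auto
  then have "direction (polar a u) = dilate (\<rho> / a) (dilate (a / \<rho>) u)" using p(2) a by (simp add: direction_def polar_def)
  also have "\<dots> = dilate (\<rho> / a * (a / \<rho>)) u"
    using dilate_props(4)[of u "a / \<rho>" "\<rho> / a"] directions_D[OF u] \<rho>_pos \<rho>_less a by simp
  also have "\<dots> = u" using dilate_props(3)[of u 1] directions_D[OF u] \<rho>_pos \<rho>_less a by simp
  finally show ?thesis .
qed

text \<open>The distance that the cone over \<open>\<theta>\<close> would assign.\<close>
definition chord :: "'a \<Rightarrow> 'a \<Rightarrow> real" where
  "chord y z = cone_chord (d x y) (d x z) (\<theta> (direction y) (direction z))"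

lemma chord_triangle: "chord y z \<le> chord y w + chord w z"
  unfolding chord_def cone_chord_def
  using \<theta>_nonneg \<theta>_le_pi \<theta>_triangle by (intro cone_triangle) auto

lemma chord_le_link:
  assumes y: "y \<in> M" "d x y < r" and z: "z \<in> M" "d x z < r" and l: "link y z"
  shows "chord y z \<le> d y z"
proof (cases "y = x \<or> z = x")
  case True
  then show ?thesis
    using x_in commute[of y x] by (auto simp: chord_def cone_chord_0_left cone_chord_0_right)
next
  case False
  note Y = direction_props[OF y] and Z = direction_props[OF z]
  obtain S where S: "S \<in> \<S>" "y \<in> S" "z \<in> S" using l by (auto simp: link_def)
  have p: "0 < d x y" "0 < d x z" using y z x_in False by (metis mdist_pos_less)+
  have "direction y \<in> S" "direction z \<in> S"
    unfolding direction_def using False dilate_in_piece[OF S(1,2) y(2)] dilate_in_piece[OF S(1,3) z(2)] p \<rho>_pos \<rho>_less by auto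
  then have ld: "link (direction y) (direction z)" using S(1) by (auto simp: link_def)
  have D: "direction y \<in> directions" "direction z \<in> directions" using Y Z False by auto
  have "chord y z \<le> cone_chord (d x y) (d x z) (ang (direction y) (direction z))"
    unfolding chord_def using \<theta>_le_fan[OF fan_link[OF D ld]] \<theta>_nonneg cos_ang(3)[OF D]
    by (intro cone_chord_mono) auto
  also have "\<dots> = d (polar (d x y) (direction y)) (polar (d x z) (direction z))"
    using dist_polar_link[OF D ld] y z by simp
  also have "\<dots> = d y z" using Y Z False by simp
  finally show ?thesis .
qed

text \<open>Otherwise some curve is shorter than the chord. Such a curve stays within radius \<open>r\<close> of \<open>x\<close>, so it
  can be cut at finitely many points into parts with ends in a common piece. For each part the chord
  is at most the distance, and chords satisfy the triangle inequality.\<close>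
lemma chord_le_dist:
  assumes len: "length_space M d" and y: "y \<in> M" "d x y < \<rho>" and z: "z \<in> M" "d x z < \<rho>"
  shows "chord y z \<le> d y z"
proof (rule ccontr)
  assume "\<not> ?thesis"
  then have "ereal (d y z) < ereal (chord y z)" by simp
  also have "ereal (d y z) = Inf {curve_length d \<gamma> | \<gamma>. pathin mtopology \<gamma> \<and> \<gamma> 0 = y \<and> \<gamma> 1 = z}"
    using len y z by (simp add: length_space_def)
  finally obtain \<gamma> where \<gamma>: "pathin mtopology \<gamma>" "\<gamma> 0 = y" "\<gamma> 1 = z" "curve_length d \<gamma> < ereal (chord y z)"
    unfolding Inf_less_iff by blast
  have len_le: "(\<Sum>i<n. d (\<gamma> (t i)) (\<gamma> (t (Suc i)))) < chord y z"
    if "mono_on {..n} t" "t ` {..n} \<subseteq> {0..1}" for n and t :: "nat \<Rightarrow> real"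
  proof -
    have "ereal (\<Sum>i<n. d (\<gamma> (t i)) (\<gamma> (t (Suc i)))) \<le> curve_length d \<gamma>"
      unfolding curve_length_def using that by (intro SUP_upper2[of "(n, t)"]) auto
    then have "ereal (\<Sum>i<n. d (\<gamma> (t i)) (\<gamma> (t (Suc i)))) < ereal (chord y z)" using \<gamma>(4) by (rule le_less_trans)
    then show ?thesis by simp
  qed
  have cont: "continuous_map (top_of_set {0..1}) mtopology \<gamma>" using \<gamma>(1) by (simp add: pathin_def)
  have \<gamma>M: "\<gamma> s \<in> M" if "s \<in> {0..1}" for s
    using continuous_map_image_subset_topspace[OF cont] that by auto
  have "chord y z \<le> cone_chord (d x y) (d x z) pi"
    unfolding chord_def using \<theta>_nonneg \<theta>_le_pi by (intro cone_chord_mono) auto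
  then have chord_le: "chord y z \<le> d x y + d x z" by (simp add: cone_chord_pi)
  have near: "d x (\<gamma> s) < r" if s: "s \<in> {0..1}" for s
  proof -
    define t where "t i = (if i = 0 then 0 else if i = 1 then s else 1 :: real)" for i :: nat
    have "mono_on {..2} t" using s by (auto simp: mono_on_def t_def)
    moreover have "t ` {..2} \<subseteq> {0..1}" using s by (auto simp: t_def)
    ultimately have "(\<Sum>i<2. d (\<gamma> (t i)) (\<gamma> (t (Suc i)))) < chord y z" by (rule len_le)
    then have "d y (\<gamma> s) + d (\<gamma> s) z < chord y z" using \<gamma>(2,3) by (simp add: t_def numeral_2_eq_2)
    moreover have "d x (\<gamma> s) \<le> d x y + d y (\<gamma> s)" using triangle[OF x_in y(1) \<gamma>M[OF s]] .
    moreover have "d x (\<gamma> s) \<le> d x z + d (\<gamma> s) z" using triangle'[OF x_in z(1) \<gamma>M[OF s]] .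
    ultimately have "d x (\<gamma> s) < d x y + d x z" using chord_le by linarith
    then show ?thesis using y(2) z(2) by (simp add: \<rho>_def)
  qed
  define \<T> where "\<T> = (\<lambda>S. {s\<in>{0..1}. \<gamma> s \<in> S}) ` \<S>"
  have fin: "finite \<T>" using pieces_finite by (simp add: \<T>_def)
  have clo: "closed T" if T: "T \<in> \<T>" for T
  proof -
    obtain S where S: "S \<in> \<S>" "T = {s\<in>{0..1}. \<gamma> s \<in> S}" using T by (auto simp: \<T>_def)
    have "closedin (top_of_set {0..1}) {s \<in> topspace (top_of_set {0..1}). \<gamma> s \<in> S}"
      by (rule closedin_continuous_map_preimage[OF cont piece_closed[OF S(1)]])
    then have "closedin (top_of_set {0..1}) T" using S(2) by simp
    then show ?thesis using closedin_closed_trans closed_atLeastAtMost by blast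
  qed
  have cov: "{0..1} \<subseteq> \<Union>\<T>" using piece_ex \<gamma>M by (force simp: \<T>_def)
  obtain n t where t: "t 0 = (0::real)" "t n = 1" "mono_on {..n} t" "t ` {..n} \<subseteq> {0..1}"
    "\<And>i. i < n \<Longrightarrow> \<exists>T\<in>\<T>. t i \<in> T \<and> t (Suc i) \<in> T"
    using closed_cover_chain[OF fin clo _ cov] by auto
  have step: "chord (\<gamma> (t i)) (\<gamma> (t (Suc i))) \<le> d (\<gamma> (t i)) (\<gamma> (t (Suc i)))" if i: "i < n" for i
  proof -
    obtain S where "S \<in> \<S>" "\<gamma> (t i) \<in> S" "\<gamma> (t (Suc i)) \<in> S"
      using t(5)[OF i] by (auto simp: \<T>_def)
    then have "link (\<gamma> (t i)) (\<gamma> (t (Suc i)))" by (auto simp: link_def)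
    moreover have "t i \<in> {0..1}" "t (Suc i) \<in> {0..1}"
      using t(4) i by (auto simp: image_subset_iff)
    ultimately show ?thesis using \<gamma>M near by (intro chord_le_link) auto
  qed
  have "chord y (\<gamma> (t m)) \<le> (\<Sum>i<m. d (\<gamma> (t i)) (\<gamma> (t (Suc i))))" if "m \<le> n" for m
    using that
  proof (induction m)
    case 0
    show ?case
      using chord_le_link[OF y(1) _ y(1) _ link_refl[OF y(1)]] y \<rho>_less t(1) \<gamma>(2) by simp
  next
    case (Suc m)
    have "chord y (\<gamma> (t (Suc m))) \<le> chord y (\<gamma> (t m)) + chord (\<gamma> (t m)) (\<gamma> (t (Suc m)))"
      by (rule chord_triangle)
    then show ?case using Suc step[of m] by simp
  qed
  then have "chord y z \<le> (\<Sum>i<n. d (\<gamma> (t i)) (\<gamma> (t (Suc i))))" using t(2) \<gamma>(3) by force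
  then show False using len_le[OF t(3,4)] by simp
qed

lemma dist_polar:
  assumes len: "length_space M d"
    and u: "u \<in> directions" "v \<in> directions" and a: "0 \<le> a" "a < \<rho>" and b: "0 \<le> b" "b < \<rho>"
  shows "d (polar a u) (polar b v) = cone_chord a b (\<theta> u v)"
proof (rule antisym)
  have ar: "a < r" "b < r" using a b \<rho>_less by auto
  show "d (polar a u) (polar b v) \<le> cone_chord a b (\<theta> u v)"
    by (rule dist_polar_le[OF u a(1) ar(1) b(1) ar(2)])
  note pu = polar_props[OF u(1) a(1) ar(1)] and pv = polar_props[OF u(2) b(1) ar(2)]
  have "cone_chord a b (\<theta> u v) = chord (polar a u) (polar b v)"
  proof (cases "a = 0 \<or> b = 0")
    case True
    then show ?thesis
      using a b by (auto simp: chord_def pu pv cone_chord_0_left cone_chord_0_right)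
  next
    case False
    then show ?thesis using direction_polar[OF u(1) _ ar(1)] direction_polar[OF u(2) _ ar(2)] a b
      by (simp add: chord_def pu pv)
  qed
  also have "\<dots> \<le> d (polar a u) (polar b v)"
    using pu pv a b by (intro chord_le_dist[OF len]) auto
  finally show "cone_chord a b (\<theta> u v) \<le> d (polar a u) (polar b v)" .
qed

lemma cone_base_\<theta>:
  assumes len: "length_space M d"
  shows "cone_base directions \<theta>"
  unfolding cone_base_def
proof (intro conjI ballI)
  show "Metric_space directions \<theta>"
  proof
    show "0 \<le> \<theta> u v" "\<theta> u v = \<theta> v u" for u v by (rule \<theta>_nonneg, rule \<theta>_sym)
    show "\<theta> u w \<le> \<theta> u v + \<theta> v w" for u v w by (rule \<theta>_triangle)
    fix u v assume u: "u \<in> directions" "v \<in> directions"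
    have eq: "u = v" if "\<theta> u v = 0"
    proof -
      have h: "0 \<le> \<rho> / 2" "0 < \<rho> / 2" "\<rho> / 2 < \<rho>" "\<rho> / 2 < r" using \<rho>_pos \<rho>_less by auto
      have "d (polar (\<rho> / 2) u) (polar (\<rho> / 2) v) = 0"
        unfolding dist_polar[OF len u h(1,3) h(1,3)] that cone_chord_zero_angle by simp
      then have e: "polar (\<rho> / 2) u = polar (\<rho> / 2) v"
        using zero[OF polar_props(1)[OF u(1) h(1,4)] polar_props(1)[OF u(2) h(1,4)]] by blast
      have "u = direction (polar (\<rho> / 2) u)" by (rule direction_polar[OF u(1) h(2,4), symmetric])
      also have "\<dots> = v" unfolding e by (rule direction_polar[OF u(2) h(2,4)])
      finally show ?thesis .
    qed
    show "\<theta> u v = 0 \<longleftrightarrow> u = v"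
    proof
      assume "u = v"
      then show "\<theta> u v = 0" using \<theta>_refl[OF u(1)] by simp
    qed (rule eq)
  qed
  show "\<theta> u v \<le> pi" for u v by (rule \<theta>_le_pi)
qed

text \<open>Polar coordinates: a point goes to its distance from \<open>x\<close> and its direction. The ball of radius
  \<open>\<rho>\<close> is mapped isometrically onto the ball of the same radius around the tip, so the map is open.\<close>
theorem cone_embedding_exists:
  assumes len: "length_space M d"
  shows "\<exists>U (\<Sigma> :: 'a set) e \<iota>. neighborhood_of M d x U \<and> cone_base \<Sigma> e \<and>
    open_isometric_embedding U d (cone_space \<Sigma>) (cone_dist e) \<iota> \<and> \<iota> x = cone_tip \<Sigma>"
proof -
  note base = cone_base_\<theta>[OF len]
  define U where "U = mball x \<rho>"
  define Q where "Q a u = cone_rel directions `` {(a, u)}" for a :: real and u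
  define \<iota> where "\<iota> y = (if directions = {} then {} else Q (d x y) (direction y))" for y
  have xU: "x \<in> U" using x_in \<rho>_pos by (simp add: U_def)
  have U: "y \<in> M" "d x y < \<rho>" "d x y < r" if "y \<in> U" for y using that \<rho>_less by (auto simp: U_def)
  have empty: "y = x" if "y \<in> U" "directions = {}" for y
    using direction_props(1)[of y] U[OF that(1)] that(2) by blast
  have dirD: "direction y \<in> directions" if "y \<in> U" "directions \<noteq> {}" for y
    using direction_props(1)[of y] U[OF that(1)] that(2) some_in_eq[of directions] by (cases "y = x") (auto simp: direction_def)
  have pd: "polar (d x y) (direction y) = y" if "y \<in> U" "directions \<noteq> {}" for y
  proof (cases "y = x")
    case True
    have "d x (polar 0 (direction x)) = 0" "polar 0 (direction x) \<in> M"
      using polar_props[OF dirD[OF xU that(2)], of 0] r_pos by auto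
    then show ?thesis using True x_in by simp
  qed (use direction_props U that in auto)
  have dQ: "cone_dist \<theta> (Q a u) (Q b v) = cone_chord a b (\<theta> u v)"
    if "0 \<le> a" "0 \<le> b" "u \<in> directions" "v \<in> directions" for a b u v
    unfolding Q_def cone_chord_def by (rule cone_dist_class[OF base that])
  have tip: "\<iota> x = cone_tip directions"
    using x_in dirD[OF xU] by (auto simp: \<iota>_def Q_def cone_tip_def cone_rel_def)
  have im: "\<iota> y \<in> cone_space directions" if "y \<in> U" for y
    using cone_class_in(1)[OF _ dirD[OF that]] by (auto simp: \<iota>_def Q_def cone_space_empty)
  have iso: "cone_dist \<theta> (\<iota> y) (\<iota> z) = d y z" if yz: "y \<in> U" "z \<in> U" for y z
  proof (cases "directions = {}")
    case True
    then have "y = x" "z = x" using empty yz by blast+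
    then show ?thesis using x_in True by (simp add: \<iota>_def cone_dist_def)
  next
    case False
    have "cone_dist \<theta> (\<iota> y) (\<iota> z) = cone_chord (d x y) (d x z) (\<theta> (direction y) (direction z))"
      using False dirD yz by (simp add: \<iota>_def dQ)
    also have "\<dots> = d (polar (d x y) (direction y)) (polar (d x z) (direction z))"
      using dist_polar[OF len dirD[OF yz(1) False] dirD[OF yz(2) False]] U yz by simp
    also have "\<dots> = d y z" using pd yz False by simp
    finally show ?thesis .
  qed
  interpret U: Metric_space U d using subspace[of U] U(1) by blast
  interpret C: Metric_space "cone_space directions" "cone_dist \<theta>" by (rule Metric_space_cone[OF base])
  have "openin C.mtopology (\<iota> ` W)" if W: "openin U.mtopology W" for W
    unfolding C.openin_mtopology
  proof (intro conjI allI impI)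
    have WU: "W \<subseteq> U" using W U.openin_mtopology by blast
    show "\<iota> ` W \<subseteq> cone_space directions" using im WU by blast
    fix k assume "k \<in> \<iota> ` W"
    then obtain y where y: "y \<in> W" "k = \<iota> y" by blast
    have yU: "y \<in> U" using y WU by blast
    obtain e where e: "0 < e" "U.mball y e \<subseteq> W" using W y(1) unfolding U.openin_mtopology by blast
    define \<epsilon> where "\<epsilon> = min e (\<rho> - d x y)"
    have "C.mball k \<epsilon> \<subseteq> \<iota> ` W"
    proof
      fix p assume "p \<in> C.mball k \<epsilon>"
      then have p: "p \<in> cone_space directions" "cone_dist \<theta> k p < \<epsilon>" by auto
      show "p \<in> \<iota> ` W"
      proof (cases "directions = {}")
        case True
        then have "p = \<iota> y" using p(1) by (simp add: cone_space_empty \<iota>_def)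
        then show ?thesis using y by blast
      next
        case False
        obtain b v where bv: "0 \<le> b" "v \<in> directions" "p = Q b v"
          using cone_space_cases[OF p(1) False] unfolding Q_def by blast
        have "b = cone_dist \<theta> (\<iota> x) p"
          using cone_dist_tip[OF base bv(1,2)] tip bv(3) by (simp add: Q_def)
        also have "\<dots> \<le> cone_dist \<theta> (\<iota> x) (\<iota> y) + cone_dist \<theta> (\<iota> y) p"
          by (rule C.triangle[OF im[OF xU] im[OF yU] p(1)])
        also have "\<dots> < d x y + \<epsilon>" using iso[OF xU yU] p(2) y(2) by simp
        also have "\<dots> \<le> \<rho>" by (simp add: \<epsilon>_def)
        finally have b: "b < \<rho>" "b < r" using \<rho>_less by auto
        define w where "w = polar b v"
        have w: "w \<in> U" "d x w = b" using polar_props[OF bv(2,1) b(2)] b x_in by (auto simp: w_def U_def)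
        have "\<iota> w = p"
        proof (cases "b = 0")
          case True
          then have "w = x" using w U(1)[OF w(1)] x_in by simp
          moreover have "Q 0 v = cone_tip directions" using bv(2) by (auto simp: Q_def cone_tip_def cone_rel_def)
          ultimately show ?thesis using tip bv(3) True by simp
        next
          case b0: False
          then have "direction w = v" unfolding w_def using bv(1) by (intro direction_polar[OF bv(2) _ b(2)]) simp
          then show ?thesis using False w(2) bv(3) by (simp add: \<iota>_def)
        qed
        moreover have "d y w < e" using iso[OF yU w(1)] \<open>\<iota> w = p\<close> p(2) y(2) by (simp add: \<epsilon>_def)
        then have "w \<in> W" using e(2) yU w(1) by auto
        ultimately show ?thesis by blast
      qed
    qed
    moreover have "0 < \<epsilon>" using e(1) U(2)[OF yU] by (simp add: \<epsilon>_def)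
    ultimately show "\<exists>r>0. C.mball k r \<subseteq> \<iota> ` W" by blast
  qed
  then have "open_isometric_embedding U d (cone_space directions) (cone_dist \<theta>) \<iota>"
    using im iso by (auto simp: open_isometric_embedding_def open_map_def)
  moreover have "neighborhood_of M d x U"
    unfolding neighborhood_of_def
  proof (intro conjI exI[of _ U])
    show "openin mtopology U" unfolding U_def by (rule openin_mball)
  qed (use xU U(1) in auto)
  ultimately show ?thesis using base tip
    by (intro exI[of _ U] exI[of _ directions] exI[of _ \<theta>] exI[of _ \<iota>]) simp
qed

end

section \<open>The characterization of polyhedral spaces\<close>

lemma closed_simplex_Int:
  assumes "finite \<sigma>" "finite \<tau>"
  shows "closed_simplex \<sigma> \<inter> closed_simplex \<tau> = closed_simplex (\<sigma> \<inter> \<tau>)"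
proof -
  have *: "sum t \<sigma> = sum t (\<sigma> \<inter> \<tau>)" if "finite \<sigma>" "\<forall>i. i \<notin> \<tau> \<longrightarrow> t i = 0"
    for t :: "nat \<Rightarrow> real" and \<sigma> \<tau> :: "nat set" using that by (intro sum.mono_neutral_right) auto
  show ?thesis
  proof (intro equalityI subsetI)
    fix t assume "t \<in> closed_simplex \<sigma> \<inter> closed_simplex \<tau>"
    then have t: "\<forall>i. 0 \<le> t i" "\<forall>i. i \<notin> \<sigma> \<longrightarrow> t i = 0" "\<forall>i. i \<notin> \<tau> \<longrightarrow> t i = 0" "sum t \<sigma> = 1"
      by (simp_all add: closed_simplex_def)
    have "sum t (\<sigma> \<inter> \<tau>) = 1" using *[OF assms(1) t(3)] t(4) by simp
    then show "t \<in> closed_simplex (\<sigma> \<inter> \<tau>)"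
      unfolding closed_simplex_def using t(1-3) by blast
  next
    fix t assume "t \<in> closed_simplex (\<sigma> \<inter> \<tau>)"
    then have t: "\<forall>i. 0 \<le> t i" "\<forall>i. i \<notin> \<sigma> \<inter> \<tau> \<longrightarrow> t i = 0" "sum t (\<sigma> \<inter> \<tau>) = 1"
      by (simp_all add: closed_simplex_def)
    have z: "\<forall>i. i \<notin> \<sigma> \<longrightarrow> t i = 0" "\<forall>i. i \<notin> \<tau> \<longrightarrow> t i = 0" using t(2) by blast+
    have "sum t \<sigma> = 1" "sum t \<tau> = 1"
      using *[OF assms(1) z(2)] *[OF assms(2) z(1)] t(3) by (simp_all add: Int_commute)
    then show "t \<in> closed_simplex \<sigma> \<inter> closed_simplex \<tau>"
      unfolding closed_simplex_def using t(1) z by blast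
  qed
qed

text \<open>A compatible radius exists because there are finitely many simplices: those that miss \<open>x\<close> are at
  positive distance from it.\<close>
theorem (in Metric_space) polyhedral_imp_locally_cone:
  assumes poly: "polyhedral_space M d" and x: "x \<in> M"
  shows "\<exists>U (\<Sigma> :: 'a set) e \<iota>. neighborhood_of M d x U \<and> cone_base \<Sigma> e \<and>
    open_isometric_embedding U d (cone_space \<Sigma>) (cone_dist e) \<iota> \<and> \<iota> x = cone_tip \<Sigma>"
proof -
  have len: "length_space M d" using poly by (simp add: polyhedral_space_def)
  obtain K h where K: "finite_simplicial_complex K"
    and h: "homeomorphic_map (realization K) mtopology h"
    and iso': "\<forall>\<sigma>\<in>K. isometric_to_Euclidean_simplex (h ` closed_simplex \<sigma>) d"
    using poly unfolding polyhedral_space_def by (elim conjE exE)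
  have iso: "isometric_to_Euclidean_simplex (h ` closed_simplex \<sigma>) d" if "\<sigma> \<in> K" for \<sigma>
    using iso' that by blast
  note complex = K[unfolded finite_simplicial_complex_def]
  note finK = complex[THEN conjunct1] complex[THEN conjunct2, THEN conjunct1]
    and face' = complex[THEN conjunct2, THEN conjunct2]
  have fin: "finite K" "finite \<sigma>" if "\<sigma> \<in> K" for \<sigma> using finK that by blast+
  have face: "\<tau> \<in> K" if "\<sigma> \<in> K" "\<tau> \<subseteq> \<sigma>" "\<tau> \<noteq> {}" for \<sigma> \<tau>
    using face'[rule_format, OF that(1)] that(2,3) by blast
  have top: "topspace (realization K) = (\<Union>\<sigma>\<in>K. closed_simplex \<sigma>)" by (simp add: realization_def)
  have cont: "continuous_map (realization K) mtopology h"
    using h by (rule homeomorphic_imp_continuous_map)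
  have hM: "h ` topspace (realization K) = M" using homeomorphic_imp_surjective_map[OF h] by simp
  have inj: "inj_on h (topspace (realization K))" using h by (rule homeomorphic_imp_injective_map)
  define \<S> where "\<S> = (\<lambda>\<sigma>. h ` closed_simplex \<sigma>) ` K"
  have sub: "S \<subseteq> M" if "S \<in> \<S>" for S using that hM top by (auto simp: \<S>_def)
  have closed: "closedin mtopology S" if S: "S \<in> \<S>" for S
  proof -
    obtain \<sigma> where \<sigma>: "\<sigma> \<in> K" "S = h ` closed_simplex \<sigma>" using S by (auto simp: \<S>_def)
    have "compactin (realization K) (closed_simplex \<sigma>)"
      unfolding realization_def compactin_subtopology
      using compactin_closed_simplex[OF fin(2)[OF \<sigma>(1)]] \<sigma>(1) by blast
    then have "compactin mtopology S" unfolding \<sigma>(2) using cont by (rule image_compactin)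
    then show ?thesis by (rule compactin_imp_closedin[OF Hausdorff_space_mtopology])
  qed
  have Int: "S \<inter> T \<in> \<S>" if ST: "S \<in> \<S>" "T \<in> \<S>" "S \<inter> T \<noteq> {}" for S T
  proof -
    obtain \<sigma> \<tau> where \<sigma>: "\<sigma> \<in> K" "S = h ` closed_simplex \<sigma>" and \<tau>: "\<tau> \<in> K" "T = h ` closed_simplex \<tau>"
      using ST by (auto simp: \<S>_def)
    have "S \<inter> T = h ` (closed_simplex \<sigma> \<inter> closed_simplex \<tau>)"
      unfolding \<sigma>(2) \<tau>(2) using \<sigma>(1) \<tau>(1) top by (intro inj_on_image_Int[OF inj, symmetric]) auto
    also have "\<dots> = h ` closed_simplex (\<sigma> \<inter> \<tau>)"
      by (simp add: closed_simplex_Int fin(2) \<sigma>(1) \<tau>(1))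
    finally have e: "S \<inter> T = h ` closed_simplex (\<sigma> \<inter> \<tau>)" .
    then have "\<sigma> \<inter> \<tau> \<noteq> {}" using ST(3) by (auto simp: closed_simplex_def)
    then have "\<sigma> \<inter> \<tau> \<in> K" using face[OF \<sigma>(1)] by blast
    then show ?thesis unfolding e \<S>_def by blast
  qed
  have finS: "finite \<S>" using finK(1) by (simp add: \<S>_def)
  have "\<exists>r>0. (x \<in> S \<longrightarrow> Metric_space.conic S d x r) \<and> (x \<notin> S \<longrightarrow> disjnt S (mball x r))"
    if S: "S \<in> \<S>" for S
  proof (cases "x \<in> S")
    case True
    have m: "Metric_space S d" using subspace[OF sub[OF S]] .
    have "isometric_to_Euclidean_simplex S d" using S iso by (auto simp: \<S>_def)
    from Euclidean_simplex_conic[OF m this True] obtain r where r: "Metric_space.conic S d x r" by blast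
    then show ?thesis using Metric_space.conic_pos[OF m r] True by blast
  next
    case False
    then show ?thesis using closed[OF S] x unfolding closedin_metric by blast
  qed
  then obtain R where R: "\<And>S. S \<in> \<S> \<Longrightarrow> 0 < R S"
    "\<And>S. S \<in> \<S> \<Longrightarrow> x \<in> S \<Longrightarrow> Metric_space.conic S d x (R S)"
    "\<And>S. S \<in> \<S> \<Longrightarrow> x \<notin> S \<Longrightarrow> disjnt S (mball x (R S))" by metis
  define r where "r = Min (insert 1 (R ` \<S>))"
  have r: "0 < r" "\<And>S. S \<in> \<S> \<Longrightarrow> r \<le> R S" using finS R(1) by (auto simp: r_def)
  have "conic_pieces M d \<S> x r"
  proof (intro conic_pieces.intro conic_pieces_axioms.intro)
    show "Metric_space M d" by unfold_locales
    show "S \<subseteq> M" "closedin mtopology S" if "S \<in> \<S>" for S using sub closed that by blast+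
    show "finite \<S>" "x \<in> M" "0 < r" by fact+
    show "M \<subseteq> \<Union>\<S>" using hM top by (auto simp: \<S>_def)
    show "S \<inter> T \<in> \<S>" if "S \<in> \<S>" "T \<in> \<S>" "S \<inter> T \<noteq> {}" for S T using Int that by blast
    show "x \<in> S" if "S \<in> \<S>" "y \<in> S" "d x y < r" for S y
    proof (rule ccontr)
      assume "x \<notin> S"
      then have "disjnt S (mball x (R S))" using R(3) that(1) by blast
      moreover have "y \<in> mball x (R S)" using r(2)[OF that(1)] that sub x by auto
      ultimately show False using that(2) by (auto simp: disjnt_def)
    qed
    show "Metric_space.conic S d x r" if "S \<in> \<S>" "x \<in> S" for S
      using Metric_space.conic_mono[OF subspace[OF sub[OF that(1)]] R(2)[OF that] r(1) r(2)[OF that(1)]] .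
  qed
  from conic_pieces.cone_embedding_exists[OF this len] show ?thesis .
qed

theorem theorem1p1:
  fixes X :: "'a set" and d :: "'a \<Rightarrow> 'a \<Rightarrow> real"
  assumes "length_space X d" and "compact_space (Metric_space.mtopology X d)"
  shows "polyhedral_space X d \<longleftrightarrow>
    (\<forall>x\<in>X. \<exists>U (\<Sigma> :: 'a set) d\<^sub>\<Sigma> \<iota>.
       neighborhood_of X d x U \<and> cone_base \<Sigma> d\<^sub>\<Sigma> \<and>
       open_isometric_embedding U d (cone_space \<Sigma>) (cone_dist d\<^sub>\<Sigma>) \<iota> \<and>
       \<iota> x = cone_tip \<Sigma>)"
proof -
  interpret Metric_space X d using assms(1) by (simp add: length_space_def)
  show ?thesis
  proof
    assume "polyhedral_space X d"
    then show "\<forall>x\<in>X. \<exists>U (\<Sigma> :: 'a set) d\<^sub>\<Sigma> \<iota>.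
       neighborhood_of X d x U \<and> cone_base \<Sigma> d\<^sub>\<Sigma> \<and>
       open_isometric_embedding U d (cone_space \<Sigma>) (cone_dist d\<^sub>\<Sigma>) \<iota> \<and>
       \<iota> x = cone_tip \<Sigma>"
      by (intro ballI polyhedral_imp_locally_cone)
  next
    assume *: "\<forall>x\<in>X. \<exists>U (\<Sigma> :: 'a set) d\<^sub>\<Sigma> \<iota>.
       neighborhood_of X d x U \<and> cone_base \<Sigma> d\<^sub>\<Sigma> \<and>
       open_isometric_embedding U d (cone_space \<Sigma>) (cone_dist d\<^sub>\<Sigma>) \<iota> \<and>
       \<iota> x = cone_tip \<Sigma>"
    have "\<exists>\<rho>. conic p \<rho>" if p: "p \<in> X" for p
    proof -
      obtain U \<iota> and \<Sigma> :: "'a set" and e where emb: "neighborhood_of X d p U" "cone_base \<Sigma> e"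
        "open_isometric_embedding U d (cone_space \<Sigma>) (cone_dist e) \<iota>" "\<iota> p = cone_tip \<Sigma>"
        using bspec[OF * p] by (elim exE conjE)
      show ?thesis by (rule cone_embedding_imp_conic[OF emb])
    qed
    from locally_conic_imp_triangulated[OF assms(2) this] show "polyhedral_space X d"
      unfolding polyhedral_space_def using assms(1) by (intro conjI)
  qed
qed

end
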